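(* Let $n,p$ be positive integers. The polyharmonic Bergman kernel $R_p$ for $\widehat{B}_p$ is given by $$R_p(x,y)=\frac{1}{n\Omega_n}\sum_{m=0}^{\infty}(n+2m)Z^p_m(x,y)\qquad (x,y\in\widehat{B}_p),$$ where the series converges absolutely and uniformly on $K\times \widehat{B}_p$ for every compact subset $K\subset \widehat{B}_p$.
   Context: Sets: $B$ and $S$ are the open unit ball and the unit sphere of $\mathbb{R}^n$ centred at $0$; $\widehat{B}_p=\bigcup_{k=0}^{p-1}e^{k\pi i/p}B\subset\mathbb{C}^n$, $\widehat{S}_p=\bigcup_{k=0}^{p-1}e^{k\pi i/p}S\subset\mathbb{C}^n$. $\Omega_n=\pi^{n/2}/\Gamma(n/2+1)$ is the volume of $B$, and $\sigma$ is the normalized surface measure on $S$. Polyharmonic functions: a complex-valued analytic function $u$ on $B$ is polyharmonic of order $p$ if $\Delta^p u=0$ on $B$; the space of these is $\mathcal{A}_{\Delta^p}(B)$. Each such $u$ has an expansion $u=\sum_{m\ge 0} q_m$ into homogeneous polynomials $q_m$ of degree $m$, converging on $B$, and is extended holomorphically to rotated balls by $u(e^{i\psi}x)=\sum_m e^{im\psi}q_m(x)$ ($\psi\in\mathbb{R}$, $x\in B$). In this way $u$ is regarded as a function on $\widehat{B}_p$. Bergman space: $b_p^2(\widehat{B}_p)$ is the space of $u\in\mathcal{A}_{\Delta^p}(B)$ (extended to $\widehat{B}_p$) with $\frac1p\sum_{k=0}^{p-1}\int_B|u(e^{k\pi i/p}y)|^2dy<\infty$ (here $|\cdot|$ is the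 modulus), with inner product $\langle u,v\rangle_{b_p^2}=\frac1p\sum_{k=0}^{p-1}\int_B u(e^{k\pi i/p}y)\overline{v(e^{k\pi i/p}y)}\,dy$. It is a Hilbert space on which point evaluations at points of $\widehat{B}_p$ are bounded. Bergman kernel: $R_p:\widehat{B}_p\times\widehat{B}_p\to\mathbb{C}$ is the unique function such that for every $x\in\widehat{B}_p$ one has $R_p(\cdot,x)\in b_p^2(\widehat{B}_p)$ and $u(x)=\langle u,R_p(\cdot,x)\rangle_{b_p^2}$ for all $u\in b_p^2(\widehat{B}_p)$. Zonal polyharmonics: $\mathcal{H}_m^p(\mathbb{C}^n)$ is the space of polynomials $q$ on $\mathbb{C}^n$ that are homogeneous of degree $m$ ($q(az)=a^mq(z)$ for $a\in\mathbb{C}$) and polyharmonic of order $p$ (i.e. $\Delta^pq=0$), and $\mathcal{H}_m^p(\widehat{S}_p)$ is the space of restrictions of its elements to $\widehat{S}_p$, with inner product $\langle f,g\rangle_{\widehat{S}_p}=\frac1p\int_S\sum_{j=0}^{p-1}f(e^{j\pi i/p}\zeta)\overline{g(e^{j\pi i/p}\zeta)}\,d\sigma(\zeta)$. For $\eta\in\widehat{S}_p$, $Z_m^p(\cdot,\eta)$ is the unique element of $\mathcal{H}_m^p(\widehat{S}_p)$ with $q(\eta)=\langle q,Z_m^p(\cdot,\eta)\rangle_{\widehat{S}_p}$ for all $q\in\mathcal{H}_m^p(\widehat{S}_p)$. It is extended to $\widehat{B}_p\times\widehat{B}_p$ by homogeneity: $Z_m^p(r\zeta,s\eta)=r^ms^mZ_m^p(\zeta,\eta)$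 for $r,s\in[0,1)$, $\zeta,\eta\in\widehat{S}_p$ (with $0^0=1$). *)

theory Defs
  imports "HOL-Analysis.Analysis"
begin

section \<open>Rotated balls and spheres\<close>

definition cvec :: "real ^ 'n \<Rightarrow> complex ^ 'n" where
  "cvec x = (\<chi> i. complex_of_real (x $ i))"

definition rotate_vec :: "real \<Rightarrow> real ^ 'n \<Rightarrow> complex ^ 'n" where
  "rotate_vec \<psi> x = cis \<psi> *s cvec x"

definition hat_ball :: "nat \<Rightarrow> (complex ^ 'n) set" where
  "hat_ball p = (\<Union>k<p. rotate_vec (real k * pi / real p) ` ball 0 1)"

definition hat_sphere :: "nat \<Rightarrow> (complex ^ 'n) set" where
  "hat_sphere p = (\<Union>k<p. rotate_vec (real k * pi / real p) ` sphere 0 1)"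

text \<open>
  The normalized surface measure of the unit sphere, as the cone measure: the mass of a Borel set
  \<open>A\<close> of unit vectors is the proportion of the volume of the unit ball filled by the cone
  over \<open>A\<close>. In dimension one this gives mass 1/2 to each of the points 1 and -1.
  The measure lives on the whole space; the origin, which the map sends to itself, is a null set.
\<close>

definition sphere_measure :: "(real ^ 'n) measure" where
  "sphere_measure = distr (uniform_measure lborel (ball 0 1)) borel (\<lambda>x. x /\<^sub>R norm x)"


section \<open>Polyharmonic functions on the ball\<close>

definition monomial :: "('n \<Rightarrow> nat) \<Rightarrow> ('a::comm_monoid_mult) ^ 'n \<Rightarrow> 'a" where
  "monomial \<alpha> x = (\<Prod>i\<in>UNIV. (x $ i) ^ \<alpha> i)"

text \<open>Summation over all multi-indices is unconditional, that is, absolute.\<close>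

definition real_analytic_on :: "(real ^ 'n \<Rightarrow> complex) \<Rightarrow> (real ^ 'n) set \<Rightarrow> bool" where
  "real_analytic_on u S \<longleftrightarrow>
     (\<forall>a\<in>S. \<exists>r>0. \<exists>c :: ('n \<Rightarrow> nat) \<Rightarrow> complex. \<forall>x\<in>ball a r.
        ((\<lambda>\<alpha>. c \<alpha> * complex_of_real (monomial \<alpha> (x - a))) has_sum u x) UNIV)"

definition partial_deriv :: "'n \<Rightarrow> (real ^ 'n \<Rightarrow> complex) \<Rightarrow> real ^ 'n \<Rightarrow> complex" where
  "partial_deriv i u x = vector_derivative (\<lambda>t. u (x + axis i t)) (at 0)"

definition laplacian :: "(real ^ 'n \<Rightarrow> complex) \<Rightarrow> real ^ 'n \<Rightarrow> complex" where
  "laplacian u x = (\<Sum>i\<in>UNIV. partial_deriv i (partial_deriv i u) x)"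

text \<open>Only the values on the ball matter; the functions are arbitrary outside it.\<close>

definition polyharmonic_ball :: "nat \<Rightarrow> (real ^ 'n \<Rightarrow> complex) set" where
  "polyharmonic_ball p =
     {u. real_analytic_on u (ball 0 1) \<and> (\<forall>x\<in>ball 0 1. (laplacian ^^ p) u x = 0)}"

definition real_homogeneous_poly :: "nat \<Rightarrow> (real ^ 'n \<Rightarrow> complex) set" where
  "real_homogeneous_poly m =
     {q. (\<exists>A c. finite A \<and> (\<forall>x. q x = (\<Sum>\<alpha>\<in>A. c \<alpha> * complex_of_real (monomial \<alpha> x)))) \<and>
         (\<forall>a x. q (a *s x) = complex_of_real a ^ m * q x)}"

text \<open>
  \<open>U\<close> is the extension of \<open>u\<close> to the union of the rotated balls, obtained by
  rotating the terms of the (unique) expansion of \<open>u\<close> into homogeneous polynomials.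
  A function on a set is represented by a total function that vanishes off the set;
  this convention is also used for the function spaces below.
\<close>

definition extends_to_hat_ball ::
    "nat \<Rightarrow> (real ^ 'n \<Rightarrow> complex) \<Rightarrow> (complex ^ 'n \<Rightarrow> complex) \<Rightarrow> bool" where
  "extends_to_hat_ball p u U \<longleftrightarrow>
     (\<forall>z. z \<notin> hat_ball p \<longrightarrow> U z = 0) \<and>
     (\<exists>q. (\<forall>m. q m \<in> real_homogeneous_poly m) \<and>
          (\<forall>x\<in>ball 0 1. (\<lambda>m. q m x) sums u x) \<and>
          (\<forall>\<psi>. \<forall>x\<in>ball 0 1. rotate_vec \<psi> x \<in> hat_ball p \<longrightarrow>
             (\<lambda>m. cis (real m * \<psi>) * q m x) sums U (rotate_vec \<psi> x)))"


section \<open>The Bergman space and its kernel\<close>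

definition bergman_space :: "nat \<Rightarrow> (complex ^ 'n \<Rightarrow> complex) set" where
  "bergman_space p =
     {U. (\<exists>u\<in>polyharmonic_ball p. extends_to_hat_ball p u U) \<and>
         ennreal (1 / real p) *
           (\<Sum>k<p. \<integral>\<^sup>+y\<in>ball 0 1. ennreal ((cmod (U (rotate_vec (real k * pi / real p) y)))\<^sup>2) \<partial>lborel)
         < \<infinity>}"

definition bergman_inner ::
    "nat \<Rightarrow> (complex ^ 'n \<Rightarrow> complex) \<Rightarrow> (complex ^ 'n \<Rightarrow> complex) \<Rightarrow> complex" where
  "bergman_inner p u v =
     1 / of_nat p * (\<Sum>k<p. LINT y:ball 0 1|lborel.
        u (rotate_vec (real k * pi / real p) y) * cnj (v (rotate_vec (real k * pi / real p) y)))"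

definition is_bergman_kernel :: "nat \<Rightarrow> (complex ^ 'n \<Rightarrow> complex ^ 'n \<Rightarrow> complex) \<Rightarrow> bool" where
  "is_bergman_kernel p R \<longleftrightarrow>
     (\<forall>x\<in>hat_ball p. (\<lambda>y. R y x) \<in> bergman_space p \<and>
        (\<forall>u\<in>bergman_space p. u x = bergman_inner p u (\<lambda>y. R y x)))"

definition bergman_kernel :: "nat \<Rightarrow> complex ^ 'n \<Rightarrow> complex ^ 'n \<Rightarrow> complex" where
  "bergman_kernel p =
     (THE R. is_bergman_kernel p R \<and> (\<forall>x y. y \<notin> hat_ball p \<longrightarrow> R x y = 0))"


section \<open>Zonal polyharmonics\<close>

definition complex_partial_deriv ::
    "'n \<Rightarrow> (complex ^ 'n \<Rightarrow> complex) \<Rightarrow> complex ^ 'n \<Rightarrow> complex" where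
  "complex_partial_deriv i q z = deriv (\<lambda>t. q (z + axis i t)) 0"

definition complex_laplacian :: "(complex ^ 'n \<Rightarrow> complex) \<Rightarrow> complex ^ 'n \<Rightarrow> complex" where
  "complex_laplacian q z = (\<Sum>i\<in>UNIV. complex_partial_deriv i (complex_partial_deriv i q) z)"

definition polyharmonic_poly :: "nat \<Rightarrow> nat \<Rightarrow> (complex ^ 'n \<Rightarrow> complex) set" where
  "polyharmonic_poly p m =
     {q. (\<exists>A c. finite A \<and> (\<forall>z. q z = (\<Sum>\<alpha>\<in>A. c \<alpha> * monomial \<alpha> z))) \<and>
         (\<forall>a z. q (a *s z) = a ^ m * q z) \<and>
         (\<forall>z. (complex_laplacian ^^ p) q z = 0)}"

definition polyharmonic_sphere :: "nat \<Rightarrow> nat \<Rightarrow> (complex ^ 'n \<Rightarrow> complex) set" where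
  "polyharmonic_sphere p m =
     (\<lambda>q z. if z \<in> hat_sphere p then q z else 0) ` polyharmonic_poly p m"

definition sphere_inner ::
    "nat \<Rightarrow> (complex ^ 'n \<Rightarrow> complex) \<Rightarrow> (complex ^ 'n \<Rightarrow> complex) \<Rightarrow> complex" where
  "sphere_inner p f g =
     1 / of_nat p * (LINT \<zeta>:sphere 0 1|sphere_measure. \<Sum>j<p.
        f (rotate_vec (real j * pi / real p) \<zeta>) * cnj (g (rotate_vec (real j * pi / real p) \<zeta>)))"

text \<open>The arguments are in the order \<open>Z (\<zeta>, \<eta>)\<close>, with \<open>\<eta>\<close> the point of evaluation.\<close>

definition zonal_sphere :: "nat \<Rightarrow> nat \<Rightarrow> complex ^ 'n \<Rightarrow> complex ^ 'n \<Rightarrow> complex" where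
  "zonal_sphere p m \<zeta> \<eta> =
     (THE f. f \<in> polyharmonic_sphere p m \<and>
             (\<forall>q\<in>polyharmonic_sphere p m. q \<eta> = sphere_inner p q f)) \<zeta>"

definition zonal :: "nat \<Rightarrow> nat \<Rightarrow> complex ^ 'n \<Rightarrow> complex ^ 'n \<Rightarrow> complex" where
  "zonal p m x y =
     (THE w. \<forall>r\<in>{0..<1}. \<forall>s\<in>{0..<1}. \<forall>\<zeta>\<in>hat_sphere p. \<forall>\<eta>\<in>hat_sphere p.
        x = r *\<^sub>R \<zeta> \<and> y = s *\<^sub>R \<eta> \<longrightarrow>
        w = complex_of_real (r ^ m * s ^ m) * zonal_sphere p m \<zeta> \<eta>)"

end

theory Submission
  imports Defs "HOL-Complex_Analysis.Conformal_Mappings"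
begin

text \<open>
  The inner product on the rotated spheres is chosen so that, on polynomials of a fixed degree \<open>m\<close>,
  the rotations cancel: it is the inner product of the unit sphere. Homogeneity expresses a sphere
  integral of a product of two such polynomials as \<open>(n + 2m) / (n \<Omega>\<^sub>n)\<close> times the integral over the
  ball (\<open>sphere_integral_homogeneous\<close>). Hence \<open>(n + 2m) / (n \<Omega>\<^sub>n)\<close> times the zonal polyharmonic of
  degree \<open>m\<close> reproduces the polyharmonic polynomials of degree \<open>m\<close> in the inner product of the ball,
  and the kernel is the sum of these functions, provided that distinct degrees are orthogonal and
  that the series converges.

  Distinct degrees are orthogonal in the Bergman inner product because of the rotations
  (\<open>rotation_orthogonality\<close>). A polyharmonic polynomial of degree \<open>m\<close> and order \<open>p\<close> is composed of
  harmonic ones of degrees \<open>m, m - 2, ..., m - 2(p - 1)\<close>, multiplied by powers of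
  \<open>\<bar>x\<bar>\<^sup>2\<close>. If two distinct degrees differ by an odd number or by at least \<open>2p\<close>, there is no common
  harmonic degree and the integral over the real ball vanishes (\<open>ball_inner_orthogonal\<close>); otherwise
  the sum over the \<open>p\<close> rotations vanishes.

  Convergence rests on the fact that zonal polyharmonics on the spheres grow more slowly than any
  exponential in \<open>m\<close> (\<open>zonal_coeffs_bound\<close>). This is derived from a comparison of the maximum of a
  homogeneous polynomial on the sphere with its square integral (\<open>sup_le_ball_norm2\<close>), which avoids
  decompositions into spherical harmonics and dimension counts. The comparison uses Leja's lemma: a
  family of polynomials that is bounded pointwise on a real cube grows at most like \<open>(1 + \<epsilon>)\<^sup>m\<close> on a
  complex neighbourhood, where \<open>m\<close> is the degree. Leja's lemma also makes the kernel series
  real analytic (\<open>polyharmonic_series\<close>) and makes the homogeneous expansion of an arbitrary element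
  of the Bergman space converge geometrically on smaller balls (\<open>pointwise_bounded_imp_geometric\<close>), so
  that its pairing with a polynomial can be computed term by term (\<open>bergman_projection\<close>).

  A polynomial or power series is handled through its family of coefficients, on which the Laplacian
  acts algebraically (\<open>mlap\<close>).
\<close>

(* The dollar sign denotes components of vectors. *)
unbundle no fps_syntax

section \<open>Power series in several variables\<close>

definition mdegree :: "('n::finite \<Rightarrow> nat) \<Rightarrow> nat" where
  "mdegree \<alpha> = (\<Sum>i\<in>UNIV. \<alpha> i)"

definition mseries :: "(('n::finite \<Rightarrow> nat) \<Rightarrow> complex) \<Rightarrow> complex ^ 'n \<Rightarrow> complex" where
  "mseries c z = (\<Sum>\<^sub>\<infinity>\<alpha>. c \<alpha> * monomial \<alpha> z)"

definition mconv :: "real \<Rightarrow> (('n::finite \<Rightarrow> nat) \<Rightarrow> complex) \<Rightarrow> bool" where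
  "mconv r c \<longleftrightarrow> (\<forall>z. (\<forall>i. norm (z $ i) < r) \<longrightarrow> (\<lambda>\<alpha>. c \<alpha> * monomial \<alpha> z) summable_on UNIV)"

definition mderiv :: "'n \<Rightarrow> (('n::finite \<Rightarrow> nat) \<Rightarrow> complex) \<Rightarrow> ('n \<Rightarrow> nat) \<Rightarrow> complex" where
  "mderiv i c = (\<lambda>\<alpha>. of_nat (Suc (\<alpha> i)) * c (\<alpha>(i := Suc (\<alpha> i))))"

definition mlap :: "(('n::finite \<Rightarrow> nat) \<Rightarrow> complex) \<Rightarrow> ('n \<Rightarrow> nat) \<Rightarrow> complex" where
  "mlap c = (\<lambda>\<alpha>. \<Sum>i\<in>UNIV. mderiv i (mderiv i c) \<alpha>)"

lemma monomial_split:
  fixes z :: "'a::comm_monoid_mult ^ 'n"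
  shows "monomial \<alpha> z = (z $ i) ^ \<alpha> i * (\<Prod>j\<in>-{i}. (z $ j) ^ \<alpha> j)"
proof -
  have "(\<Prod>j\<in>UNIV. (z $ j) ^ \<alpha> j) = (z $ i) ^ \<alpha> i * (\<Prod>j\<in>UNIV - {i}. (z $ j) ^ \<alpha> j)"
    by (rule prod.remove) auto
  then show ?thesis by (simp add: monomial_def Compl_eq_Diff_UNIV)
qed

lemma monomial_scale:
  fixes z :: "'a::comm_ring_1 ^ 'n"
  shows "monomial \<alpha> (a *s z) = a ^ mdegree \<alpha> * monomial \<alpha> z"
  by (simp add: monomial_def mdegree_def power_mult_distrib prod.distrib power_sum)

lemma norm_monomial: "norm (monomial \<alpha> (z :: complex ^ 'n)) = (\<Prod>i\<in>UNIV. norm (z $ i) ^ \<alpha> i)"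
  by (simp add: monomial_def norm_power flip: prod_norm)

lemma monomial_cvec: "monomial \<alpha> (cvec x) = complex_of_real (monomial \<alpha> x)"
  by (simp add: monomial_def cvec_def)

lemma has_sum_mseries:
  assumes "mconv r c" "\<And>i. norm (z $ i) < r"
  shows "((\<lambda>\<alpha>. c \<alpha> * monomial \<alpha> z) has_sum mseries c z) UNIV"
  using assms unfolding mconv_def mseries_def by (intro has_sum_infsum) auto

lemma has_sum_minus:
  fixes f g :: "'a \<Rightarrow> 'b::real_normed_vector"
  assumes "(f has_sum a) A" "(g has_sum b) A"
  shows "((\<lambda>x. f x - g x) has_sum (a - b)) A"
  using has_sum_add[OF assms(1), of "\<lambda>x. - g x" "- b"] assms(2) by (simp add: has_sum_uminus)

lemma inj_raise_index: "inj (\<lambda>\<alpha> :: 'n \<Rightarrow> nat. \<alpha>(i := Suc (\<alpha> i)))"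
proof (rule injI)
  fix \<alpha> \<beta> :: "'n \<Rightarrow> nat" assume e: "\<alpha>(i := Suc (\<alpha> i)) = \<beta>(i := Suc (\<beta> i))"
  show "\<alpha> = \<beta>"
  proof
    fix j show "\<alpha> j = \<beta> j" using fun_cong[OF e, of j] by (simp split: if_splits)
  qed
qed

lemma range_raise_index: "range (\<lambda>\<alpha> :: 'n \<Rightarrow> nat. \<alpha>(i := Suc (\<alpha> i))) = {\<alpha>. \<alpha> i \<noteq> 0}"
proof (intro set_eqI iffI)
  fix \<alpha> :: "'n \<Rightarrow> nat" assume "\<alpha> \<in> {\<alpha>. \<alpha> i \<noteq> 0}"
  then have "\<alpha> = (\<alpha>(i := \<alpha> i - 1))(i := Suc ((\<alpha>(i := \<alpha> i - 1)) i))" by auto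
  then show "\<alpha> \<in> range (\<lambda>\<alpha>. \<alpha>(i := Suc (\<alpha> i)))" by blast
qed auto

text \<open>Enlarging the argument of a power pays for its derivative.\<close>

lemma mul_power_le_power:
  fixes x y :: real
  assumes "0 \<le> x" "x \<le> y"
  shows "of_nat k * x ^ (k - 1) * (y - x) \<le> y ^ k"
proof -
  have "y ^ k - x ^ k = (y - x) * (\<Sum>j<k. y ^ j * x ^ (k - Suc j))"
    using power_diff_sumr2[of y k x] by (simp add: mult.commute)
  moreover have "(\<Sum>j<k. y ^ j * x ^ (k - Suc j)) \<ge> (\<Sum>j<k. x ^ (k - 1))"
  proof (rule sum_mono)
    fix j assume "j \<in> {..<k}"
    then have "x ^ (k - 1) = x ^ j * x ^ (k - Suc j)"
      by (simp flip: power_add)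
    also have "\<dots> \<le> y ^ j * x ^ (k - Suc j)"
      using assms by (intro mult_right_mono power_mono) auto
    finally show "x ^ (k - 1) \<le> y ^ j * x ^ (k - Suc j)" .
  qed
  ultimately have "(y - x) * (of_nat k * x ^ (k - 1)) \<le> y ^ k - x ^ k"
    using assms by (simp add: mult_left_mono)
  moreover have "x ^ k \<ge> 0" using assms by simp
  ultimately show ?thesis by (simp add: mult.commute)
qed

lemma mconv_mono: "mconv r c \<Longrightarrow> s \<le> r \<Longrightarrow> mconv s c"
  unfolding mconv_def by (meson less_le_trans)

text \<open>The differentiated series is dominated by the original one at a slightly larger point, and
  the difference quotients in the i-th direction are continuous functions of the increment that
  are dominated in the same way; so the quotients may be summed before passing to the limit.\<close>

lemma mseries_deriv:
  fixes z :: "complex ^ 'n"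
  assumes c: "mconv r c" and z: "\<And>i. norm (z $ i) < r"
  shows "((\<lambda>t. mseries c (z + axis i t)) has_field_derivative mseries (mderiv i c) z) (at 0)"
    and "(\<lambda>\<alpha>. mderiv i c \<alpha> * monomial \<alpha> z) summable_on UNIV"
proof -
  define y where "y = z $ i"
  obtain s where s: "norm y < s" "s < r" using z[of i] dense unfolding y_def by blast
  obtain s' where s': "s < s'" "s' < r" using s dense by blast
  have s0: "s > 0" using s norm_ge_zero[of y] by linarith
  \<comment> \<open>The dominating point: every increment of modulus below \<open>s - \<bar>y\<bar>\<close> stays below \<open>s'\<close>.\<close>
  define w where "w = (\<chi> j. if j = i then complex_of_real s' else z $ j)"
  define rest where "rest \<alpha> = (\<Prod>j\<in>-{i}. (z $ j) ^ \<alpha> j)" for \<alpha> :: "'n \<Rightarrow> nat"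
  have wn: "norm (w $ j) < r" for j using z s' s0 by (simp add: w_def)
  have wmon: "monomial \<alpha> w = complex_of_real s' ^ \<alpha> i * rest \<alpha>" for \<alpha>
    unfolding monomial_split[of \<alpha> w i] rest_def
    by (intro arg_cong2[where f="(*)"] prod.cong) (auto simp: w_def)
  have "(\<lambda>\<alpha>. c \<alpha> * monomial \<alpha> w) summable_on UNIV" using c wn unfolding mconv_def by auto
  then have "(\<lambda>\<alpha>. norm (c \<alpha> * monomial \<alpha> w)) summable_on UNIV"
    by (simp only: summable_on_iff_abs_summable_on_complex)
  then have M: "(\<lambda>\<alpha>. norm (c \<alpha> * monomial \<alpha> w) * (1 / (s' - s))) summable_on UNIV"
    by (rule summable_on_cmult_left)
  define F where "F \<alpha> t = c \<alpha> * rest \<alpha> * (\<Sum>j<\<alpha> i. (y + t) ^ j * y ^ (\<alpha> i - Suc j))" for \<alpha> t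
  define \<delta> where "\<delta> = s - norm y"
  have \<delta>: "\<delta> > 0" using s by (simp add: \<delta>_def)
  have F_le: "norm (F \<alpha> t) \<le> norm (c \<alpha> * monomial \<alpha> w) * (1 / (s' - s))"
    if t: "t \<in> ball 0 \<delta>" for \<alpha> t
  proof -
    have yt: "norm (y + t) \<le> s" using t norm_triangle_ineq[of y t] by (simp add: \<delta>_def)
    have "norm (\<Sum>j<\<alpha> i. (y + t) ^ j * y ^ (\<alpha> i - Suc j)) \<le> (\<Sum>j<\<alpha> i. s ^ (\<alpha> i - 1))"
    proof (rule sum_norm_le)
      fix j assume "j \<in> {..<\<alpha> i}"
      then have "s ^ (\<alpha> i - 1) = s ^ j * s ^ (\<alpha> i - Suc j)"
        by (simp flip: power_add)
      moreover have "norm (y + t) ^ j * norm y ^ (\<alpha> i - Suc j) \<le> s ^ j * s ^ (\<alpha> i - Suc j)"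
        using yt s s0 by (intro mult_mono power_mono) auto
      ultimately show "norm ((y + t) ^ j * y ^ (\<alpha> i - Suc j)) \<le> s ^ (\<alpha> i - 1)"
        by (simp add: norm_mult norm_power)
    qed
    also have "\<dots> = of_nat (\<alpha> i) * s ^ (\<alpha> i - 1)" by simp
    also have "\<dots> \<le> s' ^ \<alpha> i * (1 / (s' - s))"
      using mul_power_le_power[of s s' "\<alpha> i"] s0 s' by (simp add: field_simps)
    finally have "norm (F \<alpha> t) \<le> norm (c \<alpha> * rest \<alpha>) * (s' ^ \<alpha> i * (1 / (s' - s)))"
      unfolding F_def norm_mult[of "c \<alpha> * rest \<alpha>"] by (rule mult_left_mono) simp
    then show ?thesis
      using s0 s' by (simp add: wmon norm_mult norm_power mult_ac)
  qed
  have ul: "uniform_limit (ball 0 \<delta>) (\<lambda>X t. \<Sum>\<alpha>\<in>X. F \<alpha> t) (\<lambda>t. \<Sum>\<^sub>\<infinity>\<alpha>. F \<alpha> t) (finite_subsets_at_top UNIV)"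
    by (rule Weierstrass_m_test_general[OF F_le M])
  have "continuous_on (ball 0 \<delta>) (\<lambda>t. \<Sum>\<^sub>\<infinity>\<alpha>. F \<alpha> t)"
    by (rule uniform_limit_theorem[OF _ ul])
       (auto intro!: always_eventually continuous_intros simp: F_def)
  then have cont: "((\<lambda>t. \<Sum>\<^sub>\<infinity>\<alpha>. F \<alpha> t) \<longlongrightarrow> (\<Sum>\<^sub>\<infinity>\<alpha>. F \<alpha> 0)) (at 0)"
    using \<delta> by (simp add: continuous_on_eq_continuous_at isCont_def)
  have Fs: "(\<lambda>\<alpha>. F \<alpha> t) summable_on UNIV" if "t \<in> ball 0 \<delta>" for t
    unfolding summable_on_iff_abs_summable_on_complex
    by (rule Infinite_Sum.abs_summable_on_comparison_test'[OF M F_le[OF that]])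
  have quot: "(mseries c (z + axis i t) - mseries c z) / t = (\<Sum>\<^sub>\<infinity>\<alpha>. F \<alpha> t)"
    if t: "t \<noteq> 0" "t \<in> ball 0 \<delta>" for t
  proof -
    have zt: "norm ((z + axis i t) $ j) < r" for j
    proof (cases "j = i")
      case True
      then show ?thesis using t norm_triangle_ineq[of y t] s by (simp add: \<delta>_def y_def axis_def)
    qed (use z in \<open>simp add: axis_def\<close>)
    have mon: "monomial \<alpha> (z + axis i t) = (y + t) ^ \<alpha> i * rest \<alpha>" for \<alpha>
      unfolding monomial_split[of \<alpha> _ i] rest_def
      by (intro arg_cong2[where f="(*)"] prod.cong) (auto simp: y_def axis_def)
    have mon0: "monomial \<alpha> z = y ^ \<alpha> i * rest \<alpha>" for \<alpha>
      unfolding monomial_split[of \<alpha> _ i] rest_def y_def ..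
    have eq: "c \<alpha> * monomial \<alpha> (z + axis i t) - c \<alpha> * monomial \<alpha> z = F \<alpha> t * t" for \<alpha>
    proof -
      have "(y + t) ^ \<alpha> i - y ^ \<alpha> i = t * (\<Sum>j<\<alpha> i. (y + t) ^ j * y ^ (\<alpha> i - Suc j))"
        using power_diff_sumr2[of "y + t" "\<alpha> i" y] by (simp add: mult.commute)
      then show ?thesis unfolding mon mon0 F_def by (simp add: algebra_simps flip: right_diff_distrib)
    qed
    have "((\<lambda>\<alpha>. F \<alpha> t * t) has_sum (mseries c (z + axis i t) - mseries c z)) UNIV"
      using has_sum_minus[OF has_sum_mseries[OF c zt] has_sum_mseries[OF c z]] unfolding eq .
    moreover have "((\<lambda>\<alpha>. F \<alpha> t * t) has_sum ((\<Sum>\<^sub>\<infinity>\<alpha>. F \<alpha> t) * t)) UNIV"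
      by (intro has_sum_cmult_left has_sum_infsum Fs t)
    ultimately have "mseries c (z + axis i t) - mseries c z = (\<Sum>\<^sub>\<infinity>\<alpha>. F \<alpha> t) * t"
      by (rule has_sum_unique)
    then show ?thesis using t by (simp add: field_simps)
  qed
  define g where "g \<alpha> = \<alpha>(i := Suc (\<alpha> i))" for \<alpha> :: "'n \<Rightarrow> nat"
  have inj: "inj g" unfolding g_def by (rule inj_raise_index)
  have rng: "range g = {\<alpha>. \<alpha> i \<noteq> 0}" unfolding g_def by (rule range_raise_index)
  have F0: "F \<alpha> 0 = c \<alpha> * rest \<alpha> * (of_nat (\<alpha> i) * y ^ (\<alpha> i - 1))" for \<alpha>
  proof -
    have "(\<Sum>j<\<alpha> i. y ^ j * y ^ (\<alpha> i - Suc j)) = (\<Sum>j<\<alpha> i. y ^ (\<alpha> i - 1))"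
      by (intro sum.cong) (auto simp flip: power_add)
    then show ?thesis by (simp add: F_def)
  qed
  have Fg: "F (g \<alpha>) 0 = mderiv i c \<alpha> * monomial \<alpha> z" for \<alpha>
  proof -
    have "rest (g \<alpha>) = rest \<alpha>" unfolding rest_def g_def by (intro prod.cong) auto
    then show ?thesis
      by (simp only: F0 mderiv_def monomial_split[of \<alpha> z i]) (simp add: g_def rest_def y_def mult_ac)
  qed
  have "((\<lambda>\<alpha>. F \<alpha> 0) has_sum (\<Sum>\<^sub>\<infinity>\<alpha>. F \<alpha> 0)) UNIV" by (rule has_sum_infsum, rule Fs) (use \<delta> in auto)
  then have "((\<lambda>\<alpha>. F \<alpha> 0) has_sum (\<Sum>\<^sub>\<infinity>\<alpha>. F \<alpha> 0)) (range g)"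
    by (subst has_sum_cong_neutral[where T=UNIV and g="\<lambda>\<alpha>. F \<alpha> 0"]) (auto simp: rng F0)
  then have hs: "((\<lambda>\<alpha>. mderiv i c \<alpha> * monomial \<alpha> z) has_sum (\<Sum>\<^sub>\<infinity>\<alpha>. F \<alpha> 0)) UNIV"
    by (subst (asm) has_sum_reindex[OF inj]) (simp add: o_def Fg)
  then show "(\<lambda>\<alpha>. mderiv i c \<alpha> * monomial \<alpha> z) summable_on UNIV"
    by (rule has_sum_imp_summable)
  have "((\<lambda>t. (mseries c (z + axis i t) - mseries c z) / t) \<longlongrightarrow> (\<Sum>\<^sub>\<infinity>\<alpha>. F \<alpha> 0)) (at 0)"
  proof (rule Lim_transform_within[OF cont \<delta>])
    fix t :: complex assume "0 < dist t 0" "dist t 0 < \<delta>"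
    then show "(\<Sum>\<^sub>\<infinity>\<alpha>. F \<alpha> t) = (mseries c (z + axis i t) - mseries c z) / t"
      by (subst quot) (auto)
  qed
  moreover have "(\<Sum>\<^sub>\<infinity>\<alpha>. F \<alpha> 0) = mseries (mderiv i c) z"
    using hs by (simp add: mseries_def infsumI)
  moreover have ax: "axis i 0 = (0 :: complex ^ 'n)" by (simp add: vec_eq_iff axis_def)
  ultimately show "((\<lambda>t. mseries c (z + axis i t)) has_field_derivative mseries (mderiv i c) z) (at 0)"
    unfolding has_field_derivative_iff ax by simp
qed

lemma mconv_mderiv: "mconv r c \<Longrightarrow> mconv r (mderiv i c)"
  using mseries_deriv(2) unfolding mconv_def[of r "mderiv i c"] by blast

lemma mconv_add: "mconv r c \<Longrightarrow> mconv r d \<Longrightarrow> mconv r (\<lambda>\<alpha>. c \<alpha> + d \<alpha>)"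
  unfolding mconv_def by (simp add: distrib_right summable_on_add)

lemma mconv_zero: "mconv r (\<lambda>\<alpha>. 0)" by (simp add: mconv_def)

lemma mconv_cmult: "mconv r c \<Longrightarrow> mconv r (\<lambda>\<alpha>. a * c \<alpha>)"
  unfolding mconv_def by (simp add: mult.assoc summable_on_cmult_right)

lemma mconv_sum: "(\<And>x. x \<in> X \<Longrightarrow> mconv r (c x)) \<Longrightarrow> mconv r (\<lambda>\<alpha>. \<Sum>x\<in>X. c x \<alpha>)"
  by (induction X rule: infinite_finite_induct) (auto intro: mconv_zero mconv_add)

lemma mconv_mlap: "mconv r c \<Longrightarrow> mconv r (mlap c)"
  unfolding mlap_def by (intro mconv_sum mconv_mderiv)

lemma has_sum_finite_sum:
  fixes f :: "'b \<Rightarrow> 'a \<Rightarrow> 'c::topological_comm_monoid_add"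
  assumes "\<And>x. x \<in> X \<Longrightarrow> (f x has_sum s x) A"
  shows "((\<lambda>\<alpha>. \<Sum>x\<in>X. f x \<alpha>) has_sum (\<Sum>x\<in>X. s x)) A"
  using assms by (induction X rule: infinite_finite_induct) (auto intro: has_sum_add)

lemma mseries_sum:
  assumes "\<And>x. x \<in> X \<Longrightarrow> mconv r (c x)" "\<And>i. norm (z $ i) < r"
  shows "mseries (\<lambda>\<alpha>. \<Sum>x\<in>X. c x \<alpha>) z = (\<Sum>x\<in>X. mseries (c x) z)"
proof -
  have "((\<lambda>\<alpha>. \<Sum>x\<in>X. c x \<alpha> * monomial \<alpha> z) has_sum (\<Sum>x\<in>X. mseries (c x) z)) UNIV"
    using assms by (intro has_sum_finite_sum has_sum_mseries) auto
  then show ?thesis by (simp add: mseries_def sum_distrib_right infsumI)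
qed

lemma mconv_finite:
  assumes "finite {\<alpha>. c \<alpha> \<noteq> 0}"
  shows "mconv r c"
  unfolding mconv_def
proof (intro allI impI)
  fix z show "(\<lambda>\<alpha>. c \<alpha> * monomial \<alpha> z) summable_on UNIV"
    by (rule summable_on_cong_neutral[THEN iffD1, OF _ _ _ summable_on_finite[OF assms]]) auto
qed

lemma mseries_finite:
  assumes "finite A" "\<And>\<alpha>. \<alpha> \<notin> A \<Longrightarrow> c \<alpha> = 0"
  shows "mseries c z = (\<Sum>\<alpha>\<in>A. c \<alpha> * monomial \<alpha> z)"
proof -
  have "((\<lambda>\<alpha>. c \<alpha> * monomial \<alpha> z) has_sum (\<Sum>\<alpha>\<in>A. c \<alpha> * monomial \<alpha> z)) UNIV"
    using assms by (subst has_sum_cong_neutral[where T=A and g="\<lambda>\<alpha>. c \<alpha> * monomial \<alpha> z"]) auto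
  then show ?thesis by (simp add: mseries_def infsumI)
qed

lemma mseries_zero: "mseries c (0 :: complex ^ 'a) = c (\<lambda>_. 0)"
proof -
  have m: "monomial \<alpha> (0 :: complex ^ 'a) = (if \<alpha> = (\<lambda>_. 0) then 1 else 0)" for \<alpha>
  proof (cases "\<alpha> = (\<lambda>_. 0)")
    case False
    then obtain i where "\<alpha> i \<noteq> 0" by auto
    then show ?thesis using False by (auto simp: monomial_def zero_power intro!: prod_zero)
  qed (simp add: monomial_def)
  have "((\<lambda>\<alpha>. c \<alpha> * monomial \<alpha> (0 :: complex ^ 'a)) has_sum (\<Sum>\<alpha>\<in>{\<lambda>_. 0}. c \<alpha>)) UNIV"
    by (subst has_sum_cong_neutral[where T="{\<lambda>_. 0}" and g=c]) (auto simp: m intro!: has_sum_finiteI)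
  then show ?thesis by (simp add: mseries_def infsumI)
qed

lemma cvec_nth [simp]: "cvec x $ i = complex_of_real (x $ i)"
  by (simp add: cvec_def)

lemma cvec_zero [simp]: "cvec 0 = 0"
  by (simp add: vec_eq_iff)

lemma cvec_add_axis: "cvec (x + axis i t) = cvec x + axis i (complex_of_real t)"
  by (simp add: vec_eq_iff axis_def)

lemma cvec_scaleR: "cvec (a *\<^sub>R x) = complex_of_real a *s cvec x"
  by (simp add: vec_eq_iff)

lemma mseries_real_deriv:
  fixes x :: "real ^ 'n"
  assumes c: "mconv r c" and x: "\<And>i. \<bar>x $ i\<bar> < r"
  shows "((\<lambda>t. mseries c (cvec (x + axis i t))) has_vector_derivative mseries (mderiv i c) (cvec x)) (at 0)"
proof -
  have "((\<lambda>t. mseries c (cvec x + axis i t)) has_field_derivative mseries (mderiv i c) (cvec x))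
      (at (of_real 0))"
    using mseries_deriv(1)[OF c, of "cvec x" i] x by simp
  from has_vector_derivative_real_field[OF this] show ?thesis
    by (simp add: cvec_add_axis)
qed

lemma tendsto_axis: "((\<lambda>t::real. (x :: real ^ 'a) + axis i t) \<longlongrightarrow> x) (nhds 0)"
proof -
  have "((\<lambda>t::real. x + axis i t) \<longlongrightarrow> x + axis i 0) (nhds 0)"
  proof (rule vec_tendstoI)
    fix j show "((\<lambda>t. (x + axis i t) $ j) \<longlongrightarrow> (x + axis i 0) $ j) (nhds 0)"
      by (cases "j = i") (auto simp: axis_def intro!: tendsto_eq_intros filterlim_ident)
  qed
  moreover have "axis i 0 = (0 :: real ^ 'a)" by (simp add: vec_eq_iff axis_def)
  ultimately show ?thesis by simp
qed

lemma partial_deriv_mseries: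
  fixes u :: "real ^ 'n \<Rightarrow> complex"
  assumes S: "open S" and c: "mconv r c"
    and u: "\<And>y. y \<in> S \<Longrightarrow> (\<forall>j. \<bar>y $ j - a $ j\<bar> < r) \<and> u y = mseries c (cvec (y - a))"
    and y: "y \<in> S"
  shows "((\<lambda>t. u (y + axis i t)) has_vector_derivative mseries (mderiv i c) (cvec (y - a))) (at 0)"
    and "partial_deriv i u y = mseries (mderiv i c) (cvec (y - a))"
proof -
  have d: "((\<lambda>t. mseries c (cvec (y - a + axis i t))) has_vector_derivative
      mseries (mderiv i c) (cvec (y - a))) (at 0)"
    by (rule mseries_real_deriv[OF c]) (use u[OF y] in simp)
  have "eventually (\<lambda>t. y + axis i t \<in> S) (nhds 0)"
    using tendsto_axis[of y i] S y by (rule topological_tendstoD)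
  then have "eventually (\<lambda>t. u (y + axis i t) = mseries c (cvec (y - a + axis i t))) (nhds 0)"
    by eventually_elim (use u in \<open>simp add: algebra_simps\<close>)
  then have ev: "eventually (\<lambda>t. t \<in> UNIV \<longrightarrow> mseries c (cvec (y - a + axis i t)) = u (y + axis i t)) (nhds 0)"
    by eventually_elim simp
  then have e0: "mseries c (cvec (y - a + axis i 0)) = u (y + axis i 0)"
    by (auto dest: eventually_nhds_x_imp_x)
  show *: "((\<lambda>t. u (y + axis i t)) has_vector_derivative mseries (mderiv i c) (cvec (y - a))) (at 0)"
    using d has_vector_derivative_cong_ev[OF ev e0] by simp
  show "partial_deriv i u y = mseries (mderiv i c) (cvec (y - a))"
    unfolding partial_deriv_def by (rule vector_derivative_at[OF *])
qed

lemma laplacian_mseries: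
  fixes u :: "real ^ 'n \<Rightarrow> complex"
  assumes S: "open S" and c: "mconv r c"
    and u: "\<And>y. y \<in> S \<Longrightarrow> (\<forall>j. \<bar>y $ j - a $ j\<bar> < r) \<and> u y = mseries c (cvec (y - a))"
    and y: "y \<in> S"
  shows "laplacian u y = mseries (mlap c) (cvec (y - a))"
proof -
  have r: "\<forall>j. \<bar>y $ j - a $ j\<bar> < r" if "y \<in> S" for y using u that by blast
  have "partial_deriv i (partial_deriv i u) y = mseries (mderiv i (mderiv i c)) (cvec (y - a))" for i
    by (rule partial_deriv_mseries(2)[OF S mconv_mderiv[OF c] _ y])
       (simp add: partial_deriv_mseries(2)[OF S c u] r)
  then show ?thesis unfolding laplacian_def mlap_def
    by (subst mseries_sum[where r=r])
       (use r[OF y] in \<open>auto intro!: mconv_mderiv c simp flip: of_real_diff\<close>)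
qed

lemma mconv_mlap_pow: "mconv r c \<Longrightarrow> mconv r ((mlap ^^ k) c)"
  by (induction k) (auto intro: mconv_mlap)

lemma laplacian_pow_mseries:
  fixes u :: "real ^ 'n \<Rightarrow> complex"
  assumes S: "open S" and c: "mconv r c"
    and u: "\<And>y. y \<in> S \<Longrightarrow> (\<forall>j. \<bar>y $ j - a $ j\<bar> < r) \<and> u y = mseries c (cvec (y - a))"
    and y: "y \<in> S"
  shows "(laplacian ^^ k) u y = mseries ((mlap ^^ k) c) (cvec (y - a))"
  using y
proof (induction k arbitrary: y)
  case (Suc k)
  have "laplacian ((laplacian ^^ k) u) y = mseries (mlap ((mlap ^^ k) c)) (cvec (y - a))"
    by (rule laplacian_mseries[OF S mconv_mlap_pow[OF c] _ Suc.prems]) (use Suc u in auto)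
  then show ?case by simp
qed (use u in auto)

lemma complex_laplacian_mseries:
  assumes c: "\<And>r. mconv r c"
  shows "complex_laplacian (mseries c) = mseries (mlap c)"
proof
  fix z :: "complex ^ 'a"
  have lt: "norm (z $ i) < norm z + 1" for i and z :: "complex ^ 'a"
    using Finite_Cartesian_Product.norm_nth_le[of z i] by linarith
  have 1: "complex_partial_deriv i (mseries c) = mseries (mderiv i c)" if "\<And>r. mconv r c" for i :: 'a and c
  proof
    fix z show "complex_partial_deriv i (mseries c) z = mseries (mderiv i c) z"
      unfolding complex_partial_deriv_def
      by (rule DERIV_imp_deriv[OF mseries_deriv(1)[OF that[of "norm z + 1"] lt]])
  qed
  have "complex_partial_deriv i (complex_partial_deriv i (mseries c)) z = mseries (mderiv i (mderiv i c)) z" for i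
    by (simp add: 1 c mconv_mderiv)
  then show "complex_laplacian (mseries c) z = mseries (mlap c) z"
    unfolding complex_laplacian_def mlap_def
    by (subst mseries_sum[where r="norm z + 1"]) (auto intro!: mconv_mderiv c lt)
qed

lemma complex_laplacian_pow_mseries:
  assumes c: "\<And>r. mconv r c"
  shows "(complex_laplacian ^^ k) (mseries c) = mseries ((mlap ^^ k) c)"
  by (induction k) (auto simp: complex_laplacian_mseries mconv_mlap_pow c)

text \<open>Induction on the degree: the derivatives of the zero function are zero, and the constant term is
  the value at the origin. Only real points enter, so that a polynomial on the complex space is
  determined by its values on the real one.\<close>

lemma mseries_unique:
  fixes c :: "('n::finite \<Rightarrow> nat) \<Rightarrow> complex"
  assumes r: "r > 0" and c: "mconv r c"
    and z: "\<And>x :: real ^ 'n. (\<And>i. \<bar>x $ i\<bar> < r) \<Longrightarrow> mseries c (cvec x) = 0"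
  shows "c \<alpha> = 0"
proof -
  have "\<forall>\<alpha>. mdegree \<alpha> = k \<longrightarrow> c \<alpha> = 0"
    if "mconv r c" "\<And>x :: real ^ 'n. (\<And>i. \<bar>x $ i\<bar> < r) \<Longrightarrow> mseries c (cvec x) = 0"
    for c :: "('n::finite \<Rightarrow> nat) \<Rightarrow> complex" and k
    using that
  proof (induction k arbitrary: c)
    case 0
    have "\<alpha> = (\<lambda>_. 0)" if "mdegree \<alpha> = 0" for \<alpha> :: "'n \<Rightarrow> nat"
      using that by (auto simp: mdegree_def)
    then show ?case using 0(2)[of 0] r mseries_zero[of c] by auto
  next
    case (Suc k)
    show ?case
    proof (intro allI impI)
      fix \<alpha> :: "'n \<Rightarrow> nat" assume d: "mdegree \<alpha> = Suc k"
      then obtain i where i: "\<alpha> i > 0" by (metis mdegree_def bot_nat_0.not_eq_extremum nat.distinct(1) sum.neutral)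
      let ?S = "{y :: real ^ 'n. \<forall>j. \<bar>y $ j\<bar> < r}"
      have S: "open ?S"
      proof -
        have "?S = (\<Inter>j. {y. \<bar>y $ j\<bar> < r})" by auto
        also have "open \<dots>" by (intro open_INT finite ballI open_Collect_less continuous_intros)
        finally show ?thesis .
      qed
      have "mseries (mderiv i c) (cvec x) = 0" if x: "\<And>i. \<bar>x $ i\<bar> < r" for x
      proof -
        have "partial_deriv i (\<lambda>x. 0) x = mseries (mderiv i c) (cvec (x - 0))"
          by (rule partial_deriv_mseries(2)[OF S Suc.prems(1)]) (use x Suc.prems(2) in auto)
        then show ?thesis by (simp add: partial_deriv_def)
      qed
      then have IH: "mdegree \<beta> = k \<longrightarrow> mderiv i c \<beta> = 0" for \<beta>
        using Suc.IH[OF mconv_mderiv[OF Suc.prems(1)]] by blast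
      define \<beta> where "\<beta> = \<alpha>(i := \<alpha> i - 1)"
      have \<alpha>: "\<alpha> = \<beta>(i := Suc (\<beta> i))" using i by (auto simp: \<beta>_def)
      have "mdegree \<alpha> = Suc (mdegree \<beta>)"
        unfolding mdegree_def sum.remove[OF finite UNIV_I, where x=i]
        using i by (simp add: \<beta>_def)
      then have "mderiv i c \<beta> = 0" using IH d by simp
      then show "c \<alpha> = 0" by (subst \<alpha>) (simp add: mderiv_def del: of_nat_Suc)
    qed
  qed
  with c z show ?thesis by blast
qed

section \<open>Homogeneous and polyharmonic polynomials\<close>

text \<open>The degree is an integer so that derivatives lower it without a case distinction; in negative
  degrees only the zero family is left.\<close>

definition hom_coeffs :: "int \<Rightarrow> (('n::finite \<Rightarrow> nat) \<Rightarrow> complex) set" where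
  "hom_coeffs k = {c. \<forall>\<alpha>. c \<alpha> \<noteq> 0 \<longrightarrow> int (mdegree \<alpha>) = k}"

lemma le_mdegree: "\<alpha> i \<le> mdegree \<alpha>"
  unfolding mdegree_def by (rule member_le_sum) auto

lemma finite_mdegree: "finite {\<alpha> :: 'n::finite \<Rightarrow> nat. mdegree \<alpha> = m}"
proof (rule finite_subset)
  show "{\<alpha> :: 'n \<Rightarrow> nat. mdegree \<alpha> = m} \<subseteq> (UNIV :: 'n set) \<rightarrow>\<^sub>E {..m}"
    using le_mdegree by auto
  show "finite ((UNIV :: 'n set) \<rightarrow>\<^sub>E {..m})" by (intro finite_PiE) auto
qed

lemma hom_coeffs_finite: "c \<in> hom_coeffs k \<Longrightarrow> finite {\<alpha>. c \<alpha> \<noteq> 0}"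
  by (rule finite_subset[OF _ finite_mdegree[of "nat k"]]) (auto simp: hom_coeffs_def)

lemma hom_coeffs_mconv: "c \<in> hom_coeffs k \<Longrightarrow> mconv r c"
  by (intro mconv_finite hom_coeffs_finite)

lemma mseries_scale:
  assumes "c \<in> hom_coeffs (int m)"
  shows "mseries c (a *s z) = a ^ m * mseries c z"
proof -
  have "mseries c w = (\<Sum>\<alpha> | mdegree \<alpha> = m. c \<alpha> * monomial \<alpha> w)" for w
    by (rule mseries_finite[OF finite_mdegree]) (use assms in \<open>auto simp: hom_coeffs_def\<close>)
  then show ?thesis by (simp add: monomial_scale sum_distrib_left mult_ac)
qed

lemma mdegree_upd: "mdegree (\<alpha>(i := Suc (\<alpha> i))) = Suc (mdegree \<alpha>)"
  unfolding mdegree_def sum.remove[OF finite UNIV_I, where x=i] by simp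

lemma hom_coeffs_mderiv: "c \<in> hom_coeffs k \<Longrightarrow> mderiv i c \<in> hom_coeffs (k - 1)"
  by (auto simp: hom_coeffs_def mderiv_def mdegree_upd)

lemma hom_coeffs_sum: "(\<And>x. x \<in> X \<Longrightarrow> c x \<in> hom_coeffs k) \<Longrightarrow> (\<lambda>\<alpha>. \<Sum>x\<in>X. c x \<alpha>) \<in> hom_coeffs k"
  unfolding hom_coeffs_def by (auto elim!: sum.not_neutral_contains_not_neutral)

lemma hom_coeffs_mlap: "c \<in> hom_coeffs k \<Longrightarrow> mlap c \<in> hom_coeffs (k - 2)"
  unfolding mlap_def
  by (rule hom_coeffs_sum) (metis hom_coeffs_mderiv diff_diff_add one_add_one)

lemma mseries_real_unique:
  fixes c d :: "('n::finite \<Rightarrow> nat) \<Rightarrow> complex"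
  assumes r: "r > 0" and c: "mconv r c" and d: "mconv r d"
    and z: "\<And>x :: real ^ 'n. (\<And>i. \<bar>x $ i\<bar> < r) \<Longrightarrow> mseries c (cvec x) = mseries d (cvec x)"
  shows "c = d"
proof
  fix \<alpha>
  have cd: "mconv r (\<lambda>\<alpha>. c \<alpha> + (-1) * d \<alpha>)" using c d by (intro mconv_add mconv_cmult)
  have "c \<alpha> + (-1) * d \<alpha> = 0"
  proof (rule mseries_unique[OF r cd])
    fix x :: "real ^ 'n" assume x: "\<And>i. \<bar>x $ i\<bar> < r"
    have "((\<lambda>\<alpha>. (c \<alpha> + (-1) * d \<alpha>) * monomial \<alpha> (cvec x)) has_sum
        (mseries c (cvec x) - mseries d (cvec x))) UNIV"
      using has_sum_minus[OF has_sum_mseries[OF c] has_sum_mseries[OF d], of "cvec x" "cvec x"] x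
      by (simp add: algebra_simps)
    then show "mseries (\<lambda>\<alpha>. c \<alpha> + (-1) * d \<alpha>) (cvec x) = 0"
      using z[OF x] by (simp add: mseries_def infsumI)
  qed
  then show "c \<alpha> = d \<alpha>" by simp
qed

text \<open>Comparing the coefficients of a polynomial with those of its dilate by the factor 2 isolates
  the terms of one degree.\<close>

lemma homogeneous_poly_coeffs:
  fixes c :: "('n::finite \<Rightarrow> nat) \<Rightarrow> complex"
  assumes A: "finite A"
    and hom: "\<And>x :: real ^ 'n. (\<Sum>\<alpha>\<in>A. c \<alpha> * complex_of_real (monomial \<alpha> (2 *s x))) =
      2 ^ m * (\<Sum>\<alpha>\<in>A. c \<alpha> * complex_of_real (monomial \<alpha> x))"
  defines "d \<equiv> \<lambda>\<alpha>. if \<alpha> \<in> A then c \<alpha> else 0"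
  shows "d \<in> hom_coeffs (int m)" and "mseries d z = (\<Sum>\<alpha>\<in>A. c \<alpha> * monomial \<alpha> z)"
proof -
  show d: "mseries d z = (\<Sum>\<alpha>\<in>A. c \<alpha> * monomial \<alpha> z)" for z
    by (subst mseries_finite[OF A]) (auto simp: d_def)
  have fin: "finite {\<alpha>. d \<alpha> * f \<alpha> \<noteq> 0}" for f
    by (rule finite_subset[OF _ A]) (auto simp: d_def)
  have "(\<lambda>\<alpha>. d \<alpha> * 2 ^ mdegree \<alpha>) = (\<lambda>\<alpha>. d \<alpha> * 2 ^ m)"
  proof (rule mseries_real_unique[of 1])
    fix x :: "real ^ 'n"
    have "mseries (\<lambda>\<alpha>. d \<alpha> * 2 ^ mdegree \<alpha>) (cvec x) =
        (\<Sum>\<alpha>\<in>A. c \<alpha> * complex_of_real (monomial \<alpha> (2 *s x)))"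
      by (subst mseries_finite[OF A]) (auto simp: d_def monomial_scale monomial_cvec mult_ac)
    also have "\<dots> = mseries (\<lambda>\<alpha>. d \<alpha> * 2 ^ m) (cvec x)"
      by (subst mseries_finite[OF A]) (auto simp: hom d_def monomial_cvec sum_distrib_left mult_ac)
    finally show "mseries (\<lambda>\<alpha>. d \<alpha> * 2 ^ mdegree \<alpha>) (cvec x) = mseries (\<lambda>\<alpha>. d \<alpha> * 2 ^ m) (cvec x)" .
  qed (auto intro!: mconv_finite fin)
  then have e: "d \<alpha> * 2 ^ mdegree \<alpha> = d \<alpha> * 2 ^ m" for \<alpha> by (rule fun_cong)
  have "mdegree \<alpha> = m" if "d \<alpha> \<noteq> 0" for \<alpha>
  proof -
    have "(2::complex) ^ mdegree \<alpha> = 2 ^ m" using e[of \<alpha>] that by simp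
    then have "(2::nat) ^ mdegree \<alpha> = 2 ^ m"
      by (metis of_nat_numeral of_nat_power of_nat_eq_iff)
    then show ?thesis by simp
  qed
  then show "d \<in> hom_coeffs (int m)" by (auto simp: hom_coeffs_def)
qed

lemma real_homogeneous_poly_iff:
  "q \<in> real_homogeneous_poly m \<longleftrightarrow> (\<exists>c\<in>hom_coeffs (int m). q = (\<lambda>x. mseries c (cvec x)))"
proof
  assume "q \<in> real_homogeneous_poly m"
  then obtain A c where A: "finite A" and q: "\<And>x. q x = (\<Sum>\<alpha>\<in>A. c \<alpha> * complex_of_real (monomial \<alpha> x))"
    and h: "\<And>a x. q (a *s x) = complex_of_real a ^ m * q x"
    unfolding real_homogeneous_poly_def by blast
  have h2: "(\<Sum>\<alpha>\<in>A. c \<alpha> * complex_of_real (monomial \<alpha> (2 *s x))) =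
      2 ^ m * (\<Sum>\<alpha>\<in>A. c \<alpha> * complex_of_real (monomial \<alpha> x))" for x
    using h[of 2 x] by (simp add: q)
  show "\<exists>c\<in>hom_coeffs (int m). q = (\<lambda>x. mseries c (cvec x))"
    using homogeneous_poly_coeffs(1)[OF A h2]
    by (rule bexI[rotated]) (simp add: fun_eq_iff q homogeneous_poly_coeffs(2)[OF A h2] monomial_cvec)
next
  assume "\<exists>c\<in>hom_coeffs (int m). q = (\<lambda>x. mseries c (cvec x))"
  then obtain c where c: "c \<in> hom_coeffs (int m)" and q: "q = (\<lambda>x. mseries c (cvec x))" by blast
  have "q x = (\<Sum>\<alpha> | mdegree \<alpha> = m. c \<alpha> * complex_of_real (monomial \<alpha> x))" for x
    unfolding q by (subst mseries_finite[OF finite_mdegree, of m])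
      (use c in \<open>auto simp: hom_coeffs_def monomial_cvec\<close>)
  moreover have "q (a *s x) = complex_of_real a ^ m * q x" for a x
    using mseries_scale[OF c, of "of_real a" "cvec x"] cvec_scaleR[of a x]
    by (simp add: q scalar_mult_eq_scaleR)
  ultimately show "q \<in> real_homogeneous_poly m"
    unfolding real_homogeneous_poly_def using finite_mdegree by blast
qed

definition polyharm_coeffs :: "nat \<Rightarrow> int \<Rightarrow> (('n::finite \<Rightarrow> nat) \<Rightarrow> complex) set" where
  "polyharm_coeffs p k = {c \<in> hom_coeffs k. (mlap ^^ p) c = (\<lambda>_. 0)}"

lemma polyharm_coeffs_hom: "c \<in> polyharm_coeffs p k \<Longrightarrow> c \<in> hom_coeffs k"
  by (simp add: polyharm_coeffs_def)

text \<open>The real and the complex Laplacian act in the same way on coefficients, so polyharmonicity is a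
  condition on the coefficients alone.\<close>

lemma polyharmonic_poly_eq: "polyharmonic_poly p m = mseries ` polyharm_coeffs p (int m)"
proof (intro equalityI subsetI)
  fix q :: "complex ^ 'n \<Rightarrow> complex" assume "q \<in> polyharmonic_poly p m"
  then obtain A c where A: "finite A" and q: "\<And>x. q x = (\<Sum>\<alpha>\<in>A. c \<alpha> * monomial \<alpha> x)"
    and h: "\<And>a x. q (a *s x) = a ^ m * q x" and l: "\<And>z. (complex_laplacian ^^ p) q z = 0"
    unfolding polyharmonic_poly_def by blast
  have h2: "(\<Sum>\<alpha>\<in>A. c \<alpha> * complex_of_real (monomial \<alpha> (2 *s x))) =
      2 ^ m * (\<Sum>\<alpha>\<in>A. c \<alpha> * complex_of_real (monomial \<alpha> x))" for x :: "real ^ 'n"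
  proof -
    have "cvec (2 *s x) = 2 *s cvec x" by (simp add: vec_eq_iff)
    then show ?thesis using h[of 2 "cvec x"] unfolding monomial_cvec[symmetric] q by simp
  qed
  define d where "d = (\<lambda>\<alpha>. if \<alpha> \<in> A then c \<alpha> else 0)"
  have d: "d \<in> hom_coeffs (int m)" unfolding d_def by (rule homogeneous_poly_coeffs(1)[OF A h2])
  have qd: "q = mseries d"
    unfolding d_def by (rule ext) (simp add: q homogeneous_poly_coeffs(2)[OF A h2])
  have "(mlap ^^ p) d = (\<lambda>_. 0)"
  proof
    fix \<alpha>
    have "(\<lambda>z. 0) = mseries ((mlap ^^ p) d)"
      using l unfolding qd complex_laplacian_pow_mseries[OF hom_coeffs_mconv[OF d]] by (simp add: fun_eq_iff)
    then have "mseries ((mlap ^^ p) d) (cvec x) = 0" for x by metis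
    then show "(mlap ^^ p) d \<alpha> = 0"
      by (rule mseries_unique[OF zero_less_one mconv_mlap_pow[OF hom_coeffs_mconv[OF d]]])
  qed
  with d qd show "q \<in> mseries ` polyharm_coeffs p (int m)"
    by (auto simp: polyharm_coeffs_def)
next
  fix q :: "complex ^ 'n \<Rightarrow> complex" assume "q \<in> mseries ` polyharm_coeffs p (int m)"
  then obtain c where q: "q = mseries c" and c: "c \<in> hom_coeffs (int m)" "(mlap ^^ p) c = (\<lambda>_. 0)"
    by (auto simp: polyharm_coeffs_def)
  have "q x = (\<Sum>\<alpha> | mdegree \<alpha> = m. c \<alpha> * monomial \<alpha> x)" for x
    unfolding q by (subst mseries_finite[OF finite_mdegree, of m])
      (use c in \<open>auto simp: hom_coeffs_def\<close>)
  moreover have "(complex_laplacian ^^ p) q z = 0" for z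
    unfolding q complex_laplacian_pow_mseries[OF hom_coeffs_mconv[OF c(1)]] c(2)
    by (simp add: mseries_def)
  ultimately show "q \<in> polyharmonic_poly p m"
    unfolding polyharmonic_poly_def using finite_mdegree mseries_scale[OF c(1)] q by blast
qed

lemma mlap_pow_has_sum:
  assumes "\<And>\<alpha>. ((\<lambda>m. d m \<alpha>) has_sum c \<alpha>) X"
  shows "((\<lambda>m. (mlap ^^ k) (d m) \<alpha>) has_sum (mlap ^^ k) c \<alpha>) X"
proof (induction k arbitrary: \<alpha>)
  case (Suc k)
  have "((\<lambda>m. mderiv i (mderiv i ((mlap ^^ k) (d m))) \<alpha>) has_sum mderiv i (mderiv i ((mlap ^^ k) c)) \<alpha>) X" for i \<alpha>
    unfolding mderiv_def by (intro has_sum_cmult_right Suc.IH)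
  then have "((\<lambda>m. mlap ((mlap ^^ k) (d m)) \<alpha>) has_sum mlap ((mlap ^^ k) c) \<alpha>) X"
    unfolding mlap_def[of "(mlap ^^ k) c" for c] by (rule has_sum_finite_sum)
  then show ?case by simp
qed (use assms in auto)

text \<open>Absolute convergence depends on the moduli of the coordinates only, and the vectors of moduli of
  the points of a polydisc of radius \<open>r / n\<close> lie in the ball of radius \<open>r\<close>.\<close>

lemma mconv_of_real_ball:
  fixes a :: "real ^ 'n"
  assumes "\<And>x. x \<in> ball a r \<Longrightarrow> ((\<lambda>\<alpha>. c \<alpha> * complex_of_real (monomial \<alpha> (x - a))) has_sum u x) UNIV"
  shows "mconv (r / real CARD('n)) c"
  unfolding mconv_def
proof (intro allI impI)
  fix z :: "complex ^ 'n" assume z: "\<forall>i. norm (z $ i) < r / real CARD('n)"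
  define x :: "real ^ 'n" where "x = (\<chi> i. norm (z $ i))"
  have "norm x \<le> (\<Sum>i\<in>UNIV. \<bar>x $ i\<bar>)" by (rule norm_le_l1_cart)
  also have "\<dots> < (\<Sum>i\<in>(UNIV::'n set). r / real CARD('n))"
    using z by (intro sum_strict_mono) (auto simp: x_def)
  also have "\<dots> = r" by simp
  finally have "a + x \<in> ball a r" by (simp add: dist_norm)
  from assms[OF this] have "(\<lambda>\<alpha>. c \<alpha> * complex_of_real (monomial \<alpha> x)) summable_on UNIV"
    by (auto intro: has_sum_imp_summable)
  moreover have "norm (c \<alpha> * complex_of_real (monomial \<alpha> x)) = norm (c \<alpha> * monomial \<alpha> z)" for \<alpha>
    by (simp add: norm_mult norm_monomial) (simp add: x_def monomial_def abs_prod)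
  ultimately show "(\<lambda>\<alpha>. c \<alpha> * monomial \<alpha> z) summable_on UNIV"
    by (simp only: summable_on_iff_abs_summable_on_complex)
qed

section \<open>Leja's lemma on polynomials\<close>

lemma sum_cis_multiples:
  fixes l :: int
  assumes K: "K > 0" and l: "\<not> int K dvd l"
  shows "(\<Sum>j<K. cis (real_of_int l * (2 * pi * real j / real K))) = 0"
proof -
  define z where "z = cis (real_of_int l * (2 * pi / real K))"
  have zj: "cis (real_of_int l * (2 * pi * real j / real K)) = z ^ j" for j
    unfolding z_def Complex.DeMoivre by (rule arg_cong[where f=cis]) (simp add: field_simps)
  have "z \<noteq> 1"
  proof
    assume "z = 1"
    then have "cos (real_of_int l * (2 * pi / real K)) = 1" by (simp add: z_def complex_eq_iff)
    then obtain k :: int where "real_of_int l * (2 * pi / real K) = real_of_int k * 2 * pi"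
      using cos_one_2pi_int by auto
    then have "real_of_int l = real_of_int (k * int K)" using K by (simp add: field_simps)
    then have "l = k * int K" by (simp only: of_int_eq_iff)
    then show False using l by simp
  qed
  moreover have "z ^ K = 1"
  proof -
    have "z ^ K = cis (2 * pi * real_of_int l)" using K by (simp add: z_def Complex.DeMoivre field_simps)
    then show ?thesis by (simp add: cis_multiple_2pi)
  qed
  ultimately have "(\<Sum>j<K. z ^ j) = 0" by (simp add: sum_gp_strict)
  then show ?thesis unfolding zj .
qed

lemma poly_altdef_lessThan:
  assumes "degree (T :: complex poly) < K"
  shows "poly T z = (\<Sum>i<K. coeff T i * z ^ i)"
  unfolding poly_altdef
  by (rule sum.mono_neutral_left) (use assms in \<open>auto intro: coeff_eq_0\<close>)

text \<open>Fourier inversion on a rotated group of roots of unity: a coefficient is an average of values.\<close>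

lemma coeff_le_on_rotated_roots:
  fixes T :: "complex poly"
  assumes deg: "degree T < K" and k: "k < K"
    and M: "\<And>j. j < K \<Longrightarrow> norm (poly T (cis (2 * pi * (s + real j / real K)))) \<le> M"
  shows "norm (coeff T k) \<le> M"
proof -
  define w where "w j = cis (2 * pi * (s + real j / real K))" for j
  have K: "K > 0" using k by simp
  have wpow: "w j ^ i * cnj (w j) ^ k =
      cis (2 * pi * s * (real i - real k)) * cis (real_of_int (int i - int k) * (2 * pi * real j / real K))" for i j
    unfolding w_def cis_cnj Complex.DeMoivre cis_mult
    using K by (intro arg_cong[where f=cis]) (simp add: field_simps)
  have "(\<Sum>j<K. poly T (w j) * cnj (w j) ^ k) =
      (\<Sum>j<K. \<Sum>i<K. coeff T i * (w j ^ i * cnj (w j) ^ k))"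
    unfolding poly_altdef_lessThan[OF deg] sum_distrib_right by (simp only: mult.assoc)
  also have "\<dots> = (\<Sum>i<K. \<Sum>j<K. coeff T i * (w j ^ i * cnj (w j) ^ k))"
    by (rule sum.swap)
  also have "\<dots> = (\<Sum>i<K. coeff T i * (cis (2 * pi * s * (real i - real k)) *
      (\<Sum>j<K. cis (real_of_int (int i - int k) * (2 * pi * real j / real K)))))"
    by (simp only: wpow sum_distrib_left)
  also have "\<dots> = (\<Sum>i<K. if i = k then of_nat K * coeff T k else 0)"
  proof (rule sum.cong)
    fix i assume i: "i \<in> {..<K}"
    show "coeff T i * (cis (2 * pi * s * (real i - real k)) *
      (\<Sum>j<K. cis (real_of_int (int i - int k) * (2 * pi * real j / real K)))) =
      (if i = k then of_nat K * coeff T k else 0)"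
    proof (cases "i = k")
      case False
      have "\<not> int K dvd int i - int k"
      proof
        assume "int K dvd int i - int k"
        then have "\<bar>int K\<bar> \<le> \<bar>int i - int k\<bar>" using False by (intro dvd_imp_le_int) auto
        then show False using i k by auto
      qed
      from sum_cis_multiples[OF K this] False show ?thesis by simp
    qed simp
  qed simp
  also have "\<dots> = of_nat K * coeff T k" using k by simp
  finally have "of_nat K * coeff T k = (\<Sum>j<K. poly T (w j) * cnj (w j) ^ k)" ..
  then have "real K * norm (coeff T k) = norm (\<Sum>j<K. poly T (w j) * cnj (w j) ^ k)"
    by (metis norm_mult norm_of_nat)
  also have "\<dots> \<le> (\<Sum>j<K. M)"
    by (rule sum_norm_le) (use M in \<open>simp add: norm_mult norm_power w_def\<close>)
  also have "\<dots> = real K * M" by simp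
  finally show ?thesis using K by simp
qed

text \<open>A discrete Remez inequality. The polynomial is multiplied by the monic polynomial vanishing
  at the exceptional nodes; the product is controlled at every node, hence everywhere, and the
  factor is divided out again at distance \<open>\<delta>\<close> from the unit circle.\<close>

lemma poly_bound_from_most_roots:
  fixes P :: "complex poly"
  assumes deg: "degree P + b < K" and M: "M \<ge> 0" and \<delta>: "0 < \<delta>" "\<delta> \<le> 1"
    and J: "card {j \<in> {..<K}. norm (poly P (cis (2 * pi * (s + real j / real K)))) > M} \<le> b"
    and z: "norm z \<le> 1 + \<delta>"
  shows "norm (poly P z) \<le> real K * M * (2 / \<delta>) ^ b * (1 + \<delta>) ^ K"
proof -
  define w where "w j = cis (2 * pi * (s + real j / real K))" for j
  define J where "J = {j \<in> {..<K}. norm (poly P (w j)) > M}"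
  have fJ: "finite J" and cJ: "card J \<le> b" using J by (simp_all add: J_def w_def)
  define D where "D = (\<Prod>j\<in>J. [:- w j, 1:])"
  have polyD: "poly D z = (\<Prod>j\<in>J. z - w j)" for z by (simp add: D_def poly_prod)
  have "degree D \<le> (\<Sum>j\<in>J. degree [:- w j, 1:])"
    unfolding D_def using degree_prod_sum_le[OF fJ, of "\<lambda>j. [:- w j, 1:]"] by (simp add: o_def)
  also have "\<dots> = card J" by simp
  finally have degT: "degree (P * D) < K" using degree_mult_le[of P D] deg cJ by linarith
  have T: "norm (poly (P * D) (w j)) \<le> M * 2 ^ card J" if j: "j < K" for j
  proof (cases "j \<in> J")
    case True
    then have "poly D (w j) = 0" using fJ by (auto simp: polyD)
    then show ?thesis using M by simp
  next
    case False
    then have "norm (poly P (w j)) \<le> M" using j by (auto simp: J_def)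
    moreover have "norm (poly D (w j)) \<le> 2 ^ card J"
    proof -
      have "norm (w j - w i) \<le> 2" for i
        using norm_triangle_ineq4[of "w j" "w i"] by (simp add: w_def)
      then have "(\<Prod>i\<in>J. norm (w j - w i)) \<le> (\<Prod>i\<in>J. 2)"
        by (intro prod_mono) auto
      then show ?thesis by (simp add: polyD prod_norm)
    qed
    ultimately show ?thesis using M by (simp add: norm_mult mult_mono)
  qed
  have bd: "norm (poly P z) \<le> real K * M * (2 / \<delta>) ^ b * (1 + \<delta>) ^ K" if z: "norm z = 1 + \<delta>" for z
  proof -
    have "norm (poly (P * D) z) \<le> (\<Sum>i<K. (M * 2 ^ card J) * (1 + \<delta>) ^ K)"
      unfolding poly_altdef_lessThan[OF degT]
    proof (rule sum_norm_le)
      fix i assume i: "i \<in> {..<K}"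
      have "norm (coeff (P * D) i) \<le> M * 2 ^ card J"
        by (rule coeff_le_on_rotated_roots[OF degT, of _ s]) (use i T w_def in auto)
      moreover have "norm z ^ i \<le> (1 + \<delta>) ^ K" unfolding z using \<delta> i by (intro power_increasing) auto
      ultimately show "norm (coeff (P * D) i * z ^ i) \<le> M * 2 ^ card J * (1 + \<delta>) ^ K"
        using M by (simp add: norm_mult norm_power mult_mono del: coeff_mult)
    qed
    then have 1: "norm (poly P z) * norm (poly D z) \<le> real K * (M * 2 ^ card J * (1 + \<delta>) ^ K)"
      by (simp add: norm_mult)
    have "(\<Prod>i\<in>J. \<delta>) \<le> (\<Prod>i\<in>J. norm (z - w i))"
    proof (rule prod_mono)
      fix i assume "i \<in> J"
      show "0 \<le> \<delta> \<and> \<delta> \<le> norm (z - w i)"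
        using norm_triangle_ineq2[of z "w i"] z \<delta> by (simp add: w_def)
    qed
    then have "\<delta> ^ card J \<le> norm (poly D z)" by (simp add: polyD prod_norm)
    then have "norm (poly P z) * \<delta> ^ card J \<le> real K * (M * 2 ^ card J * (1 + \<delta>) ^ K)"
      using 1 mult_left_mono[of "\<delta> ^ card J" "norm (poly D z)" "norm (poly P z)"] by simp
    then have "norm (poly P z) \<le> real K * M * (2 / \<delta>) ^ card J * (1 + \<delta>) ^ K"
      using \<delta> by (simp add: field_simps)
    also have "\<dots> \<le> real K * M * (2 / \<delta>) ^ b * (1 + \<delta>) ^ K"
      using \<delta> M cJ by (intro mult_right_mono mult_left_mono power_increasing) (auto simp: field_simps)
    finally show ?thesis .
  qed
  show ?thesis
  proof (rule maximum_modulus_frontier[of "poly P" "cball 0 (1 + \<delta>)"])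
    show "poly P holomorphic_on interior (cball 0 (1 + \<delta>))" by (intro holomorphic_intros) 
    show "continuous_on (closure (cball 0 (1 + \<delta>))) (poly P)" by (intro continuous_intros)
    show "z \<in> cball 0 (1 + \<delta>)" using z by simp
    fix z :: complex assume "z \<in> frontier (cball 0 (1 + \<delta>))"
    then show "norm (poly P z) \<le> real K * M * (2 / \<delta>) ^ b * (1 + \<delta>) ^ K"
      using \<delta> by (intro bd) auto
  qed auto
qed

text \<open>The number of hits, averaged over the shifts \<open>s\<close> in an interval of length \<open>1 / K\<close>, is the
  measure of the set times \<open>K\<close>.\<close>

lemma exists_shift_few_hits:
  fixes A :: "real set"
  assumes A: "A \<in> sets borel" and m: "emeasure lborel (A \<inter> {0..<1}) < ennreal \<kappa>"
    and K: "K > 0" and \<kappa>: "\<kappa> > 0"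
  shows "\<exists>s. real (card {j \<in> {..<K}. s + real j / real K \<in> A}) \<le> \<kappa> * real K"
proof (rule ccontr)
  assume "\<not> ?thesis"
  then have big: "real (card {j \<in> {..<K}. s + real j / real K \<in> A}) > \<kappa> * real K" for s
    by (simp add: not_le)
  define I where "I = {0..<1 / real K}"
  have ind: "(\<Sum>j<K. indicator A (s + real j / real K)) = (of_nat (card {j \<in> {..<K}. s + real j / real K \<in> A}) :: ennreal)" for s
    by (simp add: indicator_def sum.If_cases Int_def)
  have "ennreal \<kappa> = (\<integral>\<^sup>+s. ennreal (\<kappa> * real K) * indicator I s \<partial>lborel)"
    using K \<kappa> by (simp add: nn_integral_cmult_indicator I_def ennreal_mult[symmetric])
  also have "\<dots> \<le> (\<integral>\<^sup>+s. (\<Sum>j<K. indicator I s * indicator A (s + real j / real K)) \<partial>lborel)"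
  proof (rule nn_integral_mono)
    fix s :: real
    have "ennreal (\<kappa> * real K) \<le> ennreal (real (card {j \<in> {..<K}. s + real j / real K \<in> A}))"
      using big[of s] by (intro ennreal_leI) simp
    then show "ennreal (\<kappa> * real K) * indicator I s \<le> (\<Sum>j<K. indicator I s * indicator A (s + real j / real K))"
      unfolding sum_distrib_left[symmetric] ind by (simp add: indicator_def ennreal_of_nat_eq_real_of_nat)
  qed
  also have "\<dots> = (\<Sum>j<K. \<integral>\<^sup>+s. indicator I s * indicator A (s + real j / real K) \<partial>lborel)"
    using A by (intro nn_integral_sum) (auto simp: I_def)
  also have "\<dots> = (\<Sum>j<K. \<integral>\<^sup>+x. indicator I (x - real j / real K) * indicator A x \<partial>lborel)"
  proof (rule sum.cong)
    fix j
    show "(\<integral>\<^sup>+s. indicator I s * indicator A (s + real j / real K) \<partial>lborel) =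
      (\<integral>\<^sup>+x. indicator I (x - real j / real K) * indicator A x \<partial>lborel)"
      using A by (subst nn_integral_real_affine[where c=1 and t="real j / real K"]) (auto simp: I_def add.commute)
  qed simp
  also have "\<dots> = (\<integral>\<^sup>+x. (\<Sum>j<K. indicator I (x - real j / real K) * indicator A x) \<partial>lborel)"
    using A by (intro nn_integral_sum[symmetric]) (auto simp: I_def)
  also have "\<dots> \<le> (\<integral>\<^sup>+x. indicator (A \<inter> {0..<1}) x \<partial>lborel)"
  proof (rule nn_integral_mono)
    fix x :: real
    let ?S = "{j \<in> {..<K}. x - real j / real K \<in> I}"
    have "(\<Sum>j<K. indicator I (x - real j / real K)) = (of_nat (card ?S) :: ennreal)"
      by (simp add: indicator_def sum.If_cases Int_def)
    moreover have "of_nat (card ?S) \<le> (indicator {0..<1} x :: ennreal)"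
    proof (cases "?S = {}")
      case False
      have sub: "?S \<subseteq> {nat \<lfloor>x * real K\<rfloor>}"
      proof
        fix j assume j: "j \<in> ?S"
        then have "\<lfloor>x * real K\<rfloor> = int j"
        proof (intro floor_unique)
          have j: "real j / real K \<le> x" "x < real j / real K + 1 / real K" using j by (auto simp: I_def)
          show "real_of_int (int j) \<le> x * real K" using j(1) K by (simp add: field_simps)
          have "x * real K < (real j / real K + 1 / real K) * real K"
            using j(2) K by (intro mult_strict_right_mono) auto
          also have "\<dots> = real j + 1" using K by (simp add: distrib_right)
          finally show "x * real K < real_of_int (int j) + 1" by simp
        qed
        then show "j \<in> {nat \<lfloor>x * real K\<rfloor>}" by simp
      qed
      have "card ?S \<le> 1" using card_mono[OF _ sub] by simp
      moreover have "x \<in> {0..<1}"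
      proof -
        obtain j where j: "j < K" "x - real j / real K \<in> I" using False by auto
        then have "real j + 1 \<le> real K" by simp
        then have "real j / real K + 1 / real K \<le> 1" using K by (simp add: field_simps)
        moreover have "0 \<le> real j / real K" by simp
        ultimately show ?thesis using j(2) by (simp only: I_def atLeastLessThan_iff) linarith
      qed
      ultimately show ?thesis by (simp add: indicator_def)
    next
      case True
      then show ?thesis by (simp only: card.empty of_nat_0 zero_le)
    qed
    ultimately show "(\<Sum>j<K. indicator I (x - real j / real K) * indicator A x) \<le> (indicator (A \<inter> {0..<1}) x :: ennreal)"
      unfolding sum_distrib_right[symmetric] indicator_inter_arith
      by (metis mult.commute mult_left_mono zero_le)
  qed
  also have "\<dots> = emeasure lborel (A \<inter> {0..<1})" using A by simp
  finally show False using m by simp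
qed

text \<open>The Joukowski substitution turns the interval into the unit circle.\<close>

lemma joukowski_poly:
  fixes Q :: "complex poly"
  assumes "degree Q \<le> m"
  obtains P where "degree P \<le> 2 * m" "\<And>w. w \<noteq> 0 \<Longrightarrow> poly P w = w ^ m * poly Q ((w + 1 / w) / 2)"
proof
  let ?P = "\<Sum>k\<le>m. smult (coeff Q k / 2 ^ k) (monom 1 (m - k) * [:1, 0, 1:] ^ k)"
  show "degree ?P \<le> 2 * m"
  proof (rule degree_sum_le)
    fix k assume k: "k \<in> {..m}"
    have "degree ([:1, 0, 1:] ^ k :: complex poly) \<le> 2 * k"
      using degree_power_le[of "[:1, 0, 1:] :: complex poly" k] by simp
    then have "degree (monom 1 (m - k) * [:1, 0, 1:] ^ k :: complex poly) \<le> (m - k) + 2 * k"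
      using degree_mult_le[of "monom 1 (m - k)" "[:1, 0, 1:] ^ k :: complex poly"] degree_monom_le[of "1::complex" "m - k"]
      by linarith
    then show "degree (smult (coeff Q k / 2 ^ k) (monom 1 (m - k) * [:1, 0, 1:] ^ k)) \<le> 2 * m"
      using k degree_smult_le[of "coeff Q k / 2 ^ k" "monom 1 (m - k) * [:1, 0, 1:] ^ k"] by simp
  qed simp
  fix w :: complex assume w: "w \<noteq> 0"
  have "poly Q ((w + 1 / w) / 2) = (\<Sum>k\<le>m. coeff Q k * ((w + 1 / w) / 2) ^ k)"
    unfolding poly_altdef using assms
    by (intro sum.mono_neutral_left) (auto intro: coeff_eq_0)
  moreover have "w ^ m * (coeff Q k * ((w + 1 / w) / 2) ^ k) = coeff Q k / 2 ^ k * (w ^ (m - k) * (1 + w * w) ^ k)"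
    if k: "k \<le> m" for k
  proof -
    have "w ^ m = w ^ (m - k) * w ^ k" using k by (simp flip: power_add)
    moreover have "w ^ k * ((w + 1 / w) / 2) ^ k = (1 + w * w) ^ k / 2 ^ k"
    proof -
      have "w * ((w + 1 / w) / 2) = (1 + w * w) / 2" using w by (simp add: field_simps)
      then show ?thesis by (metis power_mult_distrib power_divide)
    qed
    ultimately have "w ^ m * (coeff Q k * ((w + 1 / w) / 2) ^ k) = coeff Q k * w ^ (m - k) * ((1 + w * w) ^ k / 2 ^ k)"
      by (metis mult.assoc mult.left_commute)
    then show ?thesis by simp
  qed
  ultimately show "poly ?P w = w ^ m * poly Q ((w + 1 / w) / 2)"
    by (simp add: poly_sum poly_monom sum_distrib_left)
qed

text \<open>The two solutions are inverse to each other, so one of them lies outside the open unit disc.\<close>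

lemma joukowski_preimage:
  fixes t :: complex
  obtains w where "w \<noteq> 0" "(w + 1 / w) / 2 = t" "norm w \<ge> 1" "norm w \<le> 1 + 2 * norm t"
proof -
  define v where "v = t + csqrt (t\<^sup>2 - 1)"
  have eq: "v * (t - csqrt (t\<^sup>2 - 1)) = 1"
  proof -
    have "v * (t - csqrt (t\<^sup>2 - 1)) = t\<^sup>2 - (csqrt (t\<^sup>2 - 1))\<^sup>2"
      by (simp add: v_def algebra_simps power2_eq_square)
    then show ?thesis by simp
  qed
  then have v0: "v \<noteq> 0" by auto
  have inv: "1 / v = t - csqrt (t\<^sup>2 - 1)" using eq v0 by (simp add: field_simps)
  have s: "v + 1 / v = 2 * t" unfolding inv by (simp add: v_def)
  define w where "w = (if norm v \<ge> 1 then v else 1 / v)"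
  have w: "w \<noteq> 0" "w + 1 / w = 2 * t" using v0 s by (auto simp: w_def add.commute)
  have n: "norm w \<ge> 1" using v0 by (auto simp: w_def norm_divide field_simps)
  have "w = 2 * t - 1 / w" using w(2) by (simp add: eq_diff_eq)
  then have "norm w = norm (2 * t - 1 / w)" by simp
  also have "\<dots> \<le> norm (2 * t) + norm (1 / w)" by (rule norm_triangle_ineq4)
  also have "norm (1 / w) \<le> 1" using n w(1) by (simp add: norm_divide field_simps)
  finally have "norm w \<le> 1 + 2 * norm t" by (simp add: norm_mult)
  then show thesis using that[of w] w n by simp
qed

text \<open>Leja's lemma in one variable. By continuity of measure the family is uniformly bounded off a
  set of angles of small measure; a suitable rotation of the roots of unity meets that set rarely,
  and the Remez inequality applies. The radius depends on \<open>\<epsilon>\<close> alone.\<close>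

lemma leja_one_variable:
  fixes \<epsilon> :: real
  assumes "\<epsilon> > 0"
  obtains r where "r > 0"
    "\<And>F :: (nat \<times> complex poly) set. (\<And>m Q. (m, Q) \<in> F \<Longrightarrow> degree Q \<le> m) \<Longrightarrow>
       (\<And>x. \<bar>x\<bar> \<le> 1 \<Longrightarrow> \<exists>N. \<forall>(m, Q)\<in>F. norm (poly Q (complex_of_real x)) \<le> N) \<Longrightarrow>
       \<exists>N. \<forall>(m, Q)\<in>F. \<forall>t. norm t \<le> r \<longrightarrow> norm (poly Q t) \<le> N * (1 + \<epsilon>) ^ m"
proof -
  \<comment> \<open>Each of the three factors of the Remez bound may grow like \<open>(1 + e)\<^sup>m\<close>, and \<open>(1 + e)\<^sup>3 \<le> 1 + 7 e\<close>.\<close>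
  define e where "e = min 1 (\<epsilon> / 7)"
  have e: "0 < e" "e \<le> 1" "7 * e \<le> \<epsilon>" using assms by (auto simp: e_def)
  have e3: "(1 + e) ^ 3 \<le> 1 + \<epsilon>"
  proof -
    have "e ^ 2 \<le> e" "e ^ 3 \<le> e" using e power_decreasing[of 1 _ e] by auto
    moreover have "(1 + e) ^ 3 = 1 + 3 * e + 3 * e ^ 2 + e ^ 3"
      by (simp add: eval_nat_numeral algebra_simps)
    ultimately show ?thesis using e by linarith
  qed
  \<comment> \<open>The Remez factor \<open>(1 + \<delta>)\<^sup>K\<close> has an exponent of about \<open>4 m\<close>, and \<open>(1 + \<delta>)\<^sup>4 \<le> 1 + 15 \<delta>\<close>.\<close>
  define \<delta> where "\<delta> = e / 15"
  have \<delta>: "0 < \<delta>" "\<delta> \<le> 1" "15 * \<delta> \<le> e" using e by (auto simp: \<delta>_def)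
  have d4: "(1 + \<delta>) ^ 4 \<le> 1 + e"
  proof -
    have "\<delta> ^ 2 \<le> \<delta>" "\<delta> ^ 3 \<le> \<delta>" "\<delta> ^ 4 \<le> \<delta>" using \<delta> power_decreasing[of 1 _ \<delta>] by auto
    moreover have "(1 + \<delta>) ^ 4 = 1 + 4 * \<delta> + 6 * \<delta> ^ 2 + 4 * \<delta> ^ 3 + \<delta> ^ 4"
      by (simp add: eval_nat_numeral algebra_simps)
    ultimately show ?thesis using \<delta> by linarith
  qed
  have ln2: "ln (2 / \<delta>) > 0" using \<delta> by simp
  \<comment> \<open>The proportion of exceptional nodes whose cost \<open>(2 / \<delta>)\<^bsup>4 \<kappa>\<^esup>\<close> per degree is at most \<open>1 + e\<close>.\<close>
  define \<kappa> where "\<kappa> = min (1 / 4) (ln (1 + e) / (4 * ln (2 / \<delta>)))"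
  have \<kappa>: "0 < \<kappa>" "\<kappa> \<le> 1 / 4" using e ln2 by (auto simp: \<kappa>_def)
  have l4: "(2 / \<delta>) powr (4 * \<kappa>) \<le> 1 + e"
  proof -
    have "4 * \<kappa> * ln (2 / \<delta>) \<le> ln (1 + e)"
    proof -
      have "\<kappa> \<le> ln (1 + e) / (4 * ln (2 / \<delta>))" by (simp add: \<kappa>_def)
      then show ?thesis using ln2 by (simp add: field_simps)
    qed
    then have "exp (4 * \<kappa> * ln (2 / \<delta>)) \<le> exp (ln (1 + e))" by simp
    then show ?thesis using e \<delta> by (simp add: powr_def)
  qed
  show thesis
  proof (rule that[of "\<delta> / 2"])
    show "\<delta> / 2 > 0" using \<delta> by simp
    fix F :: "(nat \<times> complex poly) set"
    assume deg: "\<And>m Q. (m, Q) \<in> F \<Longrightarrow> degree Q \<le> m"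
      and pb: "\<And>x. \<bar>x\<bar> \<le> 1 \<Longrightarrow> \<exists>N. \<forall>(m, Q)\<in>F. norm (poly Q (complex_of_real x)) \<le> N"
    define E where "E N = {s. \<forall>(m, Q)\<in>F. norm (poly Q (complex_of_real (cos (2 * pi * s)))) \<le> real N}" for N
    have clE: "closed (E N)" for N
    proof -
      have "E N = (\<Inter>(m, Q)\<in>F. {s. norm (poly Q (complex_of_real (cos (2 * pi * s)))) \<le> real N})"
        by (auto simp: E_def)
      also have "closed \<dots>"
        by (auto intro!: closed_INT closed_Collect_le continuous_intros)
      finally show ?thesis .
    qed
    define A where "A N = - E N" for N
    have A: "A N \<in> sets borel" for N unfolding A_def using clE borel_open by blast
    have lim: "(\<lambda>N. emeasure lborel (A N \<inter> {0..<1})) \<longlonglongrightarrow> emeasure lborel (\<Inter>N. A N \<inter> {0..<1})"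
    proof (rule Lim_emeasure_decseq)
      show "range (\<lambda>N. A N \<inter> {0..<1}) \<subseteq> sets lborel" using A by auto
      show "decseq (\<lambda>N. A N \<inter> {0..<1})"
        proof (rule antimonoI)
        fix M N :: nat assume "M \<le> N"
        then have "real M \<le> real N" by simp
        then have "E M \<subseteq> E N" unfolding E_def by (force intro: order_trans)
        then show "A N \<inter> {0..<1} \<subseteq> A M \<inter> {0..<1}" by (auto simp: A_def)
      qed
      show "emeasure lborel (A N \<inter> {0..<1}) \<noteq> \<infinity>" for N
      proof -
        have "emeasure lborel (A N \<inter> {0..<1}) \<le> emeasure lborel {0..<1::real}"
          by (rule emeasure_mono) auto
        then show ?thesis by (auto simp: top_unique)
      qed
    qed
    have "(\<Inter>N. A N \<inter> {0..<1}) = {}"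
    proof -
      have "\<exists>N. s \<in> E N" for s
      proof -
        obtain N where N: "\<forall>(m, Q)\<in>F. norm (poly Q (complex_of_real (cos (2 * pi * s)))) \<le> N"
          using pb[of "cos (2 * pi * s)"] by auto
        obtain n where "N \<le> real n" using real_arch_simple by blast
        then have "s \<in> E n" using N by (fastforce simp: E_def)
        then show ?thesis ..
      qed
      then show ?thesis by (auto simp: A_def)
    qed
    with lim have "(\<lambda>N. emeasure lborel (A N \<inter> {0..<1})) \<longlonglongrightarrow> 0" by simp
    then have "eventually (\<lambda>N. emeasure lborel (A N \<inter> {0..<1}) < ennreal \<kappa>) sequentially"
      by (rule order_tendstoD(2)) (use \<kappa> in simp)
    then obtain N where N: "emeasure lborel (A N \<inter> {0..<1}) < ennreal \<kappa>"
      using eventually_sequentially by auto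
    define C where "C = (4 / e + 1) * real N * ((2 / \<delta>) powr \<kappa> * (1 + \<delta>))"
    have "norm (poly Q t) \<le> C * (1 + \<epsilon>) ^ m" if mQ: "(m, Q) \<in> F" and t: "norm t \<le> \<delta> / 2" for m Q t
    proof -
      \<comment> \<open>Enough nodes: the transformed polynomial has degree \<open>2 m\<close>, and at most a quarter of the nodes is
        exceptional.\<close>
      define K where "K = 4 * m + 1"
      have K: "K > 0" by (simp add: K_def)
      obtain P where P: "degree P \<le> 2 * m"
        "\<And>w. w \<noteq> 0 \<Longrightarrow> poly P w = w ^ m * poly Q ((w + 1 / w) / 2)"
        using joukowski_poly[OF deg[OF mQ]] by blast
      obtain s where s: "real (card {j \<in> {..<K}. s + real j / real K \<in> A N}) \<le> \<kappa> * real K"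
        using exists_shift_few_hits[OF A N K \<kappa>(1)] by blast
      define b where "b = card {j \<in> {..<K}. s + real j / real K \<in> A N}"
      have b: "real b \<le> \<kappa> * real K" using s by (simp add: b_def)
      have "{j \<in> {..<K}. norm (poly P (cis (2 * pi * (s + real j / real K)))) > real N} \<subseteq>
          {j \<in> {..<K}. s + real j / real K \<in> A N}"
      proof safe
        fix j assume j: "norm (poly P (cis (2 * pi * (s + real j / real K)))) > real N"
        let ?\<theta> = "2 * pi * (s + real j / real K)"
        have "(cis ?\<theta> + 1 / cis ?\<theta>) / 2 = complex_of_real (cos ?\<theta>)"
          by (simp add: complex_eq_iff cis_divide inverse_eq_divide[symmetric])
        then have "norm (poly P (cis ?\<theta>)) = norm (poly Q (complex_of_real (cos ?\<theta>)))"
          by (subst P(2)) (auto simp: norm_mult norm_power)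
        then have "\<not> norm (poly Q (complex_of_real (cos ?\<theta>))) \<le> real N" using j by simp
        then show "s + real j / real K \<in> A N" using mQ unfolding A_def E_def by blast
      qed
      then have J: "card {j \<in> {..<K}. norm (poly P (cis (2 * pi * (s + real j / real K)))) > real N} \<le> b"
        unfolding b_def by (intro card_mono) auto
      have "\<kappa> * real K \<le> 1 / 4 * real K" using \<kappa> by (intro mult_right_mono) auto
      moreover have "real (degree P) \<le> 2 * real m" "real K = 4 * real m + 1"
        using of_nat_mono[OF P(1), where ?'a=real] by (simp_all add: K_def)
      ultimately have "real (degree P) + real b < real K" using b by linarith
      then have degb: "degree P + b < K" by linarith
      obtain w where w: "w \<noteq> 0" "(w + 1 / w) / 2 = t" "norm w \<ge> 1" "norm w \<le> 1 + 2 * norm t"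
        using joukowski_preimage by blast
      have "norm (poly Q t) \<le> norm (w ^ m) * norm (poly Q t)"
        using w(3) one_le_power[of "norm w" m] mult_right_mono[of 1 "norm w ^ m" "norm (poly Q t)"]
        by (simp add: norm_power)
      also have "\<dots> = norm (poly P w)" using P(2)[OF w(1)] w(2) by (simp add: norm_mult)
      also have "\<dots> \<le> real K * real N * (2 / \<delta>) ^ b * (1 + \<delta>) ^ K"
        by (rule poly_bound_from_most_roots[OF degb _ \<delta>(1,2) J]) (use w t in auto)
      also have "\<dots> \<le> ((4 / e + 1) * (1 + e) ^ m) * real N * ((2 / \<delta>) powr \<kappa> * (1 + e) ^ m) * ((1 + \<delta>) * (1 + e) ^ m)"
      proof -
        have 1: "real K \<le> (4 / e + 1) * (1 + e) ^ m"
        proof -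
          have "1 + real m * e \<le> (1 + e) ^ m" using Bernoulli_inequality[of e m] e by simp
          then have "(4 / e + 1) * (1 + real m * e) \<le> (4 / e + 1) * (1 + e) ^ m"
            using e by (intro mult_left_mono) auto
          moreover have "real K \<le> (4 / e + 1) * (1 + real m * e)"
            using e by (simp add: K_def field_simps)
          ultimately show ?thesis by linarith
        qed
        have 2: "(2 / \<delta>) ^ b \<le> (2 / \<delta>) powr \<kappa> * (1 + e) ^ m"
        proof -
          have "(2 / \<delta>) ^ b = (2 / \<delta>) powr real b" using \<delta> by (simp add: powr_realpow)
          also have "\<dots> \<le> (2 / \<delta>) powr (\<kappa> * real K)" using \<delta> b by (intro powr_mono) (auto simp: field_simps)
          also have "\<dots> = (2 / \<delta>) powr \<kappa> * ((2 / \<delta>) powr (4 * \<kappa>)) powr real m"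
            by (simp add: K_def powr_powr powr_add[symmetric] algebra_simps)
          also have "\<dots> = (2 / \<delta>) powr \<kappa> * ((2 / \<delta>) powr (4 * \<kappa>)) ^ m"
            using \<delta> by (simp add: powr_realpow)
          also have "\<dots> \<le> (2 / \<delta>) powr \<kappa> * (1 + e) ^ m"
            using l4 by (intro mult_left_mono power_mono) auto
          finally show ?thesis .
        qed
        have 3: "(1 + \<delta>) ^ K \<le> (1 + \<delta>) * (1 + e) ^ m"
          using d4 \<delta> by (simp add: K_def power_mult power_mono)
        show ?thesis
          by (intro mult_mono 1 2 3 mult_nonneg_nonneg order_refl) (use \<delta> e in auto)
      qed
      also have "\<dots> = C * ((1 + e) ^ 3) ^ m"
        by (simp add: C_def power3_eq_cube power_mult_distrib mult_ac)
      also have "\<dots> \<le> C * (1 + \<epsilon>) ^ m"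
        using e3 e \<delta> by (intro mult_left_mono power_mono) (auto simp: C_def)
      finally show ?thesis .
    qed
    then show "\<exists>N. \<forall>(m, Q)\<in>F. \<forall>t. norm t \<le> \<delta> / 2 \<longrightarrow> norm (poly Q t) \<le> N * (1 + \<epsilon>) ^ m"
      by (intro exI[of _ C]) auto
  qed
qed

text \<open>Only the degree in each single variable matters for Leja's lemma.\<close>

definition separately_poly :: "nat \<Rightarrow> (complex ^ 'n \<Rightarrow> complex) \<Rightarrow> bool" where
  "separately_poly m Q \<longleftrightarrow> (\<forall>i z. \<exists>P. degree P \<le> m \<and> (\<forall>t. Q (\<chi> j. if j = i then t else z $ j) = poly P t))"

text \<open>Complexify one coordinate at a time: once the bound is uniform in the coordinates already
  treated, these become parameters of the family to which the one-variable lemma is applied.\<close>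

lemma leja_separately:
  fixes \<epsilon> :: real
  assumes \<epsilon>: "\<epsilon> > 0"
  obtains r where "r > 0"
    "\<And>F :: (nat \<times> (complex ^ 'n \<Rightarrow> complex)) set. (\<And>m Q. (m, Q) \<in> F \<Longrightarrow> separately_poly m Q) \<Longrightarrow>
       (\<And>x. (\<And>i. \<bar>x $ i\<bar> \<le> 1) \<Longrightarrow> \<exists>N. \<forall>(m, Q)\<in>F. norm (Q (cvec x)) \<le> N) \<Longrightarrow>
       \<exists>N. \<forall>(m, Q)\<in>F. \<forall>z. (\<forall>i. norm (z $ i) \<le> r) \<longrightarrow> norm (Q z) \<le> N * (1 + \<epsilon>) ^ m"
proof -
  let ?n = "CARD('n)"
  define e where "e = (1 + \<epsilon>) powr (1 / real ?n) - 1"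
  have e: "e > 0" unfolding e_def using \<epsilon> by (simp add: gr_one_powr)
  have en: "(1 + e) ^ ?n = 1 + \<epsilon>"
    using \<epsilon> by (simp add: e_def powr_realpow[symmetric] powr_powr)
  obtain r where r: "r > 0" and R: "\<And>F :: (nat \<times> complex poly) set. (\<And>m Q. (m, Q) \<in> F \<Longrightarrow> degree Q \<le> m) \<Longrightarrow>
       (\<And>x. \<bar>x\<bar> \<le> 1 \<Longrightarrow> \<exists>N. \<forall>(m, Q)\<in>F. norm (poly Q (complex_of_real x)) \<le> N) \<Longrightarrow>
       \<exists>N. \<forall>(m, Q)\<in>F. \<forall>t. norm t \<le> r \<longrightarrow> norm (poly Q t) \<le> N * (1 + e) ^ m"
    using leja_one_variable[OF e] by blast
  show thesis
  proof (rule that[OF r])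
    fix F :: "(nat \<times> (complex ^ 'n \<Rightarrow> complex)) set"
    assume sep: "\<And>m Q. (m, Q) \<in> F \<Longrightarrow> separately_poly m Q"
      and pb: "\<And>x. (\<And>i. \<bar>x $ i\<bar> \<le> 1) \<Longrightarrow> \<exists>N. \<forall>(m, Q)\<in>F. norm (Q (cvec x)) \<le> N"
    have "\<exists>N. \<forall>(m, Q)\<in>F. \<forall>z. (\<forall>j\<in>I. norm (z $ j) \<le> r) \<and> (\<forall>j. j \<notin> I \<longrightarrow> z $ j = complex_of_real (x $ j)) \<longrightarrow>
        norm (Q z) \<le> N * ((1 + e) ^ card I) ^ m" if "\<And>i. \<bar>x $ i\<bar> \<le> 1" for I :: "'n set" and x :: "real ^ 'n"
      using finite[of I] that
    proof (induction I arbitrary: x rule: finite_induct)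
      case empty
      have "z = cvec x" if "\<forall>j. z $ j = complex_of_real (x $ j)" for z using that by (simp add: vec_eq_iff)
      then show ?case using pb[OF empty] by force
    next
      case (insert i I)
      let ?D = "\<lambda>m::nat. ((1 + e) ^ card I) ^ m"
      have D: "?D m > 0" for m using e by simp
      \<comment> \<open>The slices in the i-th direction, normalized by the growth already accepted in the other coordinates.\<close>
      define G where "G = {(m, P). \<exists>Q z P0. (m, Q) \<in> F \<and> (\<forall>j\<in>I. norm (z $ j) \<le> r) \<and>
          (\<forall>j. j \<notin> I \<and> j \<noteq> i \<longrightarrow> z $ j = complex_of_real (x $ j)) \<and> degree P0 \<le> m \<and>
          (\<forall>t. Q (\<chi> j. if j = i then t else z $ j) = poly P0 t) \<and> P = smult (complex_of_real (1 / ?D m)) P0}"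
      have "\<exists>N. \<forall>(m, Q)\<in>G. \<forall>t. norm t \<le> r \<longrightarrow> norm (poly Q t) \<le> N * (1 + e) ^ m"
      proof (rule R)
        show "degree Q \<le> m" if "(m, Q) \<in> G" for m Q
          using that degree_smult_le order_trans unfolding G_def by blast
        fix y :: real assume y: "\<bar>y\<bar> \<le> 1"
        define x' where "x' = (\<chi> j. if j = i then y else x $ j)"
        have "\<bar>x' $ j\<bar> \<le> 1" for j using y insert.prems by (simp add: x'_def)
        from insert.IH[OF this] obtain N where N: "\<And>m Q z. (m, Q) \<in> F \<Longrightarrow> \<forall>j\<in>I. norm (z $ j) \<le> r \<Longrightarrow>
            \<forall>j. j \<notin> I \<longrightarrow> z $ j = complex_of_real (x' $ j) \<Longrightarrow> norm (Q z) \<le> N * ?D m" by blast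
        have "norm (poly P (complex_of_real y)) \<le> N" if mP: "(m, P) \<in> G" for m P
        proof -
          obtain Q z P0 where Q: "(m, Q) \<in> F" "\<forall>j\<in>I. norm (z $ j) \<le> r"
            "\<forall>j. j \<notin> I \<and> j \<noteq> i \<longrightarrow> z $ j = complex_of_real (x $ j)"
            "\<And>t. Q (\<chi> j. if j = i then t else z $ j) = poly P0 t" "P = smult (complex_of_real (1 / ?D m)) P0"
            using mP unfolding G_def by blast
          have "norm (poly P0 (complex_of_real y)) \<le> N * ?D m"
            unfolding Q(4)[symmetric]
            by (rule N[OF Q(1)]) (use Q insert.hyps in \<open>auto simp: x'_def\<close>)
          moreover have "norm (complex_of_real (1 / ?D m)) = 1 / ?D m"
            using D[of m] by (simp only: norm_of_real) simp
          ultimately show ?thesis using D[of m] unfolding Q(5) poly_smult norm_mult by (simp add: field_simps)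
        qed
        then show "\<exists>N. \<forall>(m, Q)\<in>G. norm (poly Q (complex_of_real y)) \<le> N" by auto
      qed
      then obtain N where N: "\<And>m P t. (m, P) \<in> G \<Longrightarrow> norm t \<le> r \<Longrightarrow> norm (poly P t) \<le> N * (1 + e) ^ m" by blast
      have "norm (Q z) \<le> N * ((1 + e) ^ card (insert i I)) ^ m" if mQ: "(m, Q) \<in> F"
        and z: "\<forall>j\<in>insert i I. norm (z $ j) \<le> r" "\<forall>j. j \<notin> insert i I \<longrightarrow> z $ j = complex_of_real (x $ j)" for m Q z
      proof -
        obtain P where P: "degree P \<le> m" "\<And>t. Q (\<chi> j. if j = i then t else z $ j) = poly P t"
          using sep[OF mQ] unfolding separately_poly_def by blast
        have "(m, smult (complex_of_real (1 / ?D m)) P) \<in> G"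
          unfolding G_def using mQ z P by auto
        then have "norm (poly (smult (complex_of_real (1 / ?D m)) P) (z $ i)) \<le> N * (1 + e) ^ m"
          by (rule N) (use z in simp)
        moreover have "norm (complex_of_real (1 / ?D m)) = 1 / ?D m"
          using D[of m] by (simp only: norm_of_real) simp
        ultimately have "norm (poly P (z $ i)) / ?D m \<le> N * (1 + e) ^ m"
          unfolding poly_smult norm_mult by simp
        moreover have pow: "((1 + e) ^ card (insert i I)) ^ m = (1 + e) ^ m * ?D m"
          using insert.hyps by (simp add: power_mult_distrib)
        moreover have "poly P (z $ i) = Q z"
          unfolding P(2)[symmetric] by (rule arg_cong[of _ _ Q]) (simp add: vec_eq_iff)
        ultimately show ?thesis
          using D[of m] by (simp add: field_simps pow)
      qed
      then show ?case by (intro exI[of _ N]) auto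
    qed
    note this[of 0 UNIV]
    then show "\<exists>N. \<forall>(m, Q)\<in>F. \<forall>z. (\<forall>i. norm (z $ i) \<le> r) \<longrightarrow> norm (Q z) \<le> N * (1 + \<epsilon>) ^ m"
      by (simp add: en)
  qed
qed

lemma separately_poly_cmult: "separately_poly m Q \<Longrightarrow> separately_poly m (\<lambda>z. a * Q z)"
  unfolding separately_poly_def
proof (intro allI)
  fix i z assume "\<forall>i z. \<exists>P. degree P \<le> m \<and> (\<forall>t. Q (\<chi> j. if j = i then t else z $ j) = poly P t)"
  then obtain P where "degree P \<le> m" "\<And>t. Q (\<chi> j. if j = i then t else z $ j) = poly P t" by blast
  then show "\<exists>P. degree P \<le> m \<and> (\<forall>t. a * Q (\<chi> j. if j = i then t else z $ j) = poly P t)"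
    by (intro exI[of _ "smult a P"]) (auto intro: order_trans[OF degree_smult_le])
qed

lemma separately_poly_mseries:
  assumes c: "c \<in> hom_coeffs (int m)"
  shows "separately_poly m (\<lambda>z. mseries c (a + s *s z))"
  unfolding separately_poly_def
proof (intro allI)
  fix i :: 'a and z
  let ?P = "\<Sum>\<alpha> | mdegree \<alpha> = m. smult (c \<alpha> * (\<Prod>j\<in>-{i}. (a $ j + s * z $ j) ^ \<alpha> j)) ([:a $ i, s:] ^ \<alpha> i)"
  show "\<exists>P. degree P \<le> m \<and> (\<forall>t. mseries c (a + s *s (\<chi> j. if j = i then t else z $ j)) = poly P t)"
  proof (intro exI[of _ ?P] conjI allI)
    show "degree ?P \<le> m"
    proof (rule degree_sum_le[OF finite_mdegree])
      fix \<alpha> :: "'a \<Rightarrow> nat" assume \<alpha>: "\<alpha> \<in> {\<alpha>. mdegree \<alpha> = m}"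
      have "degree ([:a $ i, s:] ^ \<alpha> i) \<le> degree [:a $ i, s:] * \<alpha> i" by (rule degree_power_le)
      also have "\<dots> \<le> 1 * \<alpha> i" by (intro mult_right_mono) auto
      also have "\<dots> \<le> m" using le_mdegree[of \<alpha> i] \<alpha> by simp
      finally show "degree (smult (c \<alpha> * (\<Prod>j\<in>-{i}. (a $ j + s * z $ j) ^ \<alpha> j)) ([:a $ i, s:] ^ \<alpha> i)) \<le> m"
        using degree_smult_le order_trans by blast
    qed
    fix t
    let ?w = "a + s *s (\<chi> j. if j = i then t else z $ j)"
    have "monomial \<alpha> ?w = (a $ i + s * t) ^ \<alpha> i * (\<Prod>j\<in>-{i}. (a $ j + s * z $ j) ^ \<alpha> j)" for \<alpha>
      unfolding monomial_split[of \<alpha> _ i] by (intro arg_cong2[where f="(*)"] prod.cong) auto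
    moreover have "mseries c ?w = (\<Sum>\<alpha> | mdegree \<alpha> = m. c \<alpha> * monomial \<alpha> ?w)"
      by (rule mseries_finite[OF finite_mdegree]) (use c in \<open>auto simp: hom_coeffs_def\<close>)
    ultimately show "mseries c ?w = poly ?P t"
      by (simp add: poly_sum poly_power mult_ac)
  qed
qed

section \<open>Integrals of homogeneous functions\<close>

lemma integral_lborel_scale:
  fixes g :: "real ^ 'n \<Rightarrow> complex"
  assumes g: "g \<in> borel_measurable borel" and s: "s > 0"
  shows "integral\<^sup>L lborel g = complex_of_real (s ^ CARD('n)) * integral\<^sup>L lborel (\<lambda>x. g (s *\<^sub>R x))"
proof -
  have "(lborel :: (real ^ 'n) measure) = density (distr lborel borel (\<lambda>x. 0 + s *\<^sub>R x)) (\<lambda>_. ennreal (\<bar>s\<bar> ^ DIM(real ^ 'n)))"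
    by (rule lborel_affine) (use s in simp)
  then have "integral\<^sup>L lborel g =
      integral\<^sup>L (density (distr lborel borel (\<lambda>x. s *\<^sub>R x)) (\<lambda>_. ennreal (s ^ CARD('n)))) g"
    using s by simp
  also have "\<dots> = integral\<^sup>L (distr lborel borel (\<lambda>x. s *\<^sub>R x)) (\<lambda>x. s ^ CARD('n) *\<^sub>R g x)"
    by (rule integral_density) (use g s in auto)
  also have "\<dots> = integral\<^sup>L lborel (\<lambda>x. s ^ CARD('n) *\<^sub>R g (s *\<^sub>R x))"
    by (rule integral_distr) (use g in auto)
  finally show ?thesis by (simp add: scaleR_conv_of_real)
qed

lemma integral_ball_scale:
  fixes G :: "real ^ 'n \<Rightarrow> complex"
  assumes G: "G \<in> borel_measurable borel" and s: "s > 0" and hom: "\<And>x. G (s *\<^sub>R x) = complex_of_real c * G x"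
  shows "(LINT x:ball 0 s|lborel. G x) = complex_of_real (s ^ CARD('n) * c) * (LINT x:ball 0 1|lborel. G x)"
proof -
  have ind: "indicator (ball 0 s) (s *\<^sub>R x) = (indicator (ball 0 1) x :: real)" for x :: "real ^ 'n"
    using s by (simp add: indicator_def)
  have m: "(\<lambda>x. indicator (ball 0 s) x *\<^sub>R G x) \<in> borel_measurable borel"
    using G by (intro borel_measurable_scaleR borel_measurable_indicator) auto
  have e: "indicator (ball 0 s) (s *\<^sub>R x) *\<^sub>R G (s *\<^sub>R x) = complex_of_real c * (indicator (ball 0 1) x *\<^sub>R G x)" for x
    unfolding ind hom by (simp add: scaleR_conv_of_real mult_ac)
  show ?thesis
    unfolding set_lebesgue_integral_def integral_lborel_scale[OF m s] e integral_mult_right_zero by simp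
qed

lemma set_integrable_ball_bounded:
  fixes G :: "real ^ 'n \<Rightarrow> complex"
  assumes "G \<in> borel_measurable borel" "\<And>x. x \<in> ball a r \<Longrightarrow> norm (G x) \<le> M"
  shows "set_integrable lborel (ball a r) G"
  unfolding set_integrable_def
  using assms emeasure_lborel_ball_finite[of a r]
  by (intro integrableI_bounded_set_indicator[where B=M]) auto

lemma norm_integral_ball_le:
  fixes G :: "real ^ 'n \<Rightarrow> complex"
  assumes A: "A \<in> sets borel" "emeasure lborel A < \<infinity>" and M: "M \<ge> 0" "\<And>x. x \<in> A \<Longrightarrow> norm (G x) \<le> M"
  shows "norm (LINT x:A|lborel. G x) \<le> M * measure lborel A"
proof -
  have "norm (LINT x:A|lborel. G x) \<le> (\<integral>x. M * indicator A x \<partial>lborel)"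
    unfolding set_lebesgue_integral_def
  proof (rule order_trans[OF integral_norm_bound integral_mono'])
    show "integrable lborel (\<lambda>x. M * indicator A x)" using A by simp
  qed (use M in \<open>auto simp: indicator_def\<close>)
  also have "\<dots> = M * measure lborel A" using A by simp
  finally show ?thesis .
qed

lemma one_minus_power_quotient:
  "((\<lambda>s::real. (1 - s ^ k) / (1 - s)) \<longlongrightarrow> real k) (at_left 1)"
proof -
  have "((\<lambda>s::real. \<Sum>i<k. s ^ i) \<longlongrightarrow> (\<Sum>i<k. 1 ^ i)) (at_left 1)" by (intro tendsto_intros)
  moreover have "eventually (\<lambda>s::real. (\<Sum>i<k. s ^ i) = (1 - s ^ k) / (1 - s)) (at_left 1)"
  proof (rule eventually_at_leftI[of 0])
    fix s :: real assume "s \<in> {0<..<1}"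
    then show "(\<Sum>i<k. s ^ i) = (1 - s ^ k) / (1 - s)"
      using one_diff_power_eq[of s k] by (simp add: field_simps)
  qed simp
  ultimately show ?thesis using tendsto_cong by fastforce
qed

text \<open>On a thin shell next to the unit sphere the weight \<open>\<bar>x\<bar>\<^sup>k\<close> is almost 1, while the integrals over
  the shells are determined by homogeneity. Comparing the two as the shell shrinks gives the
  relation without polar coordinates.\<close>

lemma integral_ball_radial_weight:
  fixes G :: "real ^ 'n \<Rightarrow> complex"
  assumes G: "G \<in> borel_measurable borel" and M: "\<And>x. x \<in> ball 0 1 \<Longrightarrow> norm (G x) \<le> M"
    and hom: "\<And>s x. s > 0 \<Longrightarrow> G (s *\<^sub>R x) = complex_of_real (s ^ a) * G x"
  shows "of_nat (CARD('n) + a + k) * (LINT x:ball 0 1|lborel. G x * complex_of_real (norm x ^ k)) =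
    of_nat (CARD('n) + a) * (LINT x:ball 0 1|lborel. G x)"
proof -
  define g f where "g = (LINT x:ball 0 1|lborel. G x)"
    and "f = (LINT x:ball 0 1|lborel. G x * complex_of_real (norm x ^ k))"
  define N where "N = CARD('n)"
  define V where "V = measure lborel (ball 0 1 :: (real ^ 'n) set)"
  have M0: "M \<ge> 0" using M[of 0] norm_ge_zero[of "G 0"] by (simp del: norm_ge_zero)
  have Gk: "(\<lambda>x. G x * complex_of_real (norm x ^ k)) \<in> borel_measurable borel" using G by measurable
  have Mk: "norm (G x * complex_of_real (norm x ^ k)) \<le> M" if "x \<in> ball 0 1" for x
    using M[OF that] that mult_mono[of "norm (G x)" M "norm x ^ k" 1] M0
    by (simp add: norm_mult norm_power power_le_one)
  have iG: "set_integrable lborel (ball 0 1) G" using G M by (rule set_integrable_ball_bounded)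
  have iGk: "set_integrable lborel (ball 0 1) (\<lambda>x. G x * complex_of_real (norm x ^ k))"
    using Gk Mk by (rule set_integrable_ball_bounded)
  \<comment> \<open>Both factors of the error are of order \<open>1 - s\<close>, so it is negligible after division by \<open>1 - s\<close>.\<close>
  have est: "norm (g * complex_of_real (1 - s ^ (N + a)) - f * complex_of_real (1 - s ^ (N + a + k))) \<le>
      M * V * (1 - s ^ k) * (1 - s ^ N)" if s: "0 < s" "s < 1" for s
  proof -
    define A where "A = ball 0 1 - ball (0 :: real ^ 'n) s"
    have As: "A \<in> sets borel" by (simp add: A_def)
    have sub: "ball 0 s \<subseteq> ball (0 :: real ^ 'n) 1" using s by auto
    have un: "ball 0 1 = A \<union> ball 0 s" "A \<inter> ball 0 s = {}" using sub by (auto simp: A_def)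
    have split: "(LINT x:A|lborel. h x) = (LINT x:ball 0 1|lborel. h x) - (LINT x:ball 0 s|lborel. h x)"
      if h: "set_integrable lborel (ball 0 1) h" for h :: "real ^ 'n \<Rightarrow> complex"
    proof -
      have "(LINT x:A \<union> ball 0 s|lborel. h x) = (LINT x:A|lborel. h x) + (LINT x:ball 0 s|lborel. h x)"
        by (rule set_integral_Un[OF un(2)])
           (use set_integrable_subset[OF h] As sub in \<open>auto simp: A_def\<close>)
      then show ?thesis using un(1) by simp
    qed
    have "(LINT x:ball 0 s|lborel. G x) = complex_of_real (s ^ N * s ^ a) * g"
      unfolding g_def N_def by (rule integral_ball_scale[OF G s(1) hom[OF s(1)]])
    then have 1: "(LINT x:A|lborel. G x) = g * complex_of_real (1 - s ^ (N + a))"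
      using split[OF iG] by (simp add: g_def algebra_simps power_add)
    have "(LINT x:ball 0 s|lborel. G x * complex_of_real (norm x ^ k)) = complex_of_real (s ^ N * s ^ (a + k)) * f"
      unfolding f_def N_def
      by (rule integral_ball_scale[OF Gk s(1)]) (use s hom[OF s(1)] in \<open>simp add: power_mult_distrib power_add mult_ac\<close>)
    then have 2: "(LINT x:A|lborel. G x * complex_of_real (norm x ^ k)) = f * complex_of_real (1 - s ^ (N + a + k))"
      using split[OF iGk] by (simp add: f_def algebra_simps power_add)
    have V: "measure lborel A = V * (1 - s ^ N)"
    proof -
      have "measure lborel A = measure lborel (ball 0 1 :: (real ^ 'n) set) - measure lborel (ball 0 s :: (real ^ 'n) set)"
        unfolding A_def using sub emeasure_lborel_ball_finite[of "0 :: real ^ 'n" 1] by (intro measure_Diff) auto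
      then show ?thesis using s by (simp add: V_def content_ball N_def algebra_simps)
    qed
    have "(LINT x:A|lborel. G x) - (LINT x:A|lborel. G x * complex_of_real (norm x ^ k)) =
        (LINT x:A|lborel. G x - G x * complex_of_real (norm x ^ k))"
      by (rule set_integral_diff(2)[symmetric])
         (use set_integrable_subset[OF iG] set_integrable_subset[OF iGk] As in \<open>auto simp: A_def\<close>)
    also have "norm \<dots> \<le> M * (1 - s ^ k) * measure lborel A"
    proof (rule norm_integral_ball_le[OF As])
      have "emeasure lborel A \<le> emeasure lborel (ball 0 1 :: (real ^ 'n) set)" by (rule emeasure_mono) (auto simp: A_def)
      then show "emeasure lborel A < \<infinity>" using emeasure_lborel_ball_finite order_le_less_trans by blast
      show "0 \<le> M * (1 - s ^ k)" using M0 s by (simp add: power_le_one)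
      fix x assume x: "x \<in> A"
      then have nx: "s \<le> norm x" "norm x < 1" by (auto simp: A_def)
      have "s ^ k \<le> norm x ^ k" using nx s by (intro power_mono) auto
      moreover have "norm x ^ k \<le> 1" using nx by (simp add: power_le_one)
      moreover have "norm (G x - G x * complex_of_real (norm x ^ k)) = norm (G x) * (1 - norm x ^ k)"
      proof -
        have "G x - G x * complex_of_real (norm x ^ k) = G x * complex_of_real (1 - norm x ^ k)"
          by (simp add: algebra_simps)
        then show ?thesis using \<open>norm x ^ k \<le> 1\<close>
          by (simp only: norm_mult norm_of_real abs_of_nonneg diff_ge_0_iff_ge)
      qed
      moreover have "norm (G x) \<le> M" using M x by (auto simp: A_def)
      ultimately show "norm (G x - G x * complex_of_real (norm x ^ k)) \<le> M * (1 - s ^ k)"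
        using M0 by (simp add: mult_mono)
    qed
    finally show ?thesis unfolding 1 2 V by (simp add: mult_ac)
  qed
  have "((\<lambda>s. g * complex_of_real ((1 - s ^ (N + a)) / (1 - s)) - f * complex_of_real ((1 - s ^ (N + a + k)) / (1 - s)))
      \<longlongrightarrow> g * complex_of_real (real (N + a)) - f * complex_of_real (real (N + a + k))) (at_left 1)"
    by (intro tendsto_intros one_minus_power_quotient)
  moreover have "((\<lambda>s. g * complex_of_real ((1 - s ^ (N + a)) / (1 - s)) - f * complex_of_real ((1 - s ^ (N + a + k)) / (1 - s)))
      \<longlongrightarrow> 0) (at_left 1)"
  proof (rule tendsto_norm_zero_cancel, rule tendsto_sandwich[OF _ _ tendsto_const])
    show "eventually (\<lambda>s. norm (g * complex_of_real ((1 - s ^ (N + a)) / (1 - s)) - f * complex_of_real ((1 - s ^ (N + a + k)) / (1 - s)))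
        \<le> M * V * ((1 - s ^ k) / (1 - s)) * (1 - s ^ N)) (at_left 1)"
    proof (rule eventually_at_leftI[of 0])
      fix s :: real assume s: "s \<in> {0<..<1}"
      have "g * complex_of_real ((1 - s ^ (N + a)) / (1 - s)) - f * complex_of_real ((1 - s ^ (N + a + k)) / (1 - s)) =
          (g * complex_of_real (1 - s ^ (N + a)) - f * complex_of_real (1 - s ^ (N + a + k))) / complex_of_real (1 - s)"
        by (simp only: of_real_divide times_divide_eq_right diff_divide_distrib[symmetric])
      then have "norm (g * complex_of_real ((1 - s ^ (N + a)) / (1 - s)) - f * complex_of_real ((1 - s ^ (N + a + k)) / (1 - s)))
          = norm (g * complex_of_real (1 - s ^ (N + a)) - f * complex_of_real (1 - s ^ (N + a + k))) / (1 - s)"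
        using s by (simp only: norm_divide norm_of_real) simp
      also have "\<dots> \<le> M * V * (1 - s ^ k) * (1 - s ^ N) / (1 - s)"
        using s est[of s] by (intro divide_right_mono) auto
      finally show "norm (g * complex_of_real ((1 - s ^ (N + a)) / (1 - s)) - f * complex_of_real ((1 - s ^ (N + a + k)) / (1 - s)))
        \<le> M * V * ((1 - s ^ k) / (1 - s)) * (1 - s ^ N)" by simp
    qed simp
    have "((\<lambda>s. M * V * ((1 - s ^ k) / (1 - s)) * (1 - s ^ N)) \<longlongrightarrow> M * V * real k * (1 - 1 ^ N)) (at_left 1)"
      by (intro tendsto_intros one_minus_power_quotient)
    then show "((\<lambda>s. M * V * ((1 - s ^ k) / (1 - s)) * (1 - s ^ N)) \<longlongrightarrow> 0) (at_left 1)" by simp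
  qed auto
  ultimately have "g * complex_of_real (real (N + a)) - f * complex_of_real (real (N + a + k)) = 0"
    by (rule tendsto_unique[OF trivial_limit_at_left_real])
  then show ?thesis by (simp add: g_def f_def N_def mult_ac)
qed

lemma AE_lborel_ne: "AE x in lborel. x \<noteq> (a :: 'a :: euclidean_space)"
  by (rule AE_I'[of "{a}"]) (auto simp: null_sets_def)

lemma set_integral_ball_cong_ne0:
  fixes f g :: "real ^ 'n \<Rightarrow> complex"
  assumes "f \<in> borel_measurable borel" "g \<in> borel_measurable borel" "\<And>x. x \<noteq> 0 \<Longrightarrow> f x = g x"
  shows "(LINT x:ball 0 1|lborel. f x) = (LINT x:ball 0 1|lborel. g x)"
proof (rule set_lebesgue_integral_cong_AE)
  show "AE x\<in>ball 0 1 in lborel. f x = g x"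
    using AE_lborel_ne[of 0] by eventually_elim (use assms in auto)
qed (use assms in auto)

text \<open>By definition the sphere measure integrates \<open>F (x / \<bar>x\<bar>)\<close>, a function of degree 0, over the ball;
  the weight \<open>\<bar>x\<bar>\<^sup>d\<close> turns it into \<open>F\<close>.\<close>

lemma sphere_integral_homogeneous:
  fixes F :: "real ^ 'n \<Rightarrow> complex"
  assumes F: "continuous_on UNIV F" and hom: "\<And>s x. s > 0 \<Longrightarrow> F (s *\<^sub>R x) = complex_of_real (s ^ d) * F x"
  shows "(LINT \<zeta>:sphere 0 1|sphere_measure. F \<zeta>) =
    of_nat (CARD('n) + d) / complex_of_real (real CARD('n) * unit_ball_vol (real CARD('n))) *
      (LINT x:ball 0 1|lborel. F x)"
proof -
  define V where "V = unit_ball_vol (real CARD('n))"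
  have V: "V > 0" by (simp add: V_def)
  define G where "G x = indicator (sphere 0 1) (x /\<^sub>R norm x) *\<^sub>R F (x /\<^sub>R norm x)" for x :: "real ^ 'n"
  have Fm: "F \<in> borel_measurable borel" using F by (rule borel_measurable_continuous_onI)
  have pm: "(\<lambda>x :: real ^ 'n. x /\<^sub>R norm x) \<in> borel_measurable borel" by measurable
  have Hm: "(\<lambda>x. indicator (sphere 0 1) x *\<^sub>R F x) \<in> borel_measurable borel"
    using Fm by (intro borel_measurable_scaleR borel_measurable_indicator) auto
  have Gm: "G \<in> borel_measurable borel"
    unfolding G_def using measurable_compose[OF pm Hm] by simp
  have "compact (F ` sphere 0 1)" by (intro compact_continuous_image continuous_on_subset[OF F]) auto
  then obtain M where M: "\<And>x. x \<in> sphere 0 1 \<Longrightarrow> norm (F x) \<le> M" "M \<ge> 0"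
    using compact_imp_bounded bounded_pos by (metis imageI less_imp_le)
  have GM: "norm (G x) \<le> M" for x using M by (simp add: G_def indicator_def)
  have Ghom: "G (s *\<^sub>R x) = G x" if "s > 0" for s x
  proof -
    have "(s *\<^sub>R x) /\<^sub>R norm (s *\<^sub>R x) = x /\<^sub>R norm x" using that by simp
    then show ?thesis by (simp only: G_def)
  qed
  have FG: "G x * complex_of_real (norm x ^ d) = F x" if "x \<noteq> 0" for x
    using hom[of "norm x" "x /\<^sub>R norm x"] that by (simp add: G_def)
  have um: "uniform_measure lborel (ball 0 1 :: (real ^ 'n) set) =
      density lborel (\<lambda>x. ennreal (indicator (ball 0 1) x / V))"
  proof -
    have "(\<lambda>x. indicator (ball 0 1 :: (real ^ 'n) set) x / emeasure lborel (ball 0 1 :: (real ^ 'n) set)) =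
      (\<lambda>x. ennreal (indicator (ball 0 1) x / V))"
      using divide_ennreal[of 1 V] V by (auto simp: fun_eq_iff emeasure_ball indicator_def V_def)
    then show ?thesis unfolding uniform_measure_def by (rule arg_cong)
  qed
  have "(LINT \<zeta>:sphere 0 1|sphere_measure. F \<zeta>) = integral\<^sup>L (uniform_measure lborel (ball 0 1)) G"
    unfolding set_lebesgue_integral_def sphere_measure_def G_def
    by (rule integral_distr[OF _ Hm]) (simp add: measurable_def[of "uniform_measure lborel _"] pm[unfolded measurable_def, simplified])
  also have "\<dots> = integral\<^sup>L lborel (\<lambda>x. (indicator (ball 0 1) x / V) *\<^sub>R G x)"
    unfolding um
  proof (rule integral_density)
    show "(\<lambda>x. indicator (ball 0 1) x / V) \<in> borel_measurable lborel"
      by (intro borel_measurable_divide borel_measurable_indicator) auto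
  qed (use Gm V in auto)
  also have "\<dots> = integral\<^sup>L lborel (\<lambda>x. complex_of_real (1 / V) * (indicator (ball 0 1) x *\<^sub>R G x))"
    by (rule Bochner_Integration.integral_cong) (auto simp: indicator_def scaleR_conv_of_real)
  also have "\<dots> = complex_of_real (1 / V) * (LINT x:ball 0 1|lborel. G x)"
    unfolding set_lebesgue_integral_def by (rule integral_mult_right_zero)
  finally have 1: "(LINT \<zeta>:sphere 0 1|sphere_measure. F \<zeta>) = (LINT x:ball 0 1|lborel. G x) / complex_of_real V" by simp
  have "of_nat (CARD('n) + 0 + d) * (LINT x:ball 0 1|lborel. G x * complex_of_real (norm x ^ d)) =
    of_nat (CARD('n) + 0) * (LINT x:ball 0 1|lborel. G x)"
    by (rule integral_ball_radial_weight[OF Gm GM]) (simp add: Ghom)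
  moreover have "(LINT x:ball 0 1|lborel. G x * complex_of_real (norm x ^ d)) = (LINT x:ball 0 1|lborel. F x)"
    by (rule set_integral_ball_cong_ne0) (use Gm Fm FG in auto)
  ultimately have "of_nat (CARD('n) + d) * (LINT x:ball 0 1|lborel. F x) = of_nat CARD('n) * (LINT x:ball 0 1|lborel. G x)"
    by simp
  then show ?thesis unfolding 1 V_def[symmetric] using V by (simp add: field_simps)
qed

lemma integral_lborel_translate:
  fixes g :: "real ^ 'n \<Rightarrow> complex"
  assumes g: "g \<in> borel_measurable borel"
  shows "integral\<^sup>L lborel (\<lambda>x. g (x + a)) = integral\<^sup>L lborel g"
proof -
  have "integral\<^sup>L lborel g = integral\<^sup>L (distr lborel borel ((+) a)) g" by (simp add: lborel_distr_plus)
  also have "\<dots> = integral\<^sup>L lborel (\<lambda>x. g (a + x))" by (rule integral_distr) (use g in auto)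
  finally show ?thesis by (simp add: add.commute)
qed

lemma norm_axis_real: "norm (axis i t :: real ^ 'n) = \<bar>t\<bar>"
  by (simp add: norm_eq_sqrt_inner inner_axis_axis)

text \<open>Differentiating the translation invariance of Lebesgue measure.\<close>

lemma integral_partial_deriv_eq_0:
  fixes \<Phi> \<Phi>' :: "real ^ 'n \<Rightarrow> complex"
  assumes c: "continuous_on UNIV \<Phi>" "continuous_on UNIV \<Phi>'"
    and supp: "\<And>x. norm x \<ge> 1 \<Longrightarrow> \<Phi> x = 0" "\<And>x. norm x \<ge> 1 \<Longrightarrow> \<Phi>' x = 0"
    and d: "\<And>x. ((\<lambda>t. \<Phi> (x + axis i t)) has_vector_derivative \<Phi>' x) (at 0)"
  shows "(LINT x:ball 0 1|lborel. \<Phi>' x) = 0"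
proof -
  have m: "\<Phi> \<in> borel_measurable borel" "\<Phi>' \<in> borel_measurable borel"
    using c by (auto intro: borel_measurable_continuous_onI)
  have ax: "axis i s + axis i t = axis i (s + t :: real)" for s t by (simp add: vec_eq_iff axis_def)
  have d': "((\<lambda>u. \<Phi> (x + axis i u)) has_vector_derivative \<Phi>' (x + axis i t)) (at t)" for x t
  proof -
    have "((\<lambda>u. u - t) has_vector_derivative 1) (at t)" by (auto intro!: derivative_eq_intros)
    moreover have "((\<lambda>s. \<Phi> ((x + axis i t) + axis i s)) has_vector_derivative \<Phi>' (x + axis i t)) (at (t - t))"
      using d[of "x + axis i t"] by simp
    ultimately have "((\<lambda>s. \<Phi> ((x + axis i t) + axis i s)) \<circ> (\<lambda>u. u - t) has_vector_derivative 1 *\<^sub>R \<Phi>' (x + axis i t)) (at t)"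
      by (rule vector_diff_chain_at)
    then show ?thesis by (simp add: o_def add.assoc ax)
  qed
  have "compact (\<Phi>' ` cball 0 1)" by (intro compact_continuous_image continuous_on_subset[OF c(2)]) auto
  then obtain M where M: "\<And>x. x \<in> cball 0 1 \<Longrightarrow> norm (\<Phi>' x) \<le> M" "M > 0"
    using compact_imp_bounded bounded_pos by (metis imageI)
  then have M': "norm (\<Phi>' x) \<le> M" for x using supp(2)[of x] M by (cases "norm x \<le> 1") auto
  define D where "D k x = of_nat (Suc k) * (\<Phi> (x + axis i (1 / real (Suc k))) - \<Phi> x)" for k x
  have Dm: "D k \<in> borel_measurable lborel" for k
  proof -
    have "(\<lambda>x. \<Phi> (x + axis i (1 / real (Suc k)))) \<in> borel_measurable borel"
      by (rule measurable_compose[OF _ m(1)]) auto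
    then show ?thesis unfolding D_def using m by auto
  qed
  have Di: "integrable lborel \<Phi>"
  proof -
    have "set_integrable lborel (ball 0 1) \<Phi>"
    proof -
      have "compact (\<Phi> ` cball 0 1)" by (intro compact_continuous_image continuous_on_subset[OF c(1)]) auto
      then obtain M where "\<And>x. x \<in> cball 0 1 \<Longrightarrow> norm (\<Phi> x) \<le> M"
        using compact_imp_bounded bounded_pos by (metis imageI)
      then show ?thesis using m by (intro set_integrable_ball_bounded[of _ _ _ M]) auto
    qed
    moreover have "indicator (ball 0 1) x *\<^sub>R \<Phi> x = \<Phi> x" for x
      using supp(1)[of x] by (cases "norm x < 1") auto
    ultimately show ?thesis by (simp add: set_integrable_def)
  qed
  have Dtr: "integrable lborel (\<lambda>x. \<Phi> (x + a))" for a
  proof -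
    have "integrable (distr lborel borel ((+) a)) \<Phi>" using Di by (simp add: lborel_distr_plus)
    then show ?thesis by (subst (asm) integrable_distr_eq) (use m in \<open>auto simp: add.commute\<close>)
  qed
  have D0: "integral\<^sup>L lborel (D k) = 0" for k
    unfolding D_def using Dtr Di by (simp add: integral_lborel_translate[OF m(1)])
  have lim: "(\<lambda>k. D k x) \<longlonglongrightarrow> \<Phi>' x" for x
  proof -
    have ax0: "axis i 0 = (0 :: real ^ 'n)" by (simp add: vec_eq_iff axis_def)
    have "((\<lambda>h. norm (\<Phi> (x + axis i (0 + h)) - \<Phi> (x + axis i 0) - h *\<^sub>R \<Phi>' x) / norm h) \<longlongrightarrow> 0) (at 0)"
      using d[of x] unfolding has_vector_derivative_def has_derivative_at by blast
    moreover have "filterlim (\<lambda>k. 1 / real (Suc k)) (at 0) sequentially"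
      unfolding filterlim_at using LIMSEQ_Suc[OF lim_1_over_n[where ?'a=real]] by auto
    ultimately have l: "(\<lambda>k. norm (\<Phi> (x + axis i (0 + 1 / real (Suc k))) - \<Phi> (x + axis i 0) - (1 / real (Suc k)) *\<^sub>R \<Phi>' x) /
        norm (1 / real (Suc k))) \<longlonglongrightarrow> 0"
      by (rule filterlim_compose)
    have "norm (\<Phi> (x + axis i (0 + 1 / real (Suc k))) - \<Phi> (x + axis i 0) - (1 / real (Suc k)) *\<^sub>R \<Phi>' x) /
        norm (1 / real (Suc k)) = norm (D k x - \<Phi>' x)" for k
    proof -
      have "D k x - \<Phi>' x = of_nat (Suc k) * (\<Phi> (x + axis i (0 + 1 / real (Suc k))) - \<Phi> (x + axis i 0) - (1 / real (Suc k)) *\<^sub>R \<Phi>' x)"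
        by (simp add: D_def ax0 scaleR_conv_of_real right_diff_distrib del: of_nat_Suc)
      then have "norm (D k x - \<Phi>' x) = real (Suc k) * norm (\<Phi> (x + axis i (0 + 1 / real (Suc k))) - \<Phi> (x + axis i 0) - (1 / real (Suc k)) *\<^sub>R \<Phi>' x)"
        by (simp only: norm_mult norm_of_nat)
      then show ?thesis by simp
    qed
    with l have "(\<lambda>k. norm (D k x - \<Phi>' x)) \<longlonglongrightarrow> 0" by simp
    then show ?thesis by (rule LIM_zero_cancel[OF tendsto_norm_zero_cancel])
  qed
  have bound: "norm (D k x) \<le> M * indicator (cball 0 2) x" for k x
  proof (cases "norm x \<le> 2")
    case True
    let ?t = "1 / real (Suc k)"
    have "norm (\<Phi> (x + axis i ?t) - \<Phi> (x + axis i 0)) \<le> M * norm (?t - 0)"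
    proof (rule differentiable_bound[of UNIV "\<lambda>u. \<Phi> (x + axis i u)" "\<lambda>u h. h *\<^sub>R \<Phi>' (x + axis i u)"])
      fix u :: real
      show "((\<lambda>u. \<Phi> (x + axis i u)) has_derivative (\<lambda>h. h *\<^sub>R \<Phi>' (x + axis i u))) (at u within UNIV)"
        using d' by (simp add: has_vector_derivative_def)
      show "onorm (\<lambda>h. h *\<^sub>R \<Phi>' (x + axis i u)) \<le> M"
        using M' by (intro onorm_bound) (auto simp: mult.commute[of M] intro!: mult_left_mono less_imp_le[OF M(2)])
    qed auto
    moreover have "axis i 0 = (0 :: real ^ 'n)" by (simp add: vec_eq_iff axis_def)
    ultimately have "norm (\<Phi> (x + axis i ?t) - \<Phi> x) \<le> M * ?t" by simp
    then have "real (Suc k) * norm (\<Phi> (x + axis i ?t) - \<Phi> x) \<le> real (Suc k) * (M * ?t)"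
      by (rule mult_left_mono) simp
    then show ?thesis using True by (simp add: D_def norm_mult del: of_nat_Suc)
  next
    case False
    have "norm (axis i (1 / real (Suc k)) :: real ^ 'n) \<le> 1" by (simp add: norm_axis_real field_simps)
    then have "norm (x + axis i (1 / real (Suc k))) \<ge> 1"
      using norm_triangle_ineq4[of "x + axis i (1 / real (Suc k))" "axis i (1 / real (Suc k))"] False by simp
    then show ?thesis using False supp(1) by (simp add: D_def)
  qed
  have "(\<lambda>k. integral\<^sup>L lborel (D k)) \<longlonglongrightarrow> integral\<^sup>L lborel \<Phi>'"
  proof (rule integral_dominated_convergence)
    show "integrable lborel (\<lambda>x :: real ^ 'n. M * indicator (cball 0 2) x :: real)"
      using emeasure_lborel_cball_finite[of "0 :: real ^ 'n" 2] by simp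
  qed (use Dm m lim bound in auto)
  then have "integral\<^sup>L lborel \<Phi>' = 0" unfolding D0 by (metis LIMSEQ_unique tendsto_const)
  moreover have "indicator (ball 0 1) x *\<^sub>R \<Phi>' x = \<Phi>' x" for x
    using supp(2)[of x] by (cases "norm x < 1") auto
  ultimately show ?thesis by (simp add: set_lebesgue_integral_def)
qed

lemma DERIV_pos_part_square: "((\<lambda>u::real. (max 0 u)\<^sup>2) has_real_derivative 2 * max 0 u) (at u)"
proof -
  consider "u > 0" | "u < 0" | "u = 0" by linarith
  then show ?thesis
  proof cases
    case 1
    have "((\<lambda>u::real. u\<^sup>2) has_real_derivative 2 * max 0 u) (at u)"
      using 1 by (auto intro!: derivative_eq_intros)
    then show ?thesis
      by (rule has_field_derivative_transform_within[where d=u]) (use 1 in \<open>auto simp: dist_real_def\<close>)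
  next
    case 2
    have "((\<lambda>u::real. 0) has_real_derivative 2 * max 0 u) (at u)" using 2 by simp
    then show ?thesis
      by (rule has_field_derivative_transform_within[where d="- u"]) (use 2 in \<open>auto simp: dist_real_def\<close>)
  next
    case 3
    have "((\<lambda>h::real. (max 0 h)\<^sup>2 / h) \<longlongrightarrow> 0) (at 0)"
    proof (rule Lim_null_comparison[where g="\<lambda>h. \<bar>h\<bar>"])
      show "eventually (\<lambda>h::real. norm ((max 0 h)\<^sup>2 / h) \<le> \<bar>h\<bar>) (at 0)"
        by (rule always_eventually) (auto simp: max_def power2_eq_square)
    qed (auto intro!: tendsto_eq_intros)
    then show ?thesis using 3 by (simp add: has_field_derivative_iff)
  qed
qed

text \<open>A divergence theorem without a surface integral. The function is cut off by \<open>(1 - \<bar>x\<bar>\<^sup>2)\<^sup>2\<close>, which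
  vanishes together with its gradient on the sphere; homogeneity then removes the weights \<open>\<bar>x\<bar>\<^sup>2\<close> and
  \<open>\<bar>x\<bar>\<^sup>4\<close> from the integrals.\<close>

lemma integral_divergence:
  fixes F F' :: "real ^ 'n \<Rightarrow> complex"
  assumes c: "continuous_on UNIV F" "continuous_on UNIV F'"
    and d: "\<And>x. ((\<lambda>t. F (x + axis i t)) has_vector_derivative F' x) (at 0)"
    and hom': "\<And>s x. s > 0 \<Longrightarrow> F' (s *\<^sub>R x) = complex_of_real (s ^ a) * F' x"
    and hom: "\<And>s x. s > 0 \<Longrightarrow> complex_of_real ((s *\<^sub>R x) $ i) * F (s *\<^sub>R x) =
      complex_of_real (s ^ b) * (complex_of_real (x $ i) * F x)"
  shows "of_nat (CARD('n) + b + 2) * (LINT x:ball 0 1|lborel. F' x) =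
    of_nat ((CARD('n) + a + 2) * (CARD('n) + a + 4)) * (LINT x:ball 0 1|lborel. complex_of_real (x $ i) * F x)"
proof -
  define w where "w x = max 0 (1 - (norm x)\<^sup>2)" for x :: "real ^ 'n"
  define H where "H x = complex_of_real (x $ i) * F x" for x
  have cH: "continuous_on UNIV H" unfolding H_def by (intro continuous_intros c)
  have cw: "continuous_on UNIV w" unfolding w_def by (intro continuous_intros)
  have dw: "((\<lambda>t. complex_of_real ((w (x + axis i t))\<^sup>2)) has_vector_derivative complex_of_real (- 4 * (x $ i) * w x)) (at 0)" for x
  proof -
    have nx: "1 - (norm (x + axis i t))\<^sup>2 = 1 - ((norm x)\<^sup>2 + 2 * t * x $ i + t\<^sup>2)" for t
    proof -
      have "(norm (x + axis i t))\<^sup>2 = x \<bullet> x + 2 * (x \<bullet> axis i t) + axis i t \<bullet> axis i t"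
        unfolding power2_norm_eq_inner by (simp add: inner_add inner_commute)
      then show ?thesis
        by (simp add: inner_axis norm_axis_real dot_square_norm power2_eq_square)
    qed
    have "((\<lambda>t. 1 - ((norm x)\<^sup>2 + 2 * t * x $ i + t\<^sup>2)) has_real_derivative - 2 * x $ i) (at 0)"
      by (auto intro!: derivative_eq_intros)
    from DERIV_chain2[OF DERIV_pos_part_square this]
    have "((\<lambda>t. (w (x + axis i t))\<^sup>2) has_real_derivative - 4 * (x $ i) * w x) (at 0)"
      unfolding w_def nx by (simp add: mult_ac)
    then have "((\<lambda>t. (w (x + axis i t))\<^sup>2) has_vector_derivative - 4 * (x $ i) * w x) (at 0)"
      by (simp add: has_real_derivative_iff_has_vector_derivative)
    then show ?thesis by (rule bounded_linear.has_vector_derivative[OF bounded_linear_of_real])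
  qed
  have "(LINT x:ball 0 1|lborel. complex_of_real ((w x)\<^sup>2) * F' x + complex_of_real (- 4 * (x $ i) * w x) * F x) = 0"
  proof (rule integral_partial_deriv_eq_0)
    show "continuous_on UNIV (\<lambda>x. complex_of_real ((w x)\<^sup>2) * F x)" by (intro continuous_intros c cw)
    show "continuous_on UNIV (\<lambda>x. complex_of_real ((w x)\<^sup>2) * F' x + complex_of_real (- 4 * (x $ i) * w x) * F x)"
      by (intro continuous_intros c cw)
    have w0: "w x = 0" if "norm x \<ge> 1" for x
      using that power_mono[of 1 "norm x" 2] by (simp add: w_def)
    show "complex_of_real ((w x)\<^sup>2) * F x = 0" if "norm x \<ge> 1" for x using w0[OF that] by simp
    show "complex_of_real ((w x)\<^sup>2) * F' x + complex_of_real (- 4 * (x $ i) * w x) * F x = 0" if "norm x \<ge> 1" for x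
      using w0[OF that] by simp
    fix x
    have ax: "axis i 0 = (0 :: real ^ 'n)" by (simp add: vec_eq_iff axis_def)
    show "((\<lambda>t. complex_of_real ((w (x + axis i t))\<^sup>2) * F (x + axis i t)) has_vector_derivative
        complex_of_real ((w x)\<^sup>2) * F' x + complex_of_real (- 4 * (x $ i) * w x) * F x) (at 0)"
      using has_vector_derivative_mult[OF dw[of x] d[of x]] by (simp only: ax add_0_right)
  qed
  moreover have "complex_of_real ((w x)\<^sup>2) * F' x + complex_of_real (- 4 * (x $ i) * w x) * F x =
      (F' x - 2 * (F' x * complex_of_real (norm x ^ 2)) + F' x * complex_of_real (norm x ^ 4)) -
      4 * (H x - H x * complex_of_real (norm x ^ 2))" if "x \<in> ball 0 1" for x
  proof -
    have "norm x ^ 2 \<le> 1" using that by (simp add: power_le_one)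
    then have w: "complex_of_real (w x) = 1 - complex_of_real (norm x ^ 2)" by (simp add: w_def)
    have n4: "complex_of_real (norm x ^ 4) = complex_of_real (norm x ^ 2) ^ 2"
      by (simp flip: power_mult)
    show ?thesis
      unfolding of_real_mult of_real_power[of "w x" 2] w n4 H_def by (simp add: algebra_simps power2_eq_square)
  qed
  ultimately have 0: "(LINT x:ball 0 1|lborel. (F' x - 2 * (F' x * complex_of_real (norm x ^ 2)) + F' x * complex_of_real (norm x ^ 4)) -
      4 * (H x - H x * complex_of_real (norm x ^ 2))) = 0"
    by (subst (asm) set_lebesgue_integral_cong[where g="\<lambda>x. (F' x - 2 * (F' x * complex_of_real (norm x ^ 2)) +
      F' x * complex_of_real (norm x ^ 4)) - 4 * (H x - H x * complex_of_real (norm x ^ 2))"]) auto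
  have bdd: "\<exists>M. \<forall>x\<in>ball 0 1. norm (f x) \<le> M" if "continuous_on UNIV f" for f :: "real ^ 'n \<Rightarrow> complex"
  proof -
    have "compact (f ` cball 0 1)" by (intro compact_continuous_image continuous_on_subset[OF that]) auto
    then obtain M where "\<And>x. x \<in> cball 0 1 \<Longrightarrow> norm (f x) \<le> M"
      using compact_imp_bounded bounded_pos by (metis imageI)
    then show ?thesis by (intro exI[of _ M]) auto
  qed
  have int: "set_integrable lborel (ball 0 1) f" if "continuous_on UNIV f" for f :: "real ^ 'n \<Rightarrow> complex"
    using bdd[OF that] borel_measurable_continuous_onI[OF that] set_integrable_ball_bounded by metis
  note intr = int[OF c(2)] int[OF cH]
    int[of "\<lambda>x. F' x * complex_of_real (norm x ^ k)" for k] int[of "\<lambda>x. H x * complex_of_real (norm x ^ k)" for k]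
  have ck: "continuous_on UNIV (\<lambda>x. F' x * complex_of_real (norm x ^ k))"
    "continuous_on UNIV (\<lambda>x. H x * complex_of_real (norm x ^ k))" for k
    by (intro continuous_intros c cH)+
  define I J where "I k = (LINT x:ball 0 1|lborel. F' x * complex_of_real (norm x ^ k))"
    and "J k = (LINT x:ball 0 1|lborel. H x * complex_of_real (norm x ^ k))" for k
  have "(LINT x:ball 0 1|lborel. (F' x - 2 * (F' x * complex_of_real (norm x ^ 2)) + F' x * complex_of_real (norm x ^ 4)) -
      4 * (H x - H x * complex_of_real (norm x ^ 2))) = (I 0 - 2 * I 2 + I 4) - 4 * (J 0 - J 2)"
    using int[OF ck(1)[of 2]] int[OF ck(1)[of 4]] int[OF ck(2)[of 2]] int[OF c(2)] int[OF cH]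
    by (simp add: I_def J_def)
  with 0 have e: "I 0 - 2 * I 2 + I 4 = 4 * (J 0 - J 2)" by simp
  obtain M1 where M1: "\<And>x. x \<in> ball 0 1 \<Longrightarrow> norm (F' x) \<le> M1" using bdd[OF c(2)] by blast
  obtain M2 where M2: "\<And>x. x \<in> ball 0 1 \<Longrightarrow> norm (H x) \<le> M2" using bdd[OF cH] by blast
  have I: "of_nat (CARD('n) + a + k) * I k = of_nat (CARD('n) + a) * I 0" for k
    using integral_ball_radial_weight[OF borel_measurable_continuous_onI[OF c(2)] M1 hom'] by (simp add: I_def)
  have J: "of_nat (CARD('n) + b + k) * J k = of_nat (CARD('n) + b) * J 0" for k
    using integral_ball_radial_weight[OF borel_measurable_continuous_onI[OF cH] M2, of b] hom by (simp add: J_def H_def)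
  define A B where "A = (of_nat (CARD('n) + a) :: complex)" and "B = (of_nat (CARD('n) + b) :: complex)"
  have I2: "(A + 2) * I 2 = A * I 0" and I4: "(A + 4) * I 4 = A * I 0" and J2: "(B + 2) * J 2 = B * J 0"
    using I[of 2] I[of 4] J[of 2] unfolding A_def B_def by (simp_all only: of_nat_add of_nat_numeral)
  have "(A + 2) * (A + 4) * (I 0 - 2 * I 2 + I 4) =
      (A + 2) * (A + 4) * I 0 - 2 * (A + 4) * ((A + 2) * I 2) + (A + 2) * ((A + 4) * I 4)"
    by (simp add: algebra_simps)
  also have "\<dots> = 8 * I 0" unfolding I2 I4 by (simp add: algebra_simps)
  finally have 1: "(A + 2) * (A + 4) * (4 * (J 0 - J 2)) = 8 * I 0" unfolding e .
  have "(B + 2) * (J 0 - J 2) = (B + 2) * J 0 - (B + 2) * J 2" by (simp add: algebra_simps)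
  also have "\<dots> = 2 * J 0" unfolding J2 by (simp add: algebra_simps)
  finally have 2: "(B + 2) * (J 0 - J 2) = 2 * J 0" .
  have "8 * ((B + 2) * I 0) = (B + 2) * (8 * I 0)" by simp
  also have "\<dots> = (A + 2) * (A + 4) * (4 * ((B + 2) * (J 0 - J 2)))" unfolding 1[symmetric] by (simp add: mult_ac)
  also have "\<dots> = 8 * ((A + 2) * (A + 4) * J 0)" unfolding 2 by simp
  finally have "(B + 2) * I 0 = (A + 2) * (A + 4) * J 0" by simp
  moreover have "I 0 = (LINT x:ball 0 1|lborel. F' x)"
    "J 0 = (LINT x:ball 0 1|lborel. complex_of_real (x $ i) * F x)" by (simp_all add: I_def J_def H_def)
  ultimately show ?thesis unfolding A_def B_def by (simp only: of_nat_add of_nat_mult of_nat_numeral)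
qed

section \<open>Orthogonality of polyharmonic polynomials\<close>

lemma hom_coeffs_neg: "c \<in> hom_coeffs k \<Longrightarrow> k < 0 \<Longrightarrow> mseries c z = 0"
  by (subst mseries_finite[of "{}"]) (auto simp: hom_coeffs_def)

lemma hom_coeffs_eq_sum:
  assumes "c \<in> hom_coeffs k"
  shows "mseries c z = (\<Sum>\<alpha> | mdegree \<alpha> = nat k. c \<alpha> * monomial \<alpha> z)"
  by (rule mseries_finite[OF finite_mdegree]) (use assms in \<open>auto simp: hom_coeffs_def\<close>)

lemma hom_coeffs_continuous:
  assumes "c \<in> hom_coeffs k"
  shows "continuous_on A (\<lambda>x. mseries c (cvec x))"
  unfolding hom_coeffs_eq_sum[OF assms, abs_def]
  by (auto simp: monomial_def intro!: continuous_intros)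

lemma hom_coeffs_scale_product:
  assumes c: "c \<in> hom_coeffs k" and d: "d \<in> hom_coeffs l"
  shows "mseries c (cvec (s *\<^sub>R x)) * mseries d (cvec (s *\<^sub>R x)) =
    complex_of_real (s ^ nat (k + l)) * (mseries c (cvec x) * mseries d (cvec x))"
proof (cases "k < 0 \<or> l < 0")
  case True
  then show ?thesis using hom_coeffs_neg[OF c] hom_coeffs_neg[OF d] by auto
next
  case False
  then have kl: "nat (k + l) = nat k + nat l" by (simp add: nat_add_distrib)
  have "c \<in> hom_coeffs (int (nat k))" "d \<in> hom_coeffs (int (nat l))" using c d False by auto
  from this[THEN mseries_scale] show ?thesis by (simp add: cvec_scaleR kl power_add mult_ac)
qed

lemma euler_homogeneous:
  assumes c: "c \<in> hom_coeffs k"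
  shows "(\<Sum>i\<in>UNIV. z $ i * mseries (mderiv i c) z) = of_int k * mseries c z"
proof -
  have lt: "norm (z $ j) < norm z + 1" for j
    using Finite_Cartesian_Product.norm_nth_le[of z j] by linarith
  have "((\<lambda>\<alpha>. of_nat (\<alpha> i) * c \<alpha> * monomial \<alpha> z) has_sum z $ i * mseries (mderiv i c) z) UNIV" for i
  proof -
    define h where "h \<alpha> = of_nat (\<alpha> i) * c \<alpha> * monomial \<alpha> z" for \<alpha>
    have "((\<lambda>\<alpha>. z $ i * (mderiv i c \<alpha> * monomial \<alpha> z)) has_sum z $ i * mseries (mderiv i c) z) UNIV"
      by (intro has_sum_cmult_right has_sum_mseries[OF hom_coeffs_mconv[OF hom_coeffs_mderiv[OF c]] lt])
    moreover have "z $ i * (mderiv i c \<alpha> * monomial \<alpha> z) = h (\<alpha>(i := Suc (\<alpha> i)))" for \<alpha>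
    proof -
      have "(\<Prod>j\<in>-{i}. z $ j ^ (\<alpha>(i := Suc (\<alpha> i))) j) = (\<Prod>j\<in>-{i}. z $ j ^ \<alpha> j)" by (intro prod.cong) auto
      then show ?thesis by (simp only: h_def mderiv_def monomial_split[of _ z i]) (simp add: mult_ac)
    qed
    ultimately have "(h \<circ> (\<lambda>\<alpha>. \<alpha>(i := Suc (\<alpha> i))) has_sum z $ i * mseries (mderiv i c) z) UNIV" by (simp add: o_def)
    then have "(h has_sum z $ i * mseries (mderiv i c) z) {\<alpha>. \<alpha> i \<noteq> 0}"
      unfolding has_sum_reindex[OF inj_raise_index, symmetric] range_raise_index .
    then have "(h has_sum z $ i * mseries (mderiv i c) z) UNIV"
      by (subst has_sum_cong_neutral[where T="{\<alpha>. \<alpha> i \<noteq> 0}" and g=h]) (auto simp: h_def)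
    then show ?thesis unfolding h_def[abs_def] .
  qed
  then have "((\<lambda>\<alpha>. \<Sum>i\<in>UNIV. of_nat (\<alpha> i) * c \<alpha> * monomial \<alpha> z) has_sum (\<Sum>i\<in>UNIV. z $ i * mseries (mderiv i c) z)) UNIV"
    by (rule has_sum_finite_sum)
  moreover have "(\<Sum>i\<in>UNIV. of_nat (\<alpha> i) * c \<alpha> * monomial \<alpha> z) = of_int k * (c \<alpha> * monomial \<alpha> z)" for \<alpha>
  proof -
    have "(\<Sum>i\<in>UNIV. of_nat (\<alpha> i) * c \<alpha> * monomial \<alpha> z) = of_nat (mdegree \<alpha>) * (c \<alpha> * monomial \<alpha> z)"
      by (simp add: mdegree_def sum_distrib_right mult.assoc)
    then show ?thesis using c by (cases "c \<alpha> = 0") (auto simp: hom_coeffs_def)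
  qed
  moreover have "((\<lambda>\<alpha>. of_int k * (c \<alpha> * monomial \<alpha> z)) has_sum of_int k * mseries c z) UNIV"
    by (intro has_sum_cmult_right has_sum_mseries[OF hom_coeffs_mconv[OF c] lt])
  ultimately show ?thesis by (simp only: has_sum_unique)
qed

definition ball_pairing :: "(('n::finite \<Rightarrow> nat) \<Rightarrow> complex) \<Rightarrow> (('n \<Rightarrow> nat) \<Rightarrow> complex) \<Rightarrow> complex" where
  "ball_pairing c d = (LINT x:ball 0 1|lborel. mseries c (cvec (x :: real ^ 'n)) * mseries d (cvec x))"

lemma set_integrable_ball_continuous:
  fixes f :: "real ^ 'n \<Rightarrow> complex"
  assumes "continuous_on UNIV f"
  shows "set_integrable lborel (ball a r) f"
proof -
  have "compact (f ` cball a r)" by (intro compact_continuous_image continuous_on_subset[OF assms]) auto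
  then obtain M where "\<And>x. x \<in> cball a r \<Longrightarrow> norm (f x) \<le> M"
    using compact_imp_bounded bounded_pos by (metis imageI)
  then show ?thesis
    by (intro set_integrable_ball_bounded[of _ _ _ M] borel_measurable_continuous_onI[OF assms]) auto
qed

lemma ball_pairing_commute: "ball_pairing c d = ball_pairing d c"
  by (simp add: ball_pairing_def mult.commute)

text \<open>Green's identity on the ball. On the sphere the normal derivative of a homogeneous polynomial of
  degree \<open>k\<close> is \<open>k\<close> times the polynomial by Euler's identity, and homogeneity turns the surface
  integral back into an integral over the ball at the cost of the factor \<open>\<kappa>\<close>. What matters is that \<open>\<kappa>\<close>
  and the pairing of the gradients are symmetric in the two polynomials and that \<open>\<kappa>\<close> is not zero.\<close>

lemma ball_green:
  fixes c d :: "('n::finite \<Rightarrow> nat) \<Rightarrow> complex"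
  assumes c: "c \<in> hom_coeffs k" and d: "d \<in> hom_coeffs l"
  defines "\<kappa> \<equiv> of_nat ((CARD('n) + nat (k + l - 2) + 2) * (CARD('n) + nat (k + l - 2) + 4)) /
      (of_nat (CARD('n) + Suc (nat (k + l - 1)) + 2) :: complex)"
  shows "ball_pairing (mlap c) d + (\<Sum>i\<in>UNIV. ball_pairing (mderiv i c) (mderiv i d)) =
    \<kappa> * of_int k * ball_pairing c d"
proof -
  let ?f = "\<lambda>c (x :: real ^ 'n). mseries c (cvec x)"
  let ?I = "\<lambda>f. LINT x:ball 0 1|lborel. (f :: real ^ 'n \<Rightarrow> complex) x"
  have c1: "mderiv i c \<in> hom_coeffs (k - 1)" and d1: "mderiv i d \<in> hom_coeffs (l - 1)"
    and c2: "mderiv i (mderiv i c) \<in> hom_coeffs (k - 2)" for i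
    using c d hom_coeffs_mderiv[OF hom_coeffs_mderiv[OF c], of i i] by (auto intro: hom_coeffs_mderiv)
  note cont = hom_coeffs_continuous[OF c] hom_coeffs_continuous[OF d] hom_coeffs_continuous[OF c1]
    hom_coeffs_continuous[OF d1] hom_coeffs_continuous[OF c2]
  have div: "?I (\<lambda>x. ?f d x * ?f (mderiv i (mderiv i c)) x + ?f (mderiv i d) x * ?f (mderiv i c) x) =
      \<kappa> * ?I (\<lambda>x. complex_of_real (x $ i) * (?f d x * ?f (mderiv i c) x))" for i
  proof -
    have "of_nat (CARD('n) + Suc (nat (k + l - 1)) + 2) *
        ?I (\<lambda>x. ?f d x * ?f (mderiv i (mderiv i c)) x + ?f (mderiv i d) x * ?f (mderiv i c) x) =
      of_nat ((CARD('n) + nat (k + l - 2) + 2) * (CARD('n) + nat (k + l - 2) + 4)) *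
        ?I (\<lambda>x. complex_of_real (x $ i) * (?f d x * ?f (mderiv i c) x))"
    proof (rule integral_divergence)
      show "continuous_on UNIV (\<lambda>x. ?f d x * ?f (mderiv i c) x)" by (intro continuous_intros cont)
      show "continuous_on UNIV (\<lambda>x. ?f d x * ?f (mderiv i (mderiv i c)) x + ?f (mderiv i d) x * ?f (mderiv i c) x)"
        by (intro continuous_intros cont)
      fix x :: "real ^ 'n"
      have lt: "\<bar>x $ j\<bar> < norm x + 1" for j using component_le_norm_cart[of x j] by linarith
      have ax: "axis i 0 = (0 :: real ^ 'n)" by (simp add: vec_eq_iff axis_def)
      show "((\<lambda>t. ?f d (x + axis i t) * ?f (mderiv i c) (x + axis i t)) has_vector_derivative
          ?f d x * ?f (mderiv i (mderiv i c)) x + ?f (mderiv i d) x * ?f (mderiv i c) x) (at 0)"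
        using has_vector_derivative_mult[OF mseries_real_deriv[OF hom_coeffs_mconv[OF d] lt, of i] mseries_real_deriv[OF hom_coeffs_mconv[OF c1[of i]] lt, of i]]
        by (simp add: ax)
    next
      fix s :: real and x :: "real ^ 'n" assume "s > 0"
      have e: "l + (k - 2) = k + l - 2" "l - 1 + (k - 1) = k + l - 2" by auto
      show "?f d (s *\<^sub>R x) * ?f (mderiv i (mderiv i c)) (s *\<^sub>R x) + ?f (mderiv i d) (s *\<^sub>R x) * ?f (mderiv i c) (s *\<^sub>R x) =
          complex_of_real (s ^ nat (k + l - 2)) *
          (?f d x * ?f (mderiv i (mderiv i c)) x + ?f (mderiv i d) x * ?f (mderiv i c) x)"
        unfolding hom_coeffs_scale_product[OF d c2] hom_coeffs_scale_product[OF d1 c1] e by (simp add: algebra_simps)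
      have e: "l + (k - 1) = k + l - 1" by auto
      show "complex_of_real ((s *\<^sub>R x) $ i) * (?f d (s *\<^sub>R x) * ?f (mderiv i c) (s *\<^sub>R x)) =
          complex_of_real (s ^ Suc (nat (k + l - 1))) * (complex_of_real (x $ i) * (?f d x * ?f (mderiv i c) x))"
        unfolding hom_coeffs_scale_product[OF d c1] e by (simp add: algebra_simps)
    qed
    then show ?thesis unfolding \<kappa>_def
      by (subst times_divide_eq_left, subst eq_divide_eq) (simp add: mult.commute del: of_nat_add of_nat_Suc of_nat_mult)
  qed
  have int: "set_integrable lborel (ball 0 1) (\<lambda>x. ?f d x * ?f (mderiv i (mderiv i c)) x)"
    "set_integrable lborel (ball 0 1) (\<lambda>x. ?f (mderiv i d) x * ?f (mderiv i c) x)"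
    "set_integrable lborel (ball 0 1) (\<lambda>x. complex_of_real (x $ i) * (?f d x * ?f (mderiv i c) x))" for i
    by (intro set_integrable_ball_continuous continuous_intros cont)+
  have "(\<Sum>i\<in>UNIV. ?I (\<lambda>x. ?f d x * ?f (mderiv i (mderiv i c)) x + ?f (mderiv i d) x * ?f (mderiv i c) x)) =
      (\<Sum>i\<in>UNIV. ?I (\<lambda>x. ?f d x * ?f (mderiv i (mderiv i c)) x)) + (\<Sum>i\<in>UNIV. ball_pairing (mderiv i c) (mderiv i d))"
    unfolding ball_pairing_def sum.distrib[symmetric]
    by (intro sum.cong refl) (use int in \<open>simp add: mult.commute\<close>)
  moreover have "(\<Sum>i\<in>UNIV. ?I (\<lambda>x. ?f d x * ?f (mderiv i (mderiv i c)) x)) = ball_pairing (mlap c) d"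
  proof -
    have "(\<Sum>i\<in>UNIV. ?I (\<lambda>x. ?f d x * ?f (mderiv i (mderiv i c)) x)) =
        ?I (\<lambda>x. \<Sum>i\<in>UNIV. ?f d x * ?f (mderiv i (mderiv i c)) x)"
      unfolding set_lebesgue_integral_def scaleR_sum_right
      by (rule Bochner_Integration.integral_sum[symmetric]) (use int in \<open>simp add: set_integrable_def\<close>)
    also have "\<dots> = ball_pairing (mlap c) d"
    proof -
      have "?f (mlap c) x = (\<Sum>i\<in>UNIV. ?f (mderiv i (mderiv i c)) x)" for x
        unfolding mlap_def
      proof (rule mseries_sum[where r="norm x + 1"])
        show "norm (cvec x $ j) < norm x + 1" for j using component_le_norm_cart[of x j] by simp
      qed (rule hom_coeffs_mconv[OF c2])
      then show ?thesis by (simp add: ball_pairing_def sum_distrib_left mult.commute)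
    qed
    finally show ?thesis .
  qed
  moreover have "(\<Sum>i\<in>UNIV. ?I (\<lambda>x. complex_of_real (x $ i) * (?f d x * ?f (mderiv i c) x))) = of_int k * ball_pairing c d"
  proof -
    have "(\<Sum>i\<in>UNIV. ?I (\<lambda>x. complex_of_real (x $ i) * (?f d x * ?f (mderiv i c) x))) =
        ?I (\<lambda>x. \<Sum>i\<in>UNIV. complex_of_real (x $ i) * (?f d x * ?f (mderiv i c) x))"
      unfolding set_lebesgue_integral_def scaleR_sum_right
      by (rule Bochner_Integration.integral_sum[symmetric]) (use int in \<open>simp add: set_integrable_def\<close>)
    also have "\<dots> = ?I (\<lambda>x. of_int k * (?f c x * ?f d x))"
    proof -
      have "(\<Sum>i\<in>UNIV. complex_of_real (x $ i) * (?f d x * ?f (mderiv i c) x)) = ?f d x * (\<Sum>i\<in>UNIV. cvec x $ i * ?f (mderiv i c) x)" for x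
        by (simp add: sum_distrib_left mult_ac)
      then show ?thesis unfolding euler_homogeneous[OF c] by (simp add: mult_ac)
    qed
    finally show ?thesis by (simp add: ball_pairing_def)
  qed
  ultimately show ?thesis unfolding div sum_distrib_left[symmetric] by (simp add: mult.assoc add.commute)
qed

text \<open>The Almansi components of a homogeneous polynomial of degree k annihilated by the a-th power
  of the Laplacian have the harmonic degrees k, k - 2, ..., k - 2(a - 1); polynomials without a
  common harmonic degree are orthogonal. Green's identity lets one induct on the orders without
  decomposing the polynomials.\<close>

lemma ball_pairing_orthogonal:
  assumes "c \<in> hom_coeffs k" "d \<in> hom_coeffs l" "(mlap ^^ a) c = (\<lambda>_. 0)" "(mlap ^^ b) d = (\<lambda>_. 0)"
    and "\<And>i j. i < a \<Longrightarrow> j < b \<Longrightarrow> k - 2 * int i \<noteq> l - 2 * int j"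
  shows "ball_pairing c d = 0"
  using assms
proof (induction "a + b" arbitrary: a b c d k l rule: less_induct)
  case less
  have z: "mseries (\<lambda>_. 0) z = 0" for z :: "complex ^ 'a" by (simp add: mseries_def)
  show ?case
  proof (cases "a = 0 \<or> b = 0")
    case True
    then show ?thesis using less.prems by (auto simp: ball_pairing_def z set_lebesgue_integral_def)
  next
    case False
    then obtain a' b' where ab: "a = Suc a'" "b = Suc b'" by (metis not0_implies_Suc)
    have "ball_pairing (mlap c) d = 0"
    proof (rule less.hyps)
      show "a' + b < a + b" using ab by simp
      show "mlap c \<in> hom_coeffs (k - 2)" by (rule hom_coeffs_mlap[OF less.prems(1)])
      show "(mlap ^^ a') (mlap c) = (\<lambda>_. 0)" using less.prems(3) by (simp add: ab funpow_swap1)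
      show "k - 2 - 2 * int i \<noteq> l - 2 * int j" if "i < a'" "j < b" for i j
        using less.prems(5)[of "Suc i" j] that ab by auto
    qed (use less.prems in auto)
    moreover have "ball_pairing (mlap d) c = 0"
      unfolding ball_pairing_commute[of "mlap d"]
    proof (rule less.hyps)
      show "a + b' < a + b" using ab by simp
      show "mlap d \<in> hom_coeffs (l - 2)" by (rule hom_coeffs_mlap[OF less.prems(2)])
      show "(mlap ^^ b') (mlap d) = (\<lambda>_. 0)" using less.prems(4) by (simp add: ab funpow_swap1)
      show "k - 2 * int i \<noteq> l - 2 - 2 * int j" if "i < a" "j < b'" for i j
        using less.prems(5)[of i "Suc j"] that ab by auto
    qed (use less.prems in auto)
    moreover define \<kappa> where "\<kappa> = of_nat ((CARD('a) + nat (k + l - 2) + 2) * (CARD('a) + nat (k + l - 2) + 4)) /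
      (of_nat (CARD('a) + Suc (nat (k + l - 1)) + 2) :: complex)"
    moreover have "\<kappa> \<noteq> 0" unfolding \<kappa>_def divide_eq_0_iff of_nat_eq_0_iff by simp
    moreover have "(\<Sum>i\<in>UNIV. ball_pairing (mderiv i d) (mderiv i c)) = (\<Sum>i\<in>UNIV. ball_pairing (mderiv i c) (mderiv i d))"
      by (intro sum.cong refl ball_pairing_commute)
    ultimately have "\<kappa> * of_int k * ball_pairing c d = \<kappa> * of_int l * ball_pairing c d"
      using ball_green[OF less.prems(1,2)] ball_green[OF less.prems(2,1)]
      unfolding ball_pairing_commute[of d c] by (simp add: add.commute)
    then have "(of_int k - of_int l :: complex) * ball_pairing c d = 0"
      using \<open>\<kappa> \<noteq> 0\<close> by (simp add: algebra_simps)
    moreover have "k \<noteq> l" using less.prems(5)[of 0 0] ab by simp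
    ultimately show ?thesis by simp
  qed
qed

lemma mseries_rotate:
  assumes "c \<in> hom_coeffs (int m)"
  shows "mseries c (rotate_vec \<psi> x) = cis (real m * \<psi>) * mseries c (cvec x)"
  by (simp add: rotate_vec_def mseries_scale[OF assms] Complex.DeMoivre)

lemma cnj_mseries:
  assumes "c \<in> hom_coeffs k"
  shows "cnj \<circ> c \<in> hom_coeffs k" and "mseries (cnj \<circ> c) (cvec x) = cnj (mseries c (cvec x))"
proof -
  show *: "cnj \<circ> c \<in> hom_coeffs k" using assms by (simp add: hom_coeffs_def)
  show "mseries (cnj \<circ> c) (cvec x) = cnj (mseries c (cvec x))"
    unfolding hom_coeffs_eq_sum[OF *] hom_coeffs_eq_sum[OF assms] by (simp add: monomial_cvec)
qed

lemma mlap_pow_cnj: "(mlap ^^ k) (cnj \<circ> c) = cnj \<circ> (mlap ^^ k) c"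
proof (induction k)
  case (Suc k)
  have "mlap (cnj \<circ> d) = cnj \<circ> mlap d" for d :: "('a \<Rightarrow> nat) \<Rightarrow> complex"
    by (simp add: mlap_def mderiv_def fun_eq_iff)
  then show ?case by (simp only: funpow.simps(2) comp_apply[of mlap] Suc)
qed simp

definition ball_inner :: "(('n::finite \<Rightarrow> nat) \<Rightarrow> complex) \<Rightarrow> (('n \<Rightarrow> nat) \<Rightarrow> complex) \<Rightarrow> complex" where
  "ball_inner c d = (LINT x:ball 0 1|lborel. mseries c (cvec (x :: real ^ 'n)) * cnj (mseries d (cvec x)))"

lemma ball_inner_orthogonal:
  assumes c: "c \<in> polyharm_coeffs p k" and d: "d \<in> polyharm_coeffs p l"
    and ne: "\<And>i j. i < p \<Longrightarrow> j < p \<Longrightarrow> k - 2 * int i \<noteq> l - 2 * int j"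
  shows "ball_inner c d = 0"
proof -
  have d': "d \<in> hom_coeffs l" using d by (rule polyharm_coeffs_hom)
  have "ball_inner c d = ball_pairing c (cnj \<circ> d)"
    unfolding ball_inner_def ball_pairing_def cnj_mseries(2)[OF d'] ..
  also have "\<dots> = 0"
  proof (rule ball_pairing_orthogonal[OF _ cnj_mseries(1)[OF d'] _ _ ne])
    show "(mlap ^^ p) (cnj \<circ> d) = (\<lambda>_. 0)" using d by (simp add: mlap_pow_cnj polyharm_coeffs_def fun_eq_iff)
  qed (use c in \<open>auto simp: polyharm_coeffs_def\<close>)
  finally show ?thesis .
qed

section \<open>Bounds by the square integral\<close>

definition ball_norm2 :: "(('n::finite \<Rightarrow> nat) \<Rightarrow> complex) \<Rightarrow> real" where
  "ball_norm2 c = (LINT x:ball 0 1|lborel. (norm (mseries c (cvec (x :: real ^ 'n))))\<^sup>2)"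

lemma set_integral_complex_of_real:
  "(LINT x:A|M. complex_of_real (f x)) = complex_of_real (LINT x:A|M. f x)"
proof -
  have "(\<lambda>x. indicator A x *\<^sub>R complex_of_real (f x)) = (\<lambda>x. complex_of_real (indicator A x *\<^sub>R f x))"
    by (simp add: fun_eq_iff scaleR_conv_of_real)
  then show ?thesis unfolding set_lebesgue_integral_def by (simp only: integral_complex_of_real)
qed

lemma ball_inner_self: "ball_inner c c = complex_of_real (ball_norm2 c)"
  unfolding ball_inner_def ball_norm2_def set_integral_complex_of_real[symmetric]
  by (simp only: complex_norm_square)

lemma ball_norm2_nonneg: "ball_norm2 c \<ge> 0"
  unfolding ball_norm2_def set_lebesgue_integral_def by (intro integral_nonneg_AE) auto

lemma mseries_le_sphere_bound:
  assumes c: "c \<in> hom_coeffs (int m)" and M: "\<And>x. norm x = 1 \<Longrightarrow> norm (mseries c (cvec x)) \<le> M"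
  shows "norm (mseries c (cvec x)) \<le> M * norm (x :: real ^ 'n) ^ m"
proof (cases "x = 0")
  case True
  obtain e :: "real ^ 'n" where e: "norm e = 1"
    using norm_axis_real[where 'n='n, of undefined 1] by (metis abs_one)
  show ?thesis
  proof (cases "m = 0")
    case m: True
    have "mseries c (cvec x) = mseries c (0 *s cvec e)" using True by simp
    also have "\<dots> = mseries c (cvec e)" using mseries_scale[OF c, of 0 "cvec e"] m by simp
    finally show ?thesis using M[OF e] m by simp
  next
    case False
    have "mseries c (0 *s cvec e) = 0" using mseries_scale[OF c, of 0 "cvec e"] False by simp
    then show ?thesis using True False by (simp add: zero_power)
  qed
next
  case False
  have "x = norm x *\<^sub>R (x /\<^sub>R norm x)" using False by simp
  then have "mseries c (cvec x) = complex_of_real (norm x) ^ m * mseries c (cvec (x /\<^sub>R norm x))"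
    using mseries_scale[OF c] cvec_scaleR by metis
  moreover have "norm (mseries c (cvec (x /\<^sub>R norm x))) \<le> M" using False by (intro M) simp
  ultimately show ?thesis by (simp add: norm_mult norm_power mult.commute[of M] mult_left_mono)
qed

text \<open>By homogeneity the bound on the sphere gives a bound \<open>b\<^sup>m\<close> on the ball of radius \<open>b\<close>. Leja's lemma,
  applied on small cubes inside this ball, carries it over to complex points near the unit ball.\<close>

lemma homogeneous_complex_bound:
  fixes \<kappa> :: real
  assumes \<kappa>: "\<kappa> > 1"
  obtains \<rho> N where "\<rho> > 0" "1 + \<rho> \<le> \<kappa>" "N \<ge> 1"
    "\<And>m (c :: ('n::finite \<Rightarrow> nat) \<Rightarrow> complex) a \<zeta>. c \<in> hom_coeffs (int m) \<Longrightarrow>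
      (\<And>x. norm x = 1 \<Longrightarrow> norm (mseries c (cvec x)) \<le> 1) \<Longrightarrow> norm (a :: real ^ 'n) \<le> 1 \<Longrightarrow> (\<And>i. norm (\<zeta> $ i) \<le> \<rho>) \<Longrightarrow>
      norm (mseries c (cvec a + \<zeta>)) \<le> N * \<kappa> ^ m"
proof -
  let ?n = "real CARD('n)"
  \<comment> \<open>One factor \<open>b\<^sup>m\<close> is spent on enlarging the ball, the other one in Leja's lemma.\<close>
  define b where "b = sqrt \<kappa>"
  have b: "b > 1" "b * b = \<kappa>" using \<kappa> by (simp_all add: b_def)
  then have bk: "b \<le> \<kappa>" by (metis less_imp_le mult_le_cancel_left1 not_one_le_zero zero_le_one order.trans not_less)
  have "b - 1 > 0" using b by simp
  then obtain r where r: "r > 0" and R: "\<And>F :: (nat \<times> (complex ^ 'n \<Rightarrow> complex)) set. (\<And>m Q. (m, Q) \<in> F \<Longrightarrow> separately_poly m Q) \<Longrightarrow>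
       (\<And>x. (\<And>i. \<bar>x $ i\<bar> \<le> 1) \<Longrightarrow> \<exists>N. \<forall>(m, Q)\<in>F. norm (Q (cvec x)) \<le> N) \<Longrightarrow>
       \<exists>N. \<forall>(m, Q)\<in>F. \<forall>z. (\<forall>i. norm (z $ i) \<le> r) \<longrightarrow> norm (Q z) \<le> N * (1 + (b - 1)) ^ m"
    using leja_separately[OF \<open>b - 1 > 0\<close>, where 'n='n] by blast
  define s where "s = min ((b - 1) / ?n) ((b - 1) / r)"
  have s: "s > 0" "1 + s * ?n \<le> b" "1 + s * r \<le> b"
  proof -
    show "s > 0" using b r by (simp add: s_def)
    have "s \<le> (b - 1) / ?n" "s \<le> (b - 1) / r" by (simp_all add: s_def)
    then show "1 + s * ?n \<le> b" "1 + s * r \<le> b" using r by (simp_all add: field_simps)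
  qed
  \<comment> \<open>A single family of all degrees and all centres, so that the constant is independent of them.\<close>
  define F where "F = {(m, Q). \<exists>(c :: ('n \<Rightarrow> nat) \<Rightarrow> complex) (a :: real ^ 'n). c \<in> hom_coeffs (int m) \<and>
      (\<forall>x. norm x = 1 \<longrightarrow> norm (mseries c (cvec x)) \<le> 1) \<and> norm a \<le> 1 \<and>
      Q = (\<lambda>z. complex_of_real (1 / b ^ m) * mseries c (cvec a + complex_of_real s *s z))}"
  have "\<exists>N. \<forall>(m, Q)\<in>F. \<forall>z. (\<forall>i. norm (z $ i) \<le> r) \<longrightarrow> norm (Q z) \<le> N * (1 + (b - 1)) ^ m"
  proof (rule R)
    fix m and Q :: "complex ^ 'n \<Rightarrow> complex" assume "(m, Q) \<in> F"
    then show "separately_poly m Q"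
      unfolding F_def by (auto intro!: separately_poly_cmult separately_poly_mseries simp del: of_real_divide)
  next
    fix x :: "real ^ 'n" assume x: "\<And>i. \<bar>x $ i\<bar> \<le> 1"
    have nx: "norm x \<le> ?n" using norm_le_l1_cart[of x] sum_mono[of UNIV "\<lambda>i. \<bar>x $ i\<bar>" "\<lambda>_. 1"] x by simp
    have "norm (Q (cvec x)) \<le> 1" if mQ: "(m, Q) \<in> F" for m Q
    proof -
      obtain c and a :: "real ^ 'n" where c: "c \<in> hom_coeffs (int m)" "\<And>x. norm x = 1 \<Longrightarrow> norm (mseries c (cvec x)) \<le> 1"
        and a: "norm a \<le> 1" and Q: "Q = (\<lambda>z. complex_of_real (1 / b ^ m) * mseries c (cvec a + complex_of_real s *s z))"
        using mQ unfolding F_def by blast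
      have e: "cvec a + complex_of_real s *s cvec x = cvec (a + s *\<^sub>R x)" by (simp add: vec_eq_iff)
      have "norm (a + s *\<^sub>R x) \<le> norm a + s * norm x" using norm_triangle_ineq[of a "s *\<^sub>R x"] s by simp
      also have "\<dots> \<le> 1 + s * ?n" using a nx s by (intro add_mono mult_left_mono) auto
      finally have "norm (a + s *\<^sub>R x) \<le> b" using s by simp
      then have "norm (a + s *\<^sub>R x) ^ m \<le> b ^ m" by (intro power_mono) auto
      moreover have "norm (mseries c (cvec (a + s *\<^sub>R x))) \<le> 1 * norm (a + s *\<^sub>R x) ^ m"
        by (rule mseries_le_sphere_bound[OF c])
      ultimately have "norm (mseries c (cvec (a + s *\<^sub>R x))) \<le> b ^ m" by linarith
      moreover have nb: "norm (complex_of_real (1 / b ^ m)) = 1 / b ^ m" unfolding norm_of_real using b by simp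
      ultimately show ?thesis unfolding Q e norm_mult nb using b by (simp add: field_simps)
    qed
    then show "\<exists>N. \<forall>(m, Q)\<in>F. norm (Q (cvec x)) \<le> N" by (intro exI[of _ 1]) auto
  qed
  then obtain N where N: "\<And>m Q z. (m, Q) \<in> F \<Longrightarrow> (\<And>i. norm (z $ i) \<le> r) \<Longrightarrow> norm (Q z) \<le> N * b ^ m"
    by (auto split: prod.splits) (metis (no_types, lifting))
  show thesis
  proof (rule that)
    show "s * r > 0" using s r by simp
    show "1 + s * r \<le> \<kappa>" using s bk by simp
    show "max N 1 \<ge> 1" by simp
    fix m and c :: "('n \<Rightarrow> nat) \<Rightarrow> complex" and a :: "real ^ 'n" and \<zeta> :: "complex ^ 'n"
    assume c: "c \<in> hom_coeffs (int m)" "\<And>x. norm x = 1 \<Longrightarrow> norm (mseries c (cvec x)) \<le> 1"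
      and a: "norm a \<le> 1" and \<zeta>: "\<And>i. norm (\<zeta> $ i) \<le> s * r"
    define z where "z = complex_of_real (1 / s) *s \<zeta>"
    have zr: "norm (z $ i) \<le> r" for i
      using \<zeta>[of i] s by (simp add: z_def norm_mult norm_divide field_simps)
    have sz: "complex_of_real s *s z = \<zeta>" using s by (simp add: z_def vec_eq_iff)
    have "(m, \<lambda>z. complex_of_real (1 / b ^ m) * mseries c (cvec a + complex_of_real s *s z)) \<in> F"
      unfolding F_def using c a by blast
    from N[OF this, of z, OF zr] have "norm (complex_of_real (1 / b ^ m) * mseries c (cvec a + \<zeta>)) \<le> N * b ^ m"
      by (simp only: sz)
    moreover have nb: "norm (complex_of_real (1 / b ^ m)) = 1 / b ^ m" unfolding norm_of_real using b by simp
    ultimately have "norm (mseries c (cvec a + \<zeta>)) \<le> N * (b ^ m * b ^ m)"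
      unfolding norm_mult nb using b by (simp add: field_simps)
    also have "\<dots> = N * \<kappa> ^ m" using b by (simp flip: power_mult_distrib)
    also have "\<dots> \<le> max N 1 * \<kappa> ^ m" using \<kappa> by (intro mult_right_mono) auto
    finally show "norm (mseries c (cvec a + \<zeta>)) \<le> max N 1 * \<kappa> ^ m" .
  qed
qed

lemma mseries_line_holomorphic:
  assumes "c \<in> hom_coeffs k"
  shows "(\<lambda>t. mseries c (a + t *s v)) holomorphic_on A"
  unfolding hom_coeffs_eq_sum[OF assms] monomial_def
  by (auto intro!: holomorphic_intros)

text \<open>At a maximum point on the sphere the Schwarz lemma keeps the polynomial above half its maximum
  on a ball whose radius decays slowly with the degree, so its square integral cannot be small.\<close>

lemma sup_le_ball_norm2:
  fixes \<epsilon> :: real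
  assumes \<epsilon>: "\<epsilon> > 0"
  obtains C where "C > 0"
    "\<And>m (c :: ('n::finite \<Rightarrow> nat) \<Rightarrow> complex) (x :: real ^ 'n). c \<in> hom_coeffs (int m) \<Longrightarrow>
      (norm (mseries c (cvec x)))\<^sup>2 \<le> C * (1 + \<epsilon>) ^ m * norm x ^ (2 * m) * ball_norm2 c"
proof -
  let ?n = "CARD('n)"
  define V where "V = unit_ball_vol (real ?n)"
  have V: "V > 0" by (simp add: V_def)
  \<comment> \<open>The volume of a ball of radius proportional to \<open>1 / \<kappa>\<^sup>m\<close> costs \<open>n\<close> factors \<open>\<kappa>\<^sup>m\<close>, and the dilation of
    the unit ball by \<open>1 + \<rho> \<le> \<kappa>\<close> costs two.\<close>
  define \<kappa> where "\<kappa> = (1 + \<epsilon>) powr (1 / real (?n + 2))"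
  have \<kappa>: "\<kappa> > 1" unfolding \<kappa>_def using \<epsilon> by (intro gr_one_powr) auto
  have \<kappa>n: "\<kappa> ^ (?n + 2) = 1 + \<epsilon>"
    using \<epsilon> by (simp add: \<kappa>_def powr_realpow[symmetric] powr_powr del: power_Suc)
  obtain \<rho> N where \<rho>: "\<rho> > 0" "1 + \<rho> \<le> \<kappa>" and N: "N \<ge> 1" and B:
    "\<And>m (c :: ('n \<Rightarrow> nat) \<Rightarrow> complex) a \<zeta>. c \<in> hom_coeffs (int m) \<Longrightarrow>
      (\<And>x. norm x = 1 \<Longrightarrow> norm (mseries c (cvec x)) \<le> 1) \<Longrightarrow> norm (a :: real ^ 'n) \<le> 1 \<Longrightarrow> (\<And>i. norm (\<zeta> $ i) \<le> \<rho>) \<Longrightarrow>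
      norm (mseries c (cvec a + \<zeta>)) \<le> N * \<kappa> ^ m"
    using homogeneous_complex_bound[OF \<kappa>] by blast
  define C where "C = 4 / V * (6 * N / \<rho>) ^ ?n * (1 + \<rho>) ^ ?n"
  have C: "C > 0" using V N \<rho> by (simp add: C_def)
  have normalized: "1 \<le> C * (1 + \<epsilon>) ^ m * ball_norm2 c"
    if c: "c \<in> hom_coeffs (int m)" and le: "\<And>x. norm x = 1 \<Longrightarrow> norm (mseries c (cvec x)) \<le> 1"
      and a: "norm a = 1" "norm (mseries c (cvec a)) = 1" for m and c :: "('n \<Rightarrow> nat) \<Rightarrow> complex" and a :: "real ^ 'n"
  proof -
    define L where "L = 3 * N * \<kappa> ^ m"
    have L: "L \<ge> 3" using mult_mono[OF N, of 1 "\<kappa> ^ m"] \<kappa> N by (simp add: L_def)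
    have lip: "norm (mseries c (cvec (a + v)) - mseries c (cvec a)) \<le> L * norm v / \<rho>" if v: "norm v < \<rho>" for v
    proof (cases "v = 0")
      case False
      define u where "u = \<rho> *\<^sub>R (v /\<^sub>R norm v)"
      define g where "g t = (mseries c (cvec a + t *s cvec u) - mseries c (cvec a)) / complex_of_real L" for t
      have nu: "norm u = \<rho>" using False \<rho> by (simp add: u_def)
      have gb: "norm (g t) < 1" if t: "norm t < 1" for t
      proof -
        have "norm (mseries c (cvec a + t *s cvec u)) \<le> N * \<kappa> ^ m"
        proof (rule B[OF c le])
          fix i
          have "norm t * \<bar>u $ i\<bar> \<le> 1 * \<rho>"
            using t component_le_norm_cart[of u i] nu by (intro mult_mono) auto
          then show "norm ((t *s cvec u) $ i) \<le> \<rho>" by (simp add: norm_mult)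
        qed (use a in auto)
        moreover have "norm (mseries c (cvec a)) \<le> N * \<kappa> ^ m"
          using a mult_mono[OF N, of 1 "\<kappa> ^ m"] \<kappa> N by simp
        ultimately have "norm (mseries c (cvec a + t *s cvec u) - mseries c (cvec a)) \<le> 2 * (N * \<kappa> ^ m)"
          using norm_triangle_ineq4[of "mseries c (cvec a + t *s cvec u)" "mseries c (cvec a)"] by linarith
        also have "\<dots> < L" using L by (simp add: L_def)
        finally show ?thesis using L by (simp add: g_def norm_divide)
      qed
      have hol: "g holomorphic_on ball 0 1"
        unfolding g_def by (intro holomorphic_intros mseries_line_holomorphic[OF c]) (use L in auto)
      define t where "t = complex_of_real (norm v / \<rho>)"
      have nt: "norm t < 1" "norm t = norm v / \<rho>"
        using v \<rho> unfolding t_def norm_of_real by simp_all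
      have "norm (g t) \<le> norm t"
        by (rule Schwarz_Lemma(1)[OF hol _ gb nt(1)]) (simp_all add: g_def)
      moreover have "cvec a + t *s cvec u = cvec (a + v)"
        using False \<rho> by (simp add: vec_eq_iff t_def u_def)
      ultimately have "norm (mseries c (cvec (a + v)) - mseries c (cvec a)) / L \<le> norm v / \<rho>"
        unfolding g_def nt norm_divide using L by simp
      then show ?thesis using L by (simp add: field_simps)
    qed simp
    define \<delta> where "\<delta> = \<rho> / (2 * L)"
    have \<delta>: "\<delta> > 0" "\<delta> \<le> \<rho>" using \<rho> L by (auto simp: \<delta>_def field_simps)
    have low: "(norm (mseries c (cvec x)))\<^sup>2 \<ge> 1 / 4" if x: "x \<in> ball a \<delta>" for x
    proof -
      have v: "norm (x - a) < \<delta>" using x by (simp add: dist_norm norm_minus_commute)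
      have "norm (mseries c (cvec (a + (x - a))) - mseries c (cvec a)) \<le> L * norm (x - a) / \<rho>"
        by (rule lip) (use v \<delta> in simp)
      also have "\<dots> \<le> L * \<delta> / \<rho>" using v L \<rho> by (intro divide_right_mono mult_left_mono) auto
      also have "\<dots> = 1 / 2" using L \<rho> by (simp add: \<delta>_def)
      finally have "norm (mseries c (cvec x) - mseries c (cvec a)) \<le> 1 / 2" by simp
      then have "norm (mseries c (cvec x)) \<ge> 1 / 2"
        using norm_triangle_ineq3[of "mseries c (cvec a)" "mseries c (cvec x)"] a(2)
        by (simp add: norm_minus_commute)
      from power_mono[OF this, of 2] show ?thesis by (simp add: power2_eq_square)
    qed
    let ?f = "\<lambda>x. (norm (mseries c (cvec (x :: real ^ 'n))))\<^sup>2"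
    have cont: "continuous_on UNIV (\<lambda>x. complex_of_real (?f x))"
      by (intro continuous_intros hom_coeffs_continuous[OF c])
    have intc: "set_integrable lborel (ball y R) (\<lambda>x. complex_of_real (?f x))" for y R
      by (rule set_integrable_ball_continuous[OF cont])
    have intr: "set_integrable lborel (ball y R) ?f" for y R
    proof -
      have "(\<lambda>x. indicator (ball y R) x *\<^sub>R complex_of_real (?f x)) = (\<lambda>x. complex_of_real (indicator (ball y R) x *\<^sub>R ?f x))"
        by (simp add: fun_eq_iff scaleR_conv_of_real)
      then show ?thesis using intc[of y R] unfolding set_integrable_def
        by (simp only: complex_of_real_integrable_eq)
    qed
    have "1 / 4 * (V * \<delta> ^ ?n) = (LINT x:ball a \<delta>|lborel. 1 / 4)"
      using \<delta> emeasure_lborel_ball_finite[of a \<delta>]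
      by (simp add: set_lebesgue_integral_def content_ball V_def)
    also have "\<dots> \<le> (LINT x:ball a \<delta>|lborel. ?f x)"
      using low by (intro set_integral_mono intr)
        (auto simp: set_integrable_def intro!: integrable_real_indicator emeasure_lborel_ball_finite integrable_mult_left)
    also have "\<dots> \<le> (LINT x:ball 0 (1 + \<rho>)|lborel. ?f x)"
      unfolding set_lebesgue_integral_def
    proof (rule integral_mono'[OF intr[unfolded set_integrable_def]])
      have sub: "ball a \<delta> \<subseteq> ball 0 (1 + \<rho>)"
      proof
        fix x assume "x \<in> ball a \<delta>"
        then have "norm (x - a) < \<rho>" using \<delta> by (simp add: dist_norm norm_minus_commute)
        then show "x \<in> ball 0 (1 + \<rho>)" using norm_triangle_ineq[of "x - a" a] a by simp
      qed
      show "indicator (ball a \<delta>) x *\<^sub>R ?f x \<le> indicator (ball 0 (1 + \<rho>)) x *\<^sub>R ?f x" for x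
        using sub by (auto simp: indicator_def)
    qed auto
    also have "\<dots> = (1 + \<rho>) ^ ?n * ((1 + \<rho>) ^ 2) ^ m * ball_norm2 c"
    proof -
      have "(LINT x:ball 0 (1 + \<rho>)|lborel. complex_of_real (?f x)) =
          complex_of_real ((1 + \<rho>) ^ ?n * ((1 + \<rho>) ^ 2) ^ m) * (LINT x:ball 0 1|lborel. complex_of_real (?f x))"
      proof (rule integral_ball_scale[OF borel_measurable_continuous_onI[OF cont]])
        show "1 + \<rho> > 0" using \<rho> by simp
        fix x :: "real ^ 'n"
        have "mseries c (cvec ((1 + \<rho>) *\<^sub>R x)) = complex_of_real (1 + \<rho>) ^ m * mseries c (cvec x)"
          by (simp only: cvec_scaleR mseries_scale[OF c])
        then have "norm (mseries c (cvec ((1 + \<rho>) *\<^sub>R x))) = (1 + \<rho>) ^ m * norm (mseries c (cvec x))"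
          using \<rho> by (simp add: norm_mult norm_power del: of_real_add of_real_1)
        then show "complex_of_real (?f ((1 + \<rho>) *\<^sub>R x)) = complex_of_real (((1 + \<rho>) ^ 2) ^ m) * complex_of_real (?f x)"
          by (simp only: power_mult_distrib of_real_mult power_mult[symmetric] mult.commute)
      qed
      then have "complex_of_real (LINT x:ball 0 (1 + \<rho>)|lborel. ?f x) =
          complex_of_real ((1 + \<rho>) ^ ?n * ((1 + \<rho>) ^ 2) ^ m * ball_norm2 c)"
        unfolding set_integral_complex_of_real ball_norm2_def of_real_mult .
      then show ?thesis by (simp only: of_real_eq_iff)
    qed
    finally have main: "1 / 4 * (V * \<delta> ^ ?n) \<le> (1 + \<rho>) ^ ?n * ((1 + \<rho>) ^ 2) ^ m * ball_norm2 c" .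
    have \<delta>': "\<delta> * (6 * N / \<rho> * \<kappa> ^ m) = 1" using \<rho> N \<kappa> by (simp add: \<delta>_def L_def)
    have "1 = (\<delta> * (6 * N / \<rho> * \<kappa> ^ m)) ^ ?n" unfolding \<delta>' by simp
    also have "\<dots> = \<delta> ^ ?n * (6 * N / \<rho> * \<kappa> ^ m) ^ ?n" by (rule power_mult_distrib)
    also have "\<dots> = 4 / V * (6 * N / \<rho> * \<kappa> ^ m) ^ ?n * (1 / 4 * (V * \<delta> ^ ?n))"
      using V by simp
    also have "\<dots> \<le> 4 / V * (6 * N / \<rho> * \<kappa> ^ m) ^ ?n * ((1 + \<rho>) ^ ?n * ((1 + \<rho>) ^ 2) ^ m * ball_norm2 c)"
      using main V N \<rho> \<kappa> by (intro mult_left_mono) auto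
    also have "\<dots> = C * (((\<kappa> ^ m) ^ ?n * ((1 + \<rho>) ^ 2) ^ m)) * ball_norm2 c"
      unfolding C_def power_mult_distrib[of "6 * N / \<rho>" "\<kappa> ^ m"] by (simp only: mult_ac)
    also have "\<dots> \<le> C * (1 + \<epsilon>) ^ m * ball_norm2 c"
    proof -
      have "(\<kappa> ^ m) ^ ?n * ((1 + \<rho>) ^ 2) ^ m \<le> (\<kappa> ^ m) ^ ?n * (\<kappa> ^ 2) ^ m"
        using \<rho> \<kappa> by (intro mult_left_mono power_mono) auto
      also have "\<dots> = (\<kappa> ^ (?n + 2)) ^ m"
        by (simp only: power_mult[symmetric] power_add[symmetric] distrib_left distrib_right mult.commute)
      finally show ?thesis using C ball_norm2_nonneg[of c] unfolding \<kappa>n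
        by (intro mult_right_mono mult_left_mono) auto
    qed
    finally show ?thesis .
  qed
  show thesis
  proof (rule that[OF C])
    fix m and c :: "('n \<Rightarrow> nat) \<Rightarrow> complex" and x :: "real ^ 'n"
    assume c: "c \<in> hom_coeffs (int m)"
    have "\<exists>a\<in>sphere (0::real ^ 'n) 1. \<forall>x\<in>sphere 0 1. norm (mseries c (cvec x)) \<le> norm (mseries c (cvec a))"
    proof (rule continuous_attains_sup)
      show "sphere 0 1 \<noteq> ({} :: (real ^ 'n) set)" 
      proof -
        have "axis undefined 1 \<in> sphere (0 :: real ^ 'n) 1" by (simp add: norm_axis_real)
        then show ?thesis by blast
      qed
      show "continuous_on (sphere 0 1) (\<lambda>x :: real ^ 'n. norm (mseries c (cvec x)))"
        by (intro continuous_intros hom_coeffs_continuous[OF c])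
    qed auto
    then obtain a :: "real ^ 'n" where a: "norm a = 1" "\<And>x. norm x = 1 \<Longrightarrow> norm (mseries c (cvec x)) \<le> norm (mseries c (cvec a))"
      by auto
    define M where "M = norm (mseries c (cvec a))"
    have M2: "M\<^sup>2 \<le> C * (1 + \<epsilon>) ^ m * ball_norm2 c"
    proof (cases "M = 0")
      case True
      then show ?thesis using C \<epsilon> ball_norm2_nonneg[of c] by simp
    next
      case False
      then have M: "M > 0" by (simp add: M_def)
      define d where "d = (\<lambda>\<alpha>. complex_of_real (1 / M) * c \<alpha>)"
      have d: "d \<in> hom_coeffs (int m)" using c by (simp add: hom_coeffs_def d_def)
      have md: "norm (mseries d z) = norm (mseries c z) / M" for z
      proof -
        have "mseries d z = complex_of_real (1 / M) * mseries c z"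
          unfolding hom_coeffs_eq_sum[OF c] hom_coeffs_eq_sum[OF d] by (simp add: d_def sum_distrib_left mult.assoc)
        moreover have "norm (complex_of_real (1 / M)) = 1 / M" unfolding norm_of_real using M by simp
        ultimately show ?thesis using M by (simp add: norm_divide)
      qed
      have "1 \<le> C * (1 + \<epsilon>) ^ m * ball_norm2 d"
        by (rule normalized[OF d]) (use a M in \<open>auto simp: md M_def[symmetric]\<close>)
      moreover have "ball_norm2 d = ball_norm2 c / M\<^sup>2"
        unfolding ball_norm2_def md power_divide set_lebesgue_integral_def by simp
      ultimately show ?thesis using M by (simp add: field_simps)
    qed
    have "norm (mseries c (cvec x)) \<le> M * norm x ^ m"
      by (rule mseries_le_sphere_bound[OF c]) (use a in \<open>auto simp: M_def\<close>)
    then have "(norm (mseries c (cvec x)))\<^sup>2 \<le> (M * norm x ^ m)\<^sup>2" by (intro power_mono) auto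
    also have "\<dots> = M\<^sup>2 * norm x ^ (2 * m)" by (simp add: power_mult_distrib power_mult[symmetric] mult.commute)
    also have "\<dots> \<le> (C * (1 + \<epsilon>) ^ m * ball_norm2 c) * norm x ^ (2 * m)" using M2 by (intro mult_right_mono) auto
    finally show "(norm (mseries c (cvec x)))\<^sup>2 \<le> C * (1 + \<epsilon>) ^ m * norm x ^ (2 * m) * ball_norm2 c"
      by (simp add: mult_ac)
  qed
qed

section \<open>Zonal polyharmonics\<close>

text \<open>Riesz representation, by induction on a finite set of indices outside which all elements
  vanish: the subspace of elements vanishing at one more index has codimension at most one.\<close>

lemma riesz_coeffs:
  fixes ip :: "('i \<Rightarrow> complex) \<Rightarrow> ('i \<Rightarrow> complex) \<Rightarrow> complex" and l :: "('i \<Rightarrow> complex) \<Rightarrow> complex"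
  assumes "finite A" "(\<lambda>_. 0) \<in> V"
    "\<And>c d a. c \<in> V \<Longrightarrow> d \<in> V \<Longrightarrow> (\<lambda>i. c i + a * d i) \<in> V"
    "\<And>c d e a. c \<in> V \<Longrightarrow> d \<in> V \<Longrightarrow> e \<in> V \<Longrightarrow> ip (\<lambda>i. c i + a * d i) e = ip c e + a * ip d e"
    "\<And>c d. c \<in> V \<Longrightarrow> d \<in> V \<Longrightarrow> ip d c = cnj (ip c d)"
    "\<And>c. c \<in> V \<Longrightarrow> ip c c = 0 \<Longrightarrow> c = (\<lambda>_. 0)"
    "\<And>c i. c \<in> V \<Longrightarrow> i \<notin> A \<Longrightarrow> c i = 0"
    "\<And>c d a. c \<in> V \<Longrightarrow> d \<in> V \<Longrightarrow> l (\<lambda>i. c i + a * d i) = l c + a * l d"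
  shows "\<exists>f\<in>V. \<forall>c\<in>V. l c = ip c f"
  using assms
proof (induction A arbitrary: V l rule: finite_induct)
  case empty
  note V = empty.prems
  have "c = (\<lambda>_. 0)" if "c \<in> V" for c using V(6)[OF that] by auto
  moreover have "l (\<lambda>_. 0) = 0" using V(7)[OF V(1) V(1), of 1] by simp
  moreover have "ip (\<lambda>_. 0) (\<lambda>_. 0) = 0" using V(3)[OF V(1) V(1) V(1), of 1] by simp
  ultimately show ?case using V(1) by metis
next
  case (insert i A)
  note V = insert.prems
  show ?case
  proof (cases "\<forall>c\<in>V. c i = 0")
    case True
    show ?thesis
    proof (rule insert.IH)
      show "c j = 0" if "c \<in> V" "j \<notin> A" for c j using V(6)[of c j] True that by (cases "j = i") auto
    qed (((rule V(2) V(3) V(4) V(5) V(7)), assumption+) | rule V(1))+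
  next
    case False
    then obtain v where v: "v \<in> V" "v i \<noteq> 0" by blast
    define V' where "V' = {c \<in> V. c i = 0}"
    have V'V: "V' \<subseteq> V" by (auto simp: V'_def)
    have ex: "\<exists>f\<in>V'. \<forall>c\<in>V'. g c = ip c f"
      if "\<And>c d a. c \<in> V \<Longrightarrow> d \<in> V \<Longrightarrow> g (\<lambda>i. c i + a * d i) = g c + a * g d" for g
    proof (rule insert.IH)
      show "c j = 0" if "c \<in> V'" "j \<notin> A" for c j using V(6)[of c j] that by (cases "j = i") (auto simp: V'_def)
      show "g (\<lambda>i. c i + a * d i) = g c + a * g d" if "c \<in> V'" "d \<in> V'" for c d a
        using \<open>\<And>c d a. c \<in> V \<Longrightarrow> d \<in> V \<Longrightarrow> g (\<lambda>i. c i + a * d i) = g c + a * g d\<close> that V'V by blast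
      show "(\<lambda>_. 0) \<in> V'" using V(1) by (simp add: V'_def)
      show "(\<lambda>i. c i + a * d i) \<in> V'" if "c \<in> V'" "d \<in> V'" for c d a
        using V(2)[of c d a] that by (simp add: V'_def)
      show "ip (\<lambda>i. c i + a * d i) e = ip c e + a * ip d e" if "c \<in> V'" "d \<in> V'" "e \<in> V'" for c d e a
        using V(3)[of c d e a] that by (simp add: V'_def)
      show "ip d c = cnj (ip c d)" if "c \<in> V'" "d \<in> V'" for c d using V(4)[of c d] that by (simp add: V'_def)
      show "c = (\<lambda>_. 0)" if "c \<in> V'" "ip c c = 0" for c using V(5)[of c] that by (simp add: V'_def)
    qed
    have lin2: "ip c (\<lambda>i. d i + a * e i) = ip c d + cnj a * ip c e" if "c \<in> V" "d \<in> V" "e \<in> V" for c d e a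
      using V(4)[OF V(2)[OF that(2,3), of a] that(1)] V(3)[OF that(2,3,1), of a] V(4)[OF that(1,2)] V(4)[OF that(1,3)]
      by simp
    obtain f where f: "f \<in> V'" "\<And>c. c \<in> V' \<Longrightarrow> l c = ip c f" using ex[of l] V(7) by blast
    obtain u where u: "u \<in> V'" "\<And>c. c \<in> V' \<Longrightarrow> ip c v = ip c u" using ex[of "\<lambda>c. ip c v"] V(3)[OF _ _ v(1)] by blast
    \<comment> \<open>A vector spanning the orthogonal complement of the smaller subspace.\<close>
    define w where "w = (\<lambda>j. v j + (- 1) * u j)"
    have wV: "w \<in> V" unfolding w_def using v u V'V V(2) by blast
    have wi: "w i \<noteq> 0" using v u by (simp add: w_def V'_def)
    have orth: "ip c w = 0" if "c \<in> V'" for c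
      unfolding w_def using lin2[of c v u "- 1"] that u v V'V by auto
    have ww: "ip w w \<noteq> 0" using V(5)[OF wV] wi by auto
    have wf: "ip w f = 0" using orth[OF f(1)] V(4)[of f w] f(1) V'V wV by auto
    define \<beta> where "\<beta> = cnj (l w / ip w w)"
    define h where "h = (\<lambda>j. f j + \<beta> * w j)"
    have hV: "h \<in> V" unfolding h_def using f wV V'V V(2) by blast
    have "l c = ip c h" if c: "c \<in> V" for c
    proof -
      define \<mu> where "\<mu> = c i / w i"
      define b where "b = (\<lambda>j. c j + (- \<mu>) * w j)"
      have bV: "b \<in> V'" unfolding V'_def using V(2)[OF c wV, of "- \<mu>"] wi by (simp add: b_def \<mu>_def)
      have bV2: "b \<in> V" using bV V'V by blast
      have cb: "c = (\<lambda>j. b j + \<mu> * w j)" by (simp add: b_def fun_eq_iff)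
      have "l c = l b + \<mu> * l w" by (subst cb) (rule V(7)[OF bV2 wV])
      moreover have "ip c h = ip b h + \<mu> * ip w h" by (subst cb) (rule V(3)[OF bV2 wV hV])
      moreover have "ip b h = ip b f" unfolding h_def using lin2[OF bV2 _ wV, of f \<beta>] f(1) V'V orth[OF bV] by auto
      moreover have "ip w h = l w"
        unfolding h_def using lin2[OF wV _ wV, of f \<beta>] f(1) V'V wf ww by (auto simp: \<beta>_def)
      ultimately show ?thesis using f(2)[OF bV] by simp
    qed
    then show ?thesis using hV by blast
  qed
qed

lemma mseries_lincomb:
  assumes "c \<in> hom_coeffs k" "d \<in> hom_coeffs k"
  shows "(\<lambda>\<alpha>. c \<alpha> + a * d \<alpha>) \<in> hom_coeffs k" "mseries (\<lambda>\<alpha>. c \<alpha> + a * d \<alpha>) z = mseries c z + a * mseries d z"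
proof -
  show *: "(\<lambda>\<alpha>. c \<alpha> + a * d \<alpha>) \<in> hom_coeffs k"
  proof -
    have "int (mdegree \<alpha>) = k" if "c \<alpha> + a * d \<alpha> \<noteq> 0" for \<alpha>
      using that assms unfolding hom_coeffs_def by (cases "c \<alpha> = 0") auto
    then show ?thesis by (simp add: hom_coeffs_def)
  qed
  show "mseries (\<lambda>\<alpha>. c \<alpha> + a * d \<alpha>) z = mseries c z + a * mseries d z"
    unfolding hom_coeffs_eq_sum[OF *] hom_coeffs_eq_sum[OF assms(1)] hom_coeffs_eq_sum[OF assms(2)]
    by (simp add: algebra_simps sum.distrib sum_distrib_left)
qed

lemma mlap_pow_lincomb:
  "(mlap ^^ k) (\<lambda>\<alpha>. c \<alpha> + a * d \<alpha>) = (\<lambda>\<alpha>. (mlap ^^ k) c \<alpha> + a * (mlap ^^ k) d \<alpha>)"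
proof (induction k)
  case (Suc k)
  have "mlap (\<lambda>\<alpha>. c \<alpha> + a * d \<alpha>) = (\<lambda>\<alpha>. mlap c \<alpha> + a * mlap d \<alpha>)" for c d :: "('a \<Rightarrow> nat) \<Rightarrow> complex"
    by (simp add: mlap_def mderiv_def fun_eq_iff algebra_simps sum.distrib sum_distrib_left)
  then show ?case by (simp only: funpow.simps(2) comp_apply[of mlap] Suc)
qed simp

lemma polyharm_coeffs_lincomb:
  "c \<in> polyharm_coeffs p k \<Longrightarrow> d \<in> polyharm_coeffs p k \<Longrightarrow> (\<lambda>\<alpha>. c \<alpha> + a * d \<alpha>) \<in> polyharm_coeffs p k"
  unfolding polyharm_coeffs_def by (auto intro: mseries_lincomb(1) simp: mlap_pow_lincomb)

lemma zero_polyharm_coeffs: "(\<lambda>_. 0) \<in> polyharm_coeffs p k"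
proof -
  have "(mlap ^^ p) (\<lambda>_. 0) = (\<lambda>_ :: 'a \<Rightarrow> nat. 0)"
  proof (induction p)
    case (Suc p)
    have "mlap (\<lambda>_. 0) = (\<lambda>_ :: 'a \<Rightarrow> nat. 0)" by (simp add: mlap_def mderiv_def)
    then show ?case using Suc by simp
  qed simp
  then show ?thesis by (simp add: polyharm_coeffs_def hom_coeffs_def)
qed

lemma ball_inner_integrable:
  fixes c d :: "('n::finite \<Rightarrow> nat) \<Rightarrow> complex"
  assumes "c \<in> hom_coeffs k" "d \<in> hom_coeffs l"
  shows "set_integrable lborel (ball 0 r) (\<lambda>x :: real ^ 'n. mseries c (cvec x) * cnj (mseries d (cvec x)))"
  by (intro set_integrable_ball_continuous continuous_intros hom_coeffs_continuous[OF assms(1)] hom_coeffs_continuous[OF assms(2)])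

lemma ball_inner_lincomb:
  assumes c: "c \<in> hom_coeffs k" and d: "d \<in> hom_coeffs k" and e: "e \<in> hom_coeffs l"
  shows "ball_inner (\<lambda>\<alpha>. c \<alpha> + a * d \<alpha>) e = ball_inner c e + a * ball_inner d e"
  unfolding ball_inner_def mseries_lincomb(2)[OF c d] distrib_right mult.assoc
  using ball_inner_integrable[OF c e] ball_inner_integrable[OF d e] by simp

lemma ball_inner_commute: "ball_inner d c = cnj (ball_inner c d)"
proof -
  have "indicator (ball 0 1) x *\<^sub>R (mseries d (cvec x) * cnj (mseries c (cvec x))) =
      cnj (indicator (ball 0 1) x *\<^sub>R (mseries c (cvec x) * cnj (mseries d (cvec x))))" for x :: "real ^ 'a"
    by (simp add: mult.commute)
  then show ?thesis unfolding ball_inner_def set_lebesgue_integral_def by (simp only: Bochner_Integration.integral_cnj)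
qed

text \<open>The bound on values by the square integral gives definiteness.\<close>

lemma ball_inner_definite:
  assumes c: "c \<in> hom_coeffs (int m)" and z: "ball_inner c c = 0"
  shows "c = (\<lambda>_. 0)"
proof
  fix \<alpha>
  have "ball_norm2 c = 0" using z by (simp add: ball_inner_self)
  moreover obtain C where "C > 0" "\<And>m (c :: ('a \<Rightarrow> nat) \<Rightarrow> complex) (x :: real ^ 'a). c \<in> hom_coeffs (int m) \<Longrightarrow>
      (norm (mseries c (cvec x)))\<^sup>2 \<le> C * (1 + 1) ^ m * norm x ^ (2 * m) * ball_norm2 c"
    using sup_le_ball_norm2[of 1, where 'n='a] by auto
  ultimately have "(norm (mseries c (cvec x)))\<^sup>2 \<le> 0" for x by (metis c mult_zero_right)
  then have "mseries c (cvec x) = 0" for x by simp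
  then show "c \<alpha> = 0" by (intro mseries_unique[OF zero_less_one hom_coeffs_mconv[OF c]])
qed

text \<open>For homogeneous polynomials of degree \<open>m\<close> this is the inner product of the rotated spheres, as
  \<open>sphere_inner_restrict\<close> shows. Written as an integral over the ball it differs from the Bergman
  inner product by the constant that appears in the kernel.\<close>

definition sphere_form :: "nat \<Rightarrow> (('n::finite \<Rightarrow> nat) \<Rightarrow> complex) \<Rightarrow> (('n \<Rightarrow> nat) \<Rightarrow> complex) \<Rightarrow> complex" where
  "sphere_form m c d =
    complex_of_real (real (CARD('n) + 2 * m) / (real CARD('n) * unit_ball_vol (real CARD('n)))) * ball_inner c d"

lemma sphere_const_pos: "real (CARD('n::finite) + 2 * m) / (real CARD('n) * unit_ball_vol (real CARD('n))) > 0"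
  by (intro divide_pos_pos mult_pos_pos unit_ball_vol_pos) (auto simp: add_pos_nonneg)

lemma zonal_coeffs_exist:
  fixes y :: "complex ^ 'n"
  shows "\<exists>k\<in>polyharm_coeffs p (int m). \<forall>c\<in>polyharm_coeffs p (int m). mseries c y = sphere_form m c k"
proof -
  let ?w = "complex_of_real (real (CARD('n) + 2 * m) / (real CARD('n) * unit_ball_vol (real CARD('n))))"
  have w: "?w \<noteq> 0" using sphere_const_pos[where 'n='n, of m] by (metis of_real_eq_0_iff less_irrefl)
  have "\<exists>k\<in>polyharm_coeffs p (int m). \<forall>c\<in>polyharm_coeffs p (int m). mseries c y / ?w = ball_inner c k"
  proof (rule riesz_coeffs[OF finite_mdegree[of m]])
    note h = polyharm_coeffs_hom[of _ p "int m"]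
    show "ball_inner (\<lambda>i. c i + a * d i) e = ball_inner c e + a * ball_inner d e"
      if "c \<in> polyharm_coeffs p (int m)" "d \<in> polyharm_coeffs p (int m)" "e \<in> polyharm_coeffs p (int m)"
      for c d e :: "('n \<Rightarrow> nat) \<Rightarrow> complex" and a
      using ball_inner_lincomb[OF h[OF that(1)] h[OF that(2)] h[OF that(3)]] .
    show "c = (\<lambda>_. 0)" if "c \<in> polyharm_coeffs p (int m)" "ball_inner c c = 0" for c :: "('n \<Rightarrow> nat) \<Rightarrow> complex"
      using ball_inner_definite[OF h[OF that(1)] that(2)] .
    show "c i = 0" if "c \<in> polyharm_coeffs p (int m)" "i \<notin> {\<alpha>. mdegree \<alpha> = m}" for c :: "('n \<Rightarrow> nat) \<Rightarrow> complex" and i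
      using h[OF that(1)] that(2) by (auto simp: hom_coeffs_def)
    show "mseries (\<lambda>i. c i + a * d i) y / ?w = mseries c y / ?w + a * (mseries d y / ?w)"
      if "c \<in> polyharm_coeffs p (int m)" "d \<in> polyharm_coeffs p (int m)" for c d a
      unfolding mseries_lincomb(2)[OF h[OF that(1)] h[OF that(2)]] add_divide_distrib by simp
  qed (auto intro: polyharm_coeffs_lincomb zero_polyharm_coeffs ball_inner_commute)
  then obtain k where k: "k \<in> polyharm_coeffs p (int m)"
    "\<And>c. c \<in> polyharm_coeffs p (int m) \<Longrightarrow> mseries c y / ?w = ball_inner c k" by blast
  have "mseries c y = sphere_form m c k" if "c \<in> polyharm_coeffs p (int m)" for c
    unfolding sphere_form_def k(2)[OF that, symmetric] times_divide_eq_right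
    by (rule nonzero_mult_div_cancel_left[OF w, symmetric])
  then show ?thesis using k(1) by blast
qed

definition zonal_coeffs :: "nat \<Rightarrow> nat \<Rightarrow> complex ^ 'n \<Rightarrow> ('n \<Rightarrow> nat) \<Rightarrow> complex" where
  "zonal_coeffs p m y = (SOME k. k \<in> polyharm_coeffs p (int m) \<and>
     (\<forall>c\<in>polyharm_coeffs p (int m). mseries c y = sphere_form m c k))"

lemma zonal_coeffs: "zonal_coeffs p m y \<in> polyharm_coeffs p (int m)"
  and zonal_coeffs_reproducing: "c \<in> polyharm_coeffs p (int m) \<Longrightarrow> mseries c y = sphere_form m c (zonal_coeffs p m y)"
proof -
  have "zonal_coeffs p m y \<in> polyharm_coeffs p (int m) \<and>
     (\<forall>c\<in>polyharm_coeffs p (int m). mseries c y = sphere_form m c (zonal_coeffs p m y))"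
    unfolding zonal_coeffs_def by (rule someI_ex[OF zonal_coeffs_exist[unfolded Bex_def]])
  then show "zonal_coeffs p m y \<in> polyharm_coeffs p (int m)"
    "c \<in> polyharm_coeffs p (int m) \<Longrightarrow> mseries c y = sphere_form m c (zonal_coeffs p m y)" by auto
qed

lemma zonal_coeffs_unique:
  fixes y :: "complex ^ 'n"
  assumes d: "d \<in> polyharm_coeffs p (int m)"
    and r: "\<And>c. c \<in> polyharm_coeffs p (int m) \<Longrightarrow> mseries c y = sphere_form m c d"
  shows "d = zonal_coeffs p m y"
proof -
  let ?k = "zonal_coeffs p m y"
  have w: "complex_of_real (real (CARD('n) + 2 * m) / (real CARD('n) * unit_ball_vol (real CARD('n)))) \<noteq> 0"
    using sphere_const_pos[where 'n='n, of m] by (metis of_real_eq_0_iff less_irrefl)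
  define e where "e = (\<lambda>\<alpha>. d \<alpha> + (- 1) * ?k \<alpha>)"
  have eP: "e \<in> polyharm_coeffs p (int m)" unfolding e_def by (rule polyharm_coeffs_lincomb[OF d zonal_coeffs])
  have "ball_inner e d = ball_inner e ?k"
    using r[OF eP] zonal_coeffs_reproducing[OF eP, of y] w by (simp add: sphere_form_def)
  then have "ball_inner d e = ball_inner ?k e" by (metis ball_inner_commute)
  moreover have "ball_inner e e = ball_inner d e + (- 1) * ball_inner ?k e"
    by (subst (1) e_def) (rule ball_inner_lincomb[OF polyharm_coeffs_hom[OF d] polyharm_coeffs_hom[OF zonal_coeffs] polyharm_coeffs_hom[OF eP]])
  ultimately have "e = (\<lambda>_. 0)" by (intro ball_inner_definite[OF polyharm_coeffs_hom[OF eP]]) simp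
  then show ?thesis by (simp add: e_def fun_eq_iff)
qed

lemma zonal_coeffs_scale: "zonal_coeffs p m (s *\<^sub>R y) = (\<lambda>\<alpha>. complex_of_real (s ^ m) * zonal_coeffs p m y \<alpha>)"
proof (rule zonal_coeffs_unique[symmetric])
  let ?k = "zonal_coeffs p m y"
  have eq: "(\<lambda>\<alpha>. complex_of_real (s ^ m) * ?k \<alpha>) = (\<lambda>\<alpha>. 0 + complex_of_real (s ^ m) * ?k \<alpha>)" by simp
  show P: "(\<lambda>\<alpha>. complex_of_real (s ^ m) * ?k \<alpha>) \<in> polyharm_coeffs p (int m)"
    unfolding eq by (rule polyharm_coeffs_lincomb[OF zero_polyharm_coeffs zonal_coeffs])
  fix c :: "('a \<Rightarrow> nat) \<Rightarrow> complex" assume c: "c \<in> polyharm_coeffs p (int m)"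
  have z: "ball_inner (\<lambda>_. 0) c = 0"
    by (simp add: ball_inner_def mseries_def set_lebesgue_integral_def)
  have "ball_inner (\<lambda>\<alpha>. complex_of_real (s ^ m) * ?k \<alpha>) c = complex_of_real (s ^ m) * ball_inner ?k c"
    using ball_inner_lincomb[OF polyharm_coeffs_hom[OF zero_polyharm_coeffs] polyharm_coeffs_hom[OF zonal_coeffs] polyharm_coeffs_hom[OF c], where a="complex_of_real (s ^ m)"] z
    by simp
  then have "ball_inner c (\<lambda>\<alpha>. complex_of_real (s ^ m) * ?k \<alpha>) = complex_of_real (s ^ m) * ball_inner c ?k"
    by (subst (1 2) ball_inner_commute) simp
  moreover have "s *\<^sub>R y = complex_of_real s *s y" by (simp add: vec_eq_iff scaleR_conv_of_real[where 'a=complex])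
  ultimately show "mseries c (s *\<^sub>R y) = sphere_form m c (\<lambda>\<alpha>. complex_of_real (s ^ m) * ?k \<alpha>)"
    using zonal_coeffs_reproducing[OF c, of y] mseries_scale[OF polyharm_coeffs_hom[OF c], of "complex_of_real s" y]
    by (simp add: sphere_form_def mult_ac)
qed

lemma rotate_in_hat_sphere: "j < p \<Longrightarrow> norm x = 1 \<Longrightarrow> rotate_vec (real j * pi / real p) x \<in> hat_sphere p"
  unfolding hat_sphere_def by (rule UN_I[of j]) auto

text \<open>The rotations multiply two polynomials of the same degree by the same factor of modulus 1, so all
  summands are equal.\<close>

lemma sphere_inner_restrict:
  fixes c d :: "('n::finite \<Rightarrow> nat) \<Rightarrow> complex"
  assumes p: "p \<ge> 1" and c: "c \<in> hom_coeffs (int m)" and d: "d \<in> hom_coeffs (int m)"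
  shows "sphere_inner p (\<lambda>z. if z \<in> hat_sphere p then mseries c z else 0)
      (\<lambda>z. if z \<in> hat_sphere p then mseries d z else 0) = sphere_form m c d"
proof -
  let ?F = "\<lambda>x :: real ^ 'n. mseries c (cvec x) * cnj (mseries d (cvec x))"
  have "(LINT \<zeta>:sphere 0 1|sphere_measure. \<Sum>j<p.
      (if rotate_vec (real j * pi / real p) \<zeta> \<in> hat_sphere p then mseries c (rotate_vec (real j * pi / real p) \<zeta>) else 0) *
      cnj (if rotate_vec (real j * pi / real p) \<zeta> \<in> hat_sphere p then mseries d (rotate_vec (real j * pi / real p) \<zeta>) else 0)) =
    (LINT \<zeta>:sphere 0 1|sphere_measure. of_nat p * ?F \<zeta>)"
  proof (rule set_lebesgue_integral_cong)
    show "sphere 0 1 \<in> sets (sphere_measure :: (real ^ 'n) measure)" by (simp add: sphere_measure_def)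
    show "\<forall>\<zeta>. \<zeta> \<in> sphere 0 1 \<longrightarrow> (\<Sum>j<p.
      (if rotate_vec (real j * pi / real p) \<zeta> \<in> hat_sphere p then mseries c (rotate_vec (real j * pi / real p) \<zeta>) else 0) *
      cnj (if rotate_vec (real j * pi / real p) \<zeta> \<in> hat_sphere p then mseries d (rotate_vec (real j * pi / real p) \<zeta>) else 0)) =
      of_nat p * ?F \<zeta>"
    proof (intro allI impI)
      fix \<zeta> :: "real ^ 'n" assume "\<zeta> \<in> sphere 0 1"
      then have \<zeta>: "norm \<zeta> = 1" by simp
      have "(\<Sum>j<p. (if rotate_vec (real j * pi / real p) \<zeta> \<in> hat_sphere p then mseries c (rotate_vec (real j * pi / real p) \<zeta>) else 0) *
        cnj (if rotate_vec (real j * pi / real p) \<zeta> \<in> hat_sphere p then mseries d (rotate_vec (real j * pi / real p) \<zeta>) else 0)) =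
        (\<Sum>j<p. ?F \<zeta>)"
      proof (rule sum.cong)
        fix j assume "j \<in> {..<p}"
        then have j: "rotate_vec (real j * pi / real p) \<zeta> \<in> hat_sphere p" using rotate_in_hat_sphere \<zeta> by blast
        have u: "cis t * cnj (cis t) = 1" for t by (simp add: cis_cnj cis_mult)
        have "cis t * a * (cnj (cis t) * b) = a * b" for t a b using u[of t] by (metis mult.assoc mult.commute mult_1)
        then show "(if rotate_vec (real j * pi / real p) \<zeta> \<in> hat_sphere p then mseries c (rotate_vec (real j * pi / real p) \<zeta>) else 0) *
          cnj (if rotate_vec (real j * pi / real p) \<zeta> \<in> hat_sphere p then mseries d (rotate_vec (real j * pi / real p) \<zeta>) else 0) = ?F \<zeta>"
          using j by (simp only: if_True mseries_rotate[OF c] mseries_rotate[OF d] complex_cnj_mult)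
      qed simp
      then show "(\<Sum>j<p. (if rotate_vec (real j * pi / real p) \<zeta> \<in> hat_sphere p then mseries c (rotate_vec (real j * pi / real p) \<zeta>) else 0) *
        cnj (if rotate_vec (real j * pi / real p) \<zeta> \<in> hat_sphere p then mseries d (rotate_vec (real j * pi / real p) \<zeta>) else 0)) =
        of_nat p * ?F \<zeta>" by simp
    qed
  qed
  also have "\<dots> = of_nat p * (LINT \<zeta>:sphere 0 1|sphere_measure. ?F \<zeta>)" by (rule set_integral_mult_right)
  also have "(LINT \<zeta>:sphere 0 1|sphere_measure. ?F \<zeta>) = sphere_form m c d"
  proof -
    have "(LINT \<zeta>:sphere 0 1|sphere_measure. ?F \<zeta>) =
      of_nat (CARD('n) + 2 * m) / complex_of_real (real CARD('n) * unit_ball_vol (real CARD('n))) *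
      (LINT x:ball 0 1|lborel. ?F x)"
    proof (rule sphere_integral_homogeneous)
      show "continuous_on UNIV ?F"
        by (intro continuous_intros hom_coeffs_continuous[OF c] hom_coeffs_continuous[OF d])
      fix s :: real and x :: "real ^ 'n" assume "s > 0"
      have "mseries c (cvec (s *\<^sub>R x)) * cnj (mseries d (cvec (s *\<^sub>R x))) =
          mseries c (cvec (s *\<^sub>R x)) * mseries (cnj \<circ> d) (cvec (s *\<^sub>R x))"
        by (simp add: cnj_mseries(2)[OF d])
      also have "\<dots> = complex_of_real (s ^ (2 * m)) * (mseries c (cvec x) * mseries (cnj \<circ> d) (cvec x))"
      proof -
        have "nat (int m + int m) = 2 * m" by simp
        then show ?thesis using hom_coeffs_scale_product[OF c cnj_mseries(1)[OF d]] by (simp only:)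
      qed
      finally show "?F (s *\<^sub>R x) = complex_of_real (s ^ (2 * m)) * ?F x" by (simp add: cnj_mseries(2)[OF d])
    qed
    then show ?thesis by (simp add: sphere_form_def ball_inner_def)
  qed
  finally show ?thesis using p by (simp add: sphere_inner_def)
qed

lemma polyharmonic_sphere_eq:
  "polyharmonic_sphere p m = (\<lambda>c z. if z \<in> hat_sphere p then mseries c z else 0) ` polyharm_coeffs p (int m)"
  unfolding polyharmonic_sphere_def polyharmonic_poly_eq image_image ..

lemma zonal_sphere_eq:
  fixes \<zeta> \<eta> :: "complex ^ 'n"
  assumes p: "p \<ge> 1" and \<zeta>: "\<zeta> \<in> hat_sphere p" and \<eta>: "\<eta> \<in> hat_sphere p"
  shows "zonal_sphere p m \<zeta> \<eta> = mseries (zonal_coeffs p m \<eta>) \<zeta>"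
proof -
  let ?res = "\<lambda>(c :: ('n \<Rightarrow> nat) \<Rightarrow> complex) z. if z \<in> hat_sphere p then mseries c z else 0"
  let ?k = "zonal_coeffs p m \<eta>"
  have si: "sphere_inner p (?res c) (?res d) = sphere_form m c d"
    if "c \<in> polyharm_coeffs p (int m)" "d \<in> polyharm_coeffs p (int m)" for c d
    by (rule sphere_inner_restrict[OF p polyharm_coeffs_hom[OF that(1)] polyharm_coeffs_hom[OF that(2)]])
  have "(THE f. f \<in> polyharmonic_sphere p m \<and> (\<forall>q\<in>polyharmonic_sphere p m. q \<eta> = sphere_inner p q f)) = ?res ?k"
  proof (rule the_equality)
    show "?res ?k \<in> polyharmonic_sphere p m \<and> (\<forall>q\<in>polyharmonic_sphere p m. q \<eta> = sphere_inner p q (?res ?k))"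
    proof (intro conjI ballI)
      show "?res ?k \<in> polyharmonic_sphere p m" unfolding polyharmonic_sphere_eq using zonal_coeffs by blast
      fix q :: "complex ^ 'n \<Rightarrow> complex" assume "q \<in> polyharmonic_sphere p m"
      then obtain c where c: "c \<in> polyharm_coeffs p (int m)" "q = ?res c" unfolding polyharmonic_sphere_eq by blast
      have "q \<eta> = sphere_form m c ?k" using \<eta> zonal_coeffs_reproducing[OF c(1), of \<eta>] c(2) by simp
      also have "\<dots> = sphere_inner p q (?res ?k)" unfolding c(2) by (rule si[OF c(1) zonal_coeffs, symmetric])
      finally show "q \<eta> = sphere_inner p q (?res ?k)" .
    qed
    fix f assume f: "f \<in> polyharmonic_sphere p m \<and> (\<forall>q\<in>polyharmonic_sphere p m. q \<eta> = sphere_inner p q f)"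
    then obtain d where d: "d \<in> polyharm_coeffs p (int m)" "f = ?res d" unfolding polyharmonic_sphere_eq by blast
    have "d = ?k"
    proof (rule zonal_coeffs_unique[OF d(1)])
      fix c :: "('n \<Rightarrow> nat) \<Rightarrow> complex" assume c: "c \<in> polyharm_coeffs p (int m)"
      then have "?res c \<in> polyharmonic_sphere p m" unfolding polyharmonic_sphere_eq by blast
      from bspec[OF conjunct2[OF f] this] have "?res c \<eta> = sphere_inner p (?res c) f" .
      then show "mseries c \<eta> = sphere_form m c d" using \<eta> si[OF c d(1)] d(2) by simp
    qed
    then show "f = ?res ?k" by (simp only: d(2))
  qed
  then show ?thesis unfolding zonal_sphere_def using \<zeta> by simp
qed

lemma hat_ball_polar:
  fixes x :: "complex ^ 'n"
  assumes p: "p \<ge> 1" and x: "x \<in> hat_ball p"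
  obtains r \<zeta> where "r \<in> {0..<1}" "\<zeta> \<in> hat_sphere p" "x = r *\<^sub>R \<zeta>"
proof -
  obtain k v where k: "k < p" and v: "norm v < 1" and xv: "x = rotate_vec (real k * pi / real p) v"
    using x unfolding hat_ball_def by auto
  obtain u where u: "norm u = 1" "v = norm v *\<^sub>R u"
  proof (cases "v = 0")
    case True
    then show ?thesis using that[of "axis undefined 1"] norm_axis_real[where 'n='n, of undefined 1] by simp
  next
    case False
    then show ?thesis using that[of "v /\<^sub>R norm v"] by simp
  qed
  have "x = norm v *\<^sub>R rotate_vec (real k * pi / real p) u"
    unfolding xv by (subst u(2)) (simp add: rotate_vec_def vec_eq_iff scaleR_conv_of_real[where 'a=complex])
  then show thesis using that[of "norm v"] v rotate_in_hat_sphere[OF k u(1)] by simp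
qed

text \<open>The representation of a point of a rotated ball by a radius and a point of a rotated sphere is not
  unique; the homogeneity of the zonal coefficients in both arguments makes the value independent
  of it.\<close>

lemma zonal_eq:
  fixes x y :: "complex ^ 'n"
  assumes p: "p \<ge> 1" and x: "x \<in> hat_ball p" and y: "y \<in> hat_ball p"
  shows "zonal p m x y = mseries (zonal_coeffs p m y) x"
proof -
  have val: "mseries (zonal_coeffs p m (s *\<^sub>R \<eta>)) (r *\<^sub>R \<zeta>) = complex_of_real (r ^ m * s ^ m) * zonal_sphere p m \<zeta> \<eta>"
    if "\<zeta> \<in> hat_sphere p" "\<eta> \<in> hat_sphere p" for r s \<zeta> and \<eta> :: "complex ^ 'n"
  proof -
    have h: "zonal_coeffs p m \<eta> \<in> hom_coeffs (int m)" by (rule polyharm_coeffs_hom[OF zonal_coeffs])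
    have "mseries (zonal_coeffs p m (s *\<^sub>R \<eta>)) z = complex_of_real (s ^ m) * mseries (zonal_coeffs p m \<eta>) z" for z
      unfolding zonal_coeffs_scale
      using mseries_lincomb(2)[OF polyharm_coeffs_hom[OF zero_polyharm_coeffs] h, of "complex_of_real (s ^ m)" z]
      by (simp add: mseries_def[of "\<lambda>_. 0"])
    moreover have "r *\<^sub>R \<zeta> = complex_of_real r *s \<zeta>" by (simp add: vec_eq_iff scaleR_conv_of_real[where 'a=complex])
    ultimately show ?thesis
      using mseries_scale[OF h, of "complex_of_real r" \<zeta>] zonal_sphere_eq[OF p that] by (simp add: mult_ac)
  qed
  obtain r \<zeta> where r: "r \<in> {0..<1}" "\<zeta> \<in> hat_sphere p" "x = r *\<^sub>R \<zeta>" using hat_ball_polar[OF p x] .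
  obtain s \<eta> where s: "s \<in> {0..<1}" "\<eta> \<in> hat_sphere p" "y = s *\<^sub>R \<eta>" using hat_ball_polar[OF p y] .
  show ?thesis
    unfolding zonal_def
  proof (rule the_equality)
    fix w assume w: "\<forall>r\<in>{0..<1}. \<forall>s\<in>{0..<1}. \<forall>\<zeta>\<in>hat_sphere p. \<forall>\<eta>\<in>hat_sphere p.
        x = r *\<^sub>R \<zeta> \<and> y = s *\<^sub>R \<eta> \<longrightarrow> w = complex_of_real (r ^ m * s ^ m) * zonal_sphere p m \<zeta> \<eta>"
    then have "w = complex_of_real (r ^ m * s ^ m) * zonal_sphere p m \<zeta> \<eta>" using r s by blast
    then show "w = mseries (zonal_coeffs p m y) x" unfolding r(3) s(3) using val r s by simp
  qed (use val in simp)
qed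

text \<open>The value of a zonal polynomial at its own pole is its squared norm. The bound on point evaluations
  therefore bounds first this norm and then all values.\<close>

lemma zonal_coeffs_bound:
  fixes \<epsilon> :: real
  assumes \<epsilon>: "\<epsilon> > 0"
  obtains C where "C > 0"
    "\<And>m (x :: real ^ 'n) (y :: real ^ 'n) \<phi> \<psi>.
      norm (mseries (zonal_coeffs p m (rotate_vec \<psi> y)) (rotate_vec \<phi> x)) \<le> C * (1 + \<epsilon>) ^ m * norm x ^ m * norm y ^ m"
proof -
  define V where "V = unit_ball_vol (real CARD('n))"
  have V: "V > 0" by (simp add: V_def)
  obtain C where C: "C > 0" and B: "\<And>m (c :: ('n \<Rightarrow> nat) \<Rightarrow> complex) (x :: real ^ 'n). c \<in> hom_coeffs (int m) \<Longrightarrow>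
      (norm (mseries c (cvec x)))\<^sup>2 \<le> C * (1 + \<epsilon>) ^ m * norm x ^ (2 * m) * ball_norm2 c"
    using sup_le_ball_norm2[OF \<epsilon>, where 'n='n] by blast
  show thesis
  proof (rule that)
    show "C * V > 0" using C V by simp
    fix m and x y :: "real ^ 'n" and \<phi> \<psi>
    define k where "k = zonal_coeffs p m (rotate_vec \<psi> y)"
    have kP: "k \<in> polyharm_coeffs p (int m)" and kh: "k \<in> hom_coeffs (int m)"
      unfolding k_def using zonal_coeffs polyharm_coeffs_hom by blast+
    have rot: "norm (mseries k (rotate_vec t z)) = norm (mseries k (cvec z))" for t z
      by (simp add: mseries_rotate[OF kh] norm_mult)
    define N where "N = ball_norm2 k"
    have N: "N \<ge> 0" by (simp add: N_def ball_norm2_nonneg)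
    define w where "w = real (CARD('n) + 2 * m) / (real CARD('n) * V)"
    have w: "w > 0" "1 / w \<le> V"
    proof -
      show "w > 0" unfolding w_def V_def by (rule sphere_const_pos)
      have "real CARD('n) * V \<le> real (CARD('n) + 2 * m) * V" using V by (intro mult_right_mono) auto
      then have "real CARD('n) * V / real (CARD('n) + 2 * m) \<le> V"
        by (subst pos_divide_le_eq) (auto simp: mult.commute add_pos_nonneg)
      then show "1 / w \<le> V" by (simp add: w_def)
    qed
    define b where "b = C * (1 + \<epsilon>) ^ m"
    have b: "b > 0" using C \<epsilon> by (simp add: b_def)
    have "mseries k (rotate_vec \<psi> y) = complex_of_real (w * N)"
      using zonal_coeffs_reproducing[OF kP, of "rotate_vec \<psi> y"]
      by (simp add: k_def[symmetric] sphere_form_def ball_inner_self w_def V_def N_def)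
    then have "norm (mseries k (cvec y)) = w * N" using rot[of \<psi> y] w N by (simp only: norm_of_real) simp
    then have "(w * N)\<^sup>2 \<le> b * norm y ^ (2 * m) * N" using B[OF kh, of y] by (simp add: b_def N_def)
    then have "w * w * N * N \<le> b * norm y ^ (2 * m) * N" by (simp add: power2_eq_square mult_ac)
    then have "N = 0 \<or> w * w * N \<le> b * norm y ^ (2 * m)" using N by (cases "N = 0") auto
    then have "w * w * N \<le> b * norm y ^ (2 * m)" using b by auto
    then have "N \<le> (1 / w) * (1 / w) * (b * norm y ^ (2 * m))" using w by (simp add: field_simps)
    also have "\<dots> \<le> V * V * (b * norm y ^ (2 * m))" using w b V by (intro mult_mono mult_right_mono) auto
    finally have NV: "N \<le> V * V * (b * norm y ^ (2 * m))" .
    have "(norm (mseries k (cvec x)))\<^sup>2 \<le> b * norm x ^ (2 * m) * N"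
      using B[OF kh, of x] by (simp only: b_def N_def)
    also have "\<dots> \<le> b * norm x ^ (2 * m) * (V * V * (b * norm y ^ (2 * m)))"
      using b by (intro mult_left_mono[OF NV]) auto
    also have "\<dots> = (C * V * (1 + \<epsilon>) ^ m * norm x ^ m * norm y ^ m)\<^sup>2"
      unfolding b_def mult_2 power_add power2_eq_square by (simp only: mult_ac)
    finally have "norm (mseries k (cvec x)) \<le> C * V * (1 + \<epsilon>) ^ m * norm x ^ m * norm y ^ m"
      by (rule power2_le_imp_le) (use C V \<epsilon> in simp)
    then show "norm (mseries (zonal_coeffs p m (rotate_vec \<psi> y)) (rotate_vec \<phi> x)) \<le> C * V * (1 + \<epsilon>) ^ m * norm x ^ m * norm y ^ m"
      using rot[of \<phi> x] by (simp add: k_def)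
  qed
qed

section \<open>Series of polyharmonic polynomials\<close>

lemma summable_power_mdegree:
  fixes t :: real
  assumes "0 \<le> t" "t < 1"
  shows "(\<lambda>\<alpha> :: 'n::finite \<Rightarrow> nat. t ^ mdegree \<alpha>) summable_on UNIV"
proof -
  have "Infinite_Set_Sum.abs_summable_on (\<lambda>\<alpha> :: 'n \<Rightarrow> nat. \<Prod>i\<in>UNIV. t ^ \<alpha> i) (UNIV \<rightarrow>\<^sub>E UNIV)"
    by (rule Infinite_Set_Sum.abs_summable_on_prod_PiE)
       (use assms in \<open>auto simp: abs_summable_on_nat_iff' power_abs summable_geometric\<close>)
  then have "Infinite_Sum.abs_summable_on (\<lambda>\<alpha> :: 'n \<Rightarrow> nat. \<Prod>i\<in>UNIV. t ^ \<alpha> i) (UNIV \<rightarrow>\<^sub>E UNIV)"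
    by (simp only: abs_summable_equivalent)
  then show ?thesis using assms
    by (simp add: PiE_UNIV_domain power_sum[symmetric] mdegree_def[symmetric] power_abs)
qed

text \<open>Cauchy's estimate with the integral over the torus replaced by an average over roots of unity,
  which is exact for polynomials whose exponents are below the number of roots.\<close>

lemma cauchy_estimate_mseries:
  fixes d :: "('n::finite \<Rightarrow> nat) \<Rightarrow> complex"
  assumes d: "\<And>\<alpha> i. d \<alpha> \<noteq> 0 \<Longrightarrow> \<alpha> i < K" and r: "r \<ge> 0"
    and S: "\<And>h. (\<And>i. norm (h $ i) \<le> r) \<Longrightarrow> norm (mseries d h) \<le> S"
  shows "norm (d \<beta>) * r ^ mdegree \<beta> \<le> S"
proof (cases "d \<beta> = 0")
  case True
  then show ?thesis using S[of 0] r norm_ge_zero[of "mseries d 0"] by (simp del: norm_ge_zero)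
next
  case False
  then have \<beta>: "\<beta> i < K" for i using d by blast
  then have K: "K > 0" by (metis gr_zeroI not_less0)
  define W where "W = (UNIV :: 'n set) \<rightarrow>\<^sub>E {..<K}"
  have fW: "finite W" unfolding W_def by (intro finite_PiE) auto
  have cW: "card W = K ^ CARD('n)" unfolding W_def by (simp add: card_PiE)
  define w where "w j = (\<chi> i. complex_of_real r * cis (2 * pi * real (j i) / real K))" for j :: "'n \<Rightarrow> nat"
  define e where "e j = (\<Prod>i\<in>UNIV. cis (- (2 * pi * real (j i) / real K) * real (\<beta> i)))" for j :: "'n \<Rightarrow> nat"
  have nodes: "monomial \<alpha> (w j) * e j = complex_of_real r ^ mdegree \<alpha> *
      (\<Prod>i\<in>UNIV. cis (real_of_int (int (\<alpha> i) - int (\<beta> i)) * (2 * pi * real (j i) / real K)))" for \<alpha> j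
  proof -
    have "cis (2 * pi * real (j i) / real K) ^ \<alpha> i * cis (- (2 * pi * real (j i) / real K) * real (\<beta> i)) =
        cis (real_of_int (int (\<alpha> i) - int (\<beta> i)) * (2 * pi * real (j i) / real K))" for i
      unfolding Complex.DeMoivre cis_mult using K by (intro arg_cong[where f=cis]) (simp add: field_simps)
    then show ?thesis
      unfolding monomial_def w_def e_def mdegree_def power_sum
      by (simp only: vec_lambda_beta power_mult_distrib prod.distrib[symmetric] mult.assoc)
  qed
  have orth: "(\<Sum>j\<in>W. \<Prod>i\<in>UNIV. cis (real_of_int (int (\<alpha> i) - int (\<beta> i)) * (2 * pi * real (j i) / real K))) =
      (if \<alpha> = \<beta> then of_nat K ^ CARD('n) else 0)" if \<alpha>: "\<And>i. \<alpha> i < K" for \<alpha>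
  proof -
    have "(\<Sum>j\<in>W. \<Prod>i\<in>UNIV. cis (real_of_int (int (\<alpha> i) - int (\<beta> i)) * (2 * pi * real (j i) / real K))) =
        (\<Prod>i\<in>UNIV. \<Sum>k<K. cis (real_of_int (int (\<alpha> i) - int (\<beta> i)) * (2 * pi * real k / real K)))"
      unfolding W_def by (rule prod_sum_PiE[symmetric]) auto
    also have "\<dots> = (if \<alpha> = \<beta> then of_nat K ^ CARD('n) else 0)"
    proof (cases "\<alpha> = \<beta>")
      case False
      then obtain i where i: "\<alpha> i \<noteq> \<beta> i" by auto
      have "\<not> int K dvd int (\<alpha> i) - int (\<beta> i)"
      proof
        assume "int K dvd int (\<alpha> i) - int (\<beta> i)"
        then have "\<bar>int K\<bar> \<le> \<bar>int (\<alpha> i) - int (\<beta> i)\<bar>" using i by (intro dvd_imp_le_int) auto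
        then show False using \<alpha>[of i] \<beta>[of i] by auto
      qed
      from sum_cis_multiples[OF K this] False show ?thesis by (auto intro!: prod_zero bexI[of _ i])
    qed simp
    finally show ?thesis .
  qed
  have ms: "mseries d z = (\<Sum>\<alpha>\<in>W. d \<alpha> * monomial \<alpha> z)" for z
    by (rule mseries_finite[OF fW]) (use d in \<open>auto simp: W_def PiE_UNIV_domain Pi_def\<close>)
  have "(\<Sum>j\<in>W. mseries d (w j) * e j) = (\<Sum>j\<in>W. \<Sum>\<alpha>\<in>W. d \<alpha> * (monomial \<alpha> (w j) * e j))"
    unfolding ms sum_distrib_right by (simp only: mult.assoc)
  also have "\<dots> = (\<Sum>\<alpha>\<in>W. \<Sum>j\<in>W. d \<alpha> * (monomial \<alpha> (w j) * e j))" by (rule sum.swap)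
  also have "\<dots> = (\<Sum>\<alpha>\<in>W. d \<alpha> * (complex_of_real r ^ mdegree \<alpha> *
      (\<Sum>j\<in>W. \<Prod>i\<in>UNIV. cis (real_of_int (int (\<alpha> i) - int (\<beta> i)) * (2 * pi * real (j i) / real K)))))"
    unfolding nodes by (simp only: sum_distrib_left)
  also have "\<dots> = (\<Sum>\<alpha>\<in>W. if \<alpha> = \<beta> then d \<beta> * (complex_of_real r ^ mdegree \<beta> * of_nat K ^ CARD('n)) else 0)"
  proof (rule sum.cong)
    fix \<alpha> assume "\<alpha> \<in> W"
    then have "\<alpha> i < K" for i by (auto simp: W_def)
    from orth[OF this] show "d \<alpha> * (complex_of_real r ^ mdegree \<alpha> *
      (\<Sum>j\<in>W. \<Prod>i\<in>UNIV. cis (real_of_int (int (\<alpha> i) - int (\<beta> i)) * (2 * pi * real (j i) / real K)))) =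
      (if \<alpha> = \<beta> then d \<beta> * (complex_of_real r ^ mdegree \<beta> * of_nat K ^ CARD('n)) else 0)" by simp
  qed simp
  also have "\<dots> = d \<beta> * (complex_of_real r ^ mdegree \<beta> * of_nat K ^ CARD('n))"
    using fW \<beta> by (simp add: W_def PiE_UNIV_domain)
  finally have "norm (d \<beta> * (complex_of_real r ^ mdegree \<beta> * of_nat K ^ CARD('n))) = norm (\<Sum>j\<in>W. mseries d (w j) * e j)" by simp
  also have "\<dots> \<le> (\<Sum>j\<in>W. S)"
  proof (rule sum_norm_le)
    fix j assume "j \<in> W"
    have "norm (e j) = 1" unfolding e_def prod_norm[symmetric] by simp
    moreover have "norm (mseries d (w j)) \<le> S" by (rule S) (use r in \<open>simp add: w_def norm_mult\<close>)
    ultimately show "norm (mseries d (w j) * e j) \<le> S" by (simp add: norm_mult)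
  qed
  finally have "norm (d \<beta>) * r ^ mdegree \<beta> * real K ^ CARD('n) \<le> S * real K ^ CARD('n)"
    using r by (simp add: norm_mult norm_power cW mult_ac)
  then show ?thesis using K by simp
qed

lemma mseries_shift:
  fixes c :: "('n::finite \<Rightarrow> nat) \<Rightarrow> complex"
  assumes c: "c \<in> hom_coeffs (int m)"
  obtains d where "\<And>\<alpha> i. d \<alpha> \<noteq> 0 \<Longrightarrow> \<alpha> i < Suc m" "\<And>h. mseries c (a + h) = mseries d h"
proof
  define W where "W = (UNIV :: 'n set) \<rightarrow>\<^sub>E {..m}"
  have fW: "finite W" unfolding W_def by (intro finite_PiE) auto
  define b where "b \<alpha> \<gamma> = (\<Prod>i\<in>UNIV. of_nat (\<alpha> i choose \<gamma> i) * (a $ i) ^ (\<alpha> i - \<gamma> i))" for \<alpha> \<gamma> :: "'n \<Rightarrow> nat"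
  define d where "d \<gamma> = (if \<gamma> \<in> W then \<Sum>\<alpha> | mdegree \<alpha> = m. c \<alpha> * b \<alpha> \<gamma> else 0)" for \<gamma>
  show "\<alpha> i < Suc m" if "d \<alpha> \<noteq> 0" for \<alpha> i
    using that by (auto simp: d_def W_def less_Suc_eq_le split: if_splits)
  fix h :: "complex ^ 'n"
  have mon: "monomial \<alpha> (a + h) = (\<Sum>\<gamma>\<in>W. b \<alpha> \<gamma> * monomial \<gamma> h)" if \<alpha>: "mdegree \<alpha> = m" for \<alpha>
  proof -
    have "(a $ i + h $ i) ^ \<alpha> i = (\<Sum>k\<le>m. of_nat (\<alpha> i choose k) * (a $ i) ^ (\<alpha> i - k) * (h $ i) ^ k)" for i
    proof -
      have "(a $ i + h $ i) ^ \<alpha> i = (\<Sum>k\<le>\<alpha> i. of_nat (\<alpha> i choose k) * (a $ i) ^ (\<alpha> i - k) * (h $ i) ^ k)"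
        using binomial_ring[of "h $ i" "a $ i" "\<alpha> i"] by (simp add: add.commute mult_ac)
      also have "\<dots> = (\<Sum>k\<le>m. of_nat (\<alpha> i choose k) * (a $ i) ^ (\<alpha> i - k) * (h $ i) ^ k)"
        using le_mdegree[of \<alpha> i] \<alpha> by (intro sum.mono_neutral_left) (auto simp: binomial_eq_0)
      finally show ?thesis .
    qed
    then have "monomial \<alpha> (a + h) = (\<Prod>i\<in>UNIV. \<Sum>k\<le>m. of_nat (\<alpha> i choose k) * (a $ i) ^ (\<alpha> i - k) * (h $ i) ^ k)"
      by (simp add: monomial_def)
    also have "\<dots> = (\<Sum>\<gamma>\<in>W. \<Prod>i\<in>UNIV. of_nat (\<alpha> i choose \<gamma> i) * (a $ i) ^ (\<alpha> i - \<gamma> i) * (h $ i) ^ \<gamma> i)"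
      unfolding W_def by (rule prod_sum_PiE) auto
    finally show ?thesis by (simp add: b_def monomial_def prod.distrib)
  qed
  have "mseries c (a + h) = (\<Sum>\<alpha> | mdegree \<alpha> = m. \<Sum>\<gamma>\<in>W. c \<alpha> * (b \<alpha> \<gamma> * monomial \<gamma> h))"
    unfolding hom_coeffs_eq_sum[OF c] by (simp add: mon sum_distrib_left)
  also have "\<dots> = (\<Sum>\<gamma>\<in>W. \<Sum>\<alpha> | mdegree \<alpha> = m. c \<alpha> * (b \<alpha> \<gamma> * monomial \<gamma> h))" by (rule sum.swap)
  also have "\<dots> = (\<Sum>\<gamma>\<in>W. d \<gamma> * monomial \<gamma> h)"
    by (intro sum.cong) (simp_all add: d_def sum_distrib_right mult.assoc)
  also have "\<dots> = mseries d h" by (rule mseries_finite[OF fW, symmetric]) (simp add: d_def)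
  finally show "mseries c (a + h) = mseries d h" .
qed

text \<open>The Taylor coefficients of the sum at a point are the sums of those of the terms, since Leja's
  lemma and Cauchy's estimates make the double series absolutely convergent. So the Laplacian may be
  applied term by term.\<close>

lemma polyharmonic_series:
  fixes q :: "nat \<Rightarrow> ('n::finite \<Rightarrow> nat) \<Rightarrow> complex"
  assumes q: "\<And>m. q m \<in> polyharm_coeffs p (int m)"
    and b: "\<And>m x. norm (x :: real ^ 'n) = 1 \<Longrightarrow> norm (mseries (q m) (cvec x)) \<le> C * \<kappa> ^ m"
    and \<kappa>: "0 < \<kappa>" "\<kappa> < 1" and C: "C > 0"
  shows "(\<lambda>x. \<Sum>m. mseries (q m) (cvec x)) \<in> polyharmonic_ball p"
proof -
  define u where "u x = (\<Sum>m. mseries (q m) (cvec x))" for x :: "real ^ 'n"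
  have qh: "q m \<in> hom_coeffs (int m)" for m by (rule polyharm_coeffs_hom[OF q])
  \<comment> \<open>Leja's lemma may lose half of the decay: \<open>\<kappa> * \<mu> = sqrt \<kappa>\<close>.\<close>
  define \<mu> where "\<mu> = 1 / sqrt \<kappa>"
  have s1: "\<mu> > 1" using \<kappa> by (simp add: \<mu>_def)
  obtain \<rho> N where \<rho>: "\<rho> > 0" "1 + \<rho> \<le> \<mu>" and N: "N \<ge> 1" and B:
    "\<And>m (c :: ('n \<Rightarrow> nat) \<Rightarrow> complex) a \<zeta>. c \<in> hom_coeffs (int m) \<Longrightarrow>
      (\<And>x. norm x = 1 \<Longrightarrow> norm (mseries c (cvec x)) \<le> 1) \<Longrightarrow> norm (a :: real ^ 'n) \<le> 1 \<Longrightarrow> (\<And>i. norm (\<zeta> $ i) \<le> \<rho>) \<Longrightarrow>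
      norm (mseries c (cvec a + \<zeta>)) \<le> N * \<mu> ^ m"
    using homogeneous_complex_bound[OF s1] by blast
  define \<theta> where "\<theta> = sqrt \<kappa>"
  have \<theta>: "0 < \<theta>" "\<theta> < 1" using \<kappa> by (simp_all add: \<theta>_def)
  have bq: "norm (mseries (q m) (cvec a + \<zeta>)) \<le> C * N * \<theta> ^ m"
    if a: "norm (a :: real ^ 'n) \<le> 1" and \<zeta>: "\<And>i. norm (\<zeta> $ i) \<le> \<rho>" for m a and \<zeta> :: "complex ^ 'n"
  proof -
    define w where "w = C * \<kappa> ^ m"
    have w: "w > 0" using C \<kappa> by (simp add: w_def)
    define d where "d = (\<lambda>\<alpha>. complex_of_real (1 / w) * q m \<alpha>)"
    have d: "d \<in> hom_coeffs (int m)" using qh[of m] by (simp add: hom_coeffs_def d_def)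
    have md: "norm (mseries d z) = norm (mseries (q m) z) / w" for z
    proof -
      have "mseries d z = complex_of_real (1 / w) * mseries (q m) z"
        unfolding hom_coeffs_eq_sum[OF qh] hom_coeffs_eq_sum[OF d] by (simp add: d_def sum_distrib_left mult.assoc)
      then show ?thesis using w by (simp add: norm_divide)
    qed
    have "norm (mseries d (cvec a + \<zeta>)) \<le> N * \<mu> ^ m"
      by (rule B[OF d _ a \<zeta>]) (use b w in \<open>simp add: md w_def\<close>)
    then have "norm (mseries (q m) (cvec a + \<zeta>)) \<le> N * \<mu> ^ m * w" using w by (simp add: md field_simps)
    also have "\<dots> = C * N * (\<kappa> / sqrt \<kappa>) ^ m" by (simp add: w_def \<mu>_def power_divide)
    also have "\<kappa> / sqrt \<kappa> = \<theta>" using \<kappa> by (simp add: \<theta>_def real_div_sqrt)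
    finally show ?thesis .
  qed
  have sumu: "((\<lambda>m. mseries (q m) (cvec x)) has_sum u x) UNIV"
    if a: "norm a \<le> 1" and x: "\<And>i. \<bar>x $ i - a $ i\<bar> \<le> \<rho>" for x a
  proof -
    have ax: "cvec a + cvec (x - a) = cvec x" by (simp add: vec_eq_iff)
    have le: "norm (mseries (q m) (cvec x)) \<le> C * N * \<theta> ^ m" for m
      using bq[OF a, of "cvec (x - a)" m] x unfolding ax by (simp flip: of_real_diff)
    have "summable (\<lambda>m. C * N * \<theta> ^ m)" using \<theta> by (intro summable_mult summable_geometric) simp
    then have s: "summable (\<lambda>m. norm (mseries (q m) (cvec x)))"
      by (rule summable_comparison_test'[where N=0]) (use le in simp)
    have "(\<lambda>m. mseries (q m) (cvec x)) sums u x"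
      unfolding u_def by (rule summable_sums[OF summable_norm_cancel[OF s]])
    with s show ?thesis by (rule norm_summable_imp_has_sum)
  qed
  define R where "R = \<rho> / 2"
  have R: "R > 0" using \<rho> by (simp add: R_def)
  have expansion: "\<exists>c. (\<forall>x\<in>ball a R. ((\<lambda>\<alpha>. c \<alpha> * complex_of_real (monomial \<alpha> (x - a))) has_sum u x) UNIV) \<and>
      (mlap ^^ p) c (\<lambda>_. 0) = 0" if a: "norm a < 1" for a
  proof -
    have "\<exists>d. (\<forall>\<alpha> i. d \<alpha> \<noteq> 0 \<longrightarrow> \<alpha> i < Suc m) \<and> (\<forall>h. mseries (q m) (cvec a + h) = mseries d h)" for m
    proof (rule mseries_shift[OF qh[of m], of "cvec a"])
      fix d assume "\<And>\<alpha> i. d \<alpha> \<noteq> 0 \<Longrightarrow> \<alpha> i < Suc m" "\<And>h. mseries (q m) (cvec a + h) = mseries d h"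
      then show ?thesis by blast
    qed
    then obtain d where d: "\<And>m \<alpha> i. d m \<alpha> \<noteq> 0 \<Longrightarrow> \<alpha> i < Suc m" "\<And>m h. mseries (q m) (cvec a + h) = mseries (d m) h"
      by metis
    have dfin: "finite {\<alpha>. d m \<alpha> \<noteq> 0}" for m
    proof (rule finite_subset)
      show "{\<alpha>. d m \<alpha> \<noteq> 0} \<subseteq> UNIV \<rightarrow>\<^sub>E {..<Suc m}" using d(1) by (auto simp: PiE_UNIV_domain Pi_def)
      show "finite ((UNIV :: 'n set) \<rightarrow>\<^sub>E {..<Suc m})" by (intro finite_PiE) auto
    qed
    have dbound: "norm (d m \<alpha>) * \<rho> ^ mdegree \<alpha> \<le> C * N * \<theta> ^ m" for m \<alpha>
    proof (rule cauchy_estimate_mseries[of "d m" "Suc m"])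
      show "\<alpha> i < Suc m" if "d m \<alpha> \<noteq> 0" for \<alpha> i using d(1) that by blast
      show "norm (mseries (d m) h) \<le> C * N * \<theta> ^ m" if "\<And>i. norm (h $ i) \<le> \<rho>" for h
        unfolding d(2)[symmetric] by (rule bq) (use a that in auto)
    qed (use \<rho> in simp)
    have sm: "(\<lambda>m. C * N * \<theta> ^ m) summable_on UNIV"
      using \<theta> C N by (intro norm_summable_imp_summable_on) (simp add: norm_mult norm_power summable_mult summable_geometric)
    have sa: "(\<lambda>\<alpha> :: 'n \<Rightarrow> nat. (1 / 2 :: real) ^ mdegree \<alpha>) summable_on UNIV" by (rule summable_power_mdegree) auto
    have prod: "(\<lambda>(m, \<alpha>). C * N * \<theta> ^ m * (1 / 2) ^ mdegree (\<alpha> :: 'n \<Rightarrow> nat)) summable_on (UNIV \<times> UNIV)"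
    proof (rule summable_on_SigmaI)
      show "((\<lambda>\<alpha>. case (m, \<alpha>) of (m, \<alpha>) \<Rightarrow> C * N * \<theta> ^ m * (1 / 2) ^ mdegree \<alpha>) has_sum
          C * N * \<theta> ^ m * (\<Sum>\<^sub>\<infinity>\<alpha> :: 'n \<Rightarrow> nat. (1 / 2) ^ mdegree \<alpha>)) (UNIV :: ('n \<Rightarrow> nat) set)" for m
        unfolding prod.case by (intro has_sum_cmult_right has_sum_infsum sa)
      show "(\<lambda>m. C * N * \<theta> ^ m * (\<Sum>\<^sub>\<infinity>\<alpha> :: 'n \<Rightarrow> nat. (1 / 2) ^ mdegree \<alpha>)) summable_on UNIV"
        by (intro summable_on_cmult_left sm)
    qed (use C N \<theta> in auto)
    define c where "c \<alpha> = (\<Sum>\<^sub>\<infinity>m. d m \<alpha>)" for \<alpha>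
    have chs: "((\<lambda>m. d m \<alpha>) has_sum c \<alpha>) UNIV" for \<alpha>
    proof -
      have "(\<lambda>m. norm (d m \<alpha>)) summable_on UNIV"
      proof (rule Infinite_Sum.abs_summable_on_comparison_test')
        show "(\<lambda>m. C * N * \<theta> ^ m * (1 / \<rho> ^ mdegree \<alpha>)) summable_on UNIV" by (intro summable_on_cmult_left sm)
        show "norm (d m \<alpha>) \<le> C * N * \<theta> ^ m * (1 / \<rho> ^ mdegree \<alpha>)" for m
          using dbound[of m \<alpha>] \<rho> by (simp add: field_simps)
      qed
      then show ?thesis unfolding c_def by (intro has_sum_infsum) (simp only: summable_on_iff_abs_summable_on_complex)
    qed
    have main: "((\<lambda>\<alpha>. c \<alpha> * complex_of_real (monomial \<alpha> (x - a))) has_sum u x) UNIV" if x: "x \<in> ball a R" for x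
    proof -
      define h where "h = cvec (x - a)"
      have ah: "cvec a + h = cvec x" by (simp add: h_def vec_eq_iff)
      have hb: "norm (h $ i) \<le> \<rho> / 2" for i
        using x component_le_norm_cart[of "x - a" i] unfolding h_def cvec_nth norm_of_real
        by (simp add: R_def dist_norm norm_minus_commute)
      define f where "f = (\<lambda>(m, \<alpha>). d m \<alpha> * monomial \<alpha> h)"
      have fb: "norm (f (m, \<alpha>)) \<le> C * N * \<theta> ^ m * (1 / 2) ^ mdegree \<alpha>" for m \<alpha>
      proof -
        have "norm (monomial \<alpha> h) \<le> (\<Prod>i\<in>(UNIV::'n set). (\<rho> / 2) ^ \<alpha> i)"
          unfolding norm_monomial using hb by (intro prod_mono conjI power_mono) auto
        also have "\<dots> = (\<rho> / 2) ^ mdegree \<alpha>" by (simp only: mdegree_def power_sum)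
        also have "\<dots> = \<rho> ^ mdegree \<alpha> * (1 / 2) ^ mdegree \<alpha>" by (simp add: power_divide)
        finally have "norm (f (m, \<alpha>)) \<le> norm (d m \<alpha>) * (\<rho> ^ mdegree \<alpha> * (1 / 2) ^ mdegree \<alpha>)"
          unfolding f_def prod.case norm_mult by (rule mult_left_mono) simp
        also have "\<dots> \<le> C * N * \<theta> ^ m * (1 / 2) ^ mdegree \<alpha>"
          unfolding mult.assoc[symmetric] using dbound by (rule mult_right_mono) simp
        finally show ?thesis .
      qed
      have "(\<lambda>x. norm (f x)) summable_on (UNIV \<times> UNIV)"
        by (rule Infinite_Sum.abs_summable_on_comparison_test'[OF prod]) (use fb in auto)
      then have fs: "f summable_on (UNIV \<times> UNIV)" by (simp only: summable_on_iff_abs_summable_on_complex)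
      have lt: "norm (h $ i) < \<rho>" for i using hb[of i] \<rho> by linarith
      have in_m: "((\<lambda>\<alpha>. f (m, \<alpha>)) has_sum mseries (q m) (cvec x)) UNIV" for m
        unfolding f_def prod.case d(2)[of m h, unfolded ah]
        by (rule has_sum_mseries[OF mconv_finite[OF dfin] lt])
      have "(f has_sum u x) (UNIV \<times> UNIV)"
      proof (rule has_sum_SigmaI[OF in_m _ fs])
        show "((\<lambda>m. mseries (q m) (cvec x)) has_sum u x) UNIV"
        proof (rule sumu[of a])
          show "\<bar>x $ i - a $ i\<bar> \<le> \<rho>" for i
            using hb[of i] \<rho> unfolding h_def cvec_nth norm_of_real by simp
        qed (use a in simp)
      qed
      then have "((\<lambda>(\<alpha>, m). f (m, \<alpha>)) has_sum u x) (UNIV \<times> UNIV)"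
        by (subst (asm) has_sum_swap) (simp add: case_prod_unfold)
      then have "((\<lambda>\<alpha>. c \<alpha> * monomial \<alpha> h) has_sum u x) UNIV"
        by (rule has_sum_SigmaD) (auto simp: f_def intro!: has_sum_cmult_left chs)
      then show ?thesis by (simp add: h_def monomial_cvec)
    qed
    have lap0: "(mlap ^^ p) (d m) (\<lambda>_. 0) = 0" for m
    proof -
      let ?u = "\<lambda>x. mseries (q m) (cvec x)"
      have "(laplacian ^^ p) ?u a = mseries ((mlap ^^ p) (q m)) (cvec (a - 0))"
      proof (rule laplacian_pow_mseries[of "ball 0 (norm a + 1)"])
        show "mconv (norm a + 1) (q m)" by (rule hom_coeffs_mconv[OF qh])
        show "(\<forall>j. \<bar>y $ j - 0 $ j\<bar> < norm a + 1) \<and> ?u y = mseries (q m) (cvec (y - 0))" if "y \<in> ball 0 (norm a + 1)" for y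
          using that component_le_norm_cart[of y] by (auto intro: order_le_less_trans)
      qed auto
      also have "\<dots> = 0" using q[of m] by (simp add: polyharm_coeffs_def mseries_def)
      finally have 1: "(laplacian ^^ p) ?u a = 0" .
      have "(laplacian ^^ p) ?u a = mseries ((mlap ^^ p) (d m)) (cvec (a - a))"
      proof (rule laplacian_pow_mseries[of "ball a 1"])
        show "mconv 1 (d m)" by (rule mconv_finite[OF dfin])
        show "(\<forall>j. \<bar>y $ j - a $ j\<bar> < 1) \<and> ?u y = mseries (d m) (cvec (y - a))" if "y \<in> ball a 1" for y
        proof -
          have "cvec a + cvec (y - a) = cvec y" by (simp add: vec_eq_iff)
          then have "?u y = mseries (d m) (cvec (y - a))" using d(2)[of m "cvec (y - a)"] by simp
          moreover have "\<bar>y $ j - a $ j\<bar> < 1" for j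
            using component_le_norm_cart[of "y - a" j] that by (simp add: dist_norm norm_minus_commute)
          ultimately show ?thesis by simp
        qed
      qed auto
      then show ?thesis using 1 by (simp add: mseries_zero)
    qed
    have "((\<lambda>m. (mlap ^^ p) (d m) (\<lambda>_. 0)) has_sum (mlap ^^ p) c (\<lambda>_. 0)) UNIV"
      by (rule mlap_pow_has_sum[OF chs])
    then have "(mlap ^^ p) c (\<lambda>_. 0) = 0" unfolding lap0 using has_sum_0_simp has_sum_unique by blast
    then show ?thesis using main by blast
  qed
  have "real_analytic_on u (ball 0 1)"
    unfolding real_analytic_on_def
  proof
    fix a :: "real ^ 'n" assume "a \<in> ball 0 1"
    then obtain c where "\<forall>x\<in>ball a R. ((\<lambda>\<alpha>. c \<alpha> * complex_of_real (monomial \<alpha> (x - a))) has_sum u x) UNIV"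
      using expansion[of a] by auto
    then show "\<exists>r>0. \<exists>c. \<forall>x\<in>ball a r. ((\<lambda>\<alpha>. c \<alpha> * complex_of_real (monomial \<alpha> (x - a))) has_sum u x) UNIV"
      using R by blast
  qed
  moreover have "(laplacian ^^ p) u a = 0" if "a \<in> ball 0 1" for a
  proof -
    obtain c where c: "\<And>x. x \<in> ball a R \<Longrightarrow> ((\<lambda>\<alpha>. c \<alpha> * complex_of_real (monomial \<alpha> (x - a))) has_sum u x) UNIV"
      and c0: "(mlap ^^ p) c (\<lambda>_. 0) = 0" using expansion[of a] \<open>a \<in> ball 0 1\<close> by (metis mem_ball_0)
    define r where "r = R / real CARD('n)"
    have r: "0 < r" "r \<le> R" using R by (auto simp: r_def field_simps)
    have "(laplacian ^^ p) u a = mseries ((mlap ^^ p) c) (cvec (a - a))"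
    proof (rule laplacian_pow_mseries[of "ball a r"])
      show "mconv r c" unfolding r_def by (rule mconv_of_real_ball[OF c])
      show "(\<forall>j. \<bar>y $ j - a $ j\<bar> < r) \<and> u y = mseries c (cvec (y - a))" if y: "y \<in> ball a r" for y
      proof
        show "\<forall>j. \<bar>y $ j - a $ j\<bar> < r"
          using component_le_norm_cart[of "y - a"] y by (auto simp: dist_norm norm_minus_commute intro: order_le_less_trans)
        have "y \<in> ball a R" using y r by auto
        from infsumI[OF c[OF this]] show "u y = mseries c (cvec (y - a))"
          by (simp add: mseries_def monomial_cvec)
      qed
    qed (use r in auto)
    then show ?thesis using c0 by (simp add: mseries_zero)
  qed
  ultimately show ?thesis unfolding polyharmonic_ball_def u_def by blast
qed

section \<open>The kernel series\<close>

text \<open>The weight is linear in \<open>m\<close> and is absorbed into the exponential.\<close>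

lemma weighted_zonal_bound:
  fixes \<epsilon> :: real
  assumes \<epsilon>: "\<epsilon> > 0"
  obtains C where "C > 0"
    "\<And>m (x :: real ^ 'n) (y :: real ^ 'n) \<phi> \<psi>.
      real (CARD('n) + 2 * m) * norm (mseries (zonal_coeffs p m (rotate_vec \<psi> y)) (rotate_vec \<phi> x)) \<le>
      C * (1 + \<epsilon>) ^ m * norm x ^ m * norm y ^ m"
proof -
  define e where "e = sqrt (1 + \<epsilon>) - 1"
  have e: "e > 0" "(1 + e) * (1 + e) = 1 + \<epsilon>" using \<epsilon> by (simp_all add: e_def)
  obtain C where C: "C > 0" and B: "\<And>m (x :: real ^ 'n) (y :: real ^ 'n) \<phi> \<psi>.
      norm (mseries (zonal_coeffs p m (rotate_vec \<psi> y)) (rotate_vec \<phi> x)) \<le> C * (1 + e) ^ m * norm x ^ m * norm y ^ m"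
    using zonal_coeffs_bound[OF e(1), where 'n='n and p=p] by blast
  define D where "D = real CARD('n) + 2 / e"
  have D: "D > 0" using e by (simp add: D_def add_pos_pos)
  have w: "real (CARD('n) + 2 * m) \<le> D * (1 + e) ^ m" for m
  proof -
    have "1 + real m * e \<le> (1 + e) ^ m" using Bernoulli_inequality[of e m] e by simp
    then have "D * (1 + real m * e) \<le> D * (1 + e) ^ m" using D by (intro mult_left_mono) auto
    moreover have "D * (1 + real m * e) = real CARD('n) + 2 * real m + (2 / e + real CARD('n) * real m * e)"
      using e by (simp add: D_def field_simps)
    moreover have "2 / e + real CARD('n) * real m * e \<ge> 0" using e by simp
    ultimately show ?thesis by simp
  qed
  show thesis
  proof (rule that)
    show "D * C > 0" using C D by simp
    fix m and x y :: "real ^ 'n" and \<phi> \<psi>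
    have "real (CARD('n) + 2 * m) * norm (mseries (zonal_coeffs p m (rotate_vec \<psi> y)) (rotate_vec \<phi> x)) \<le>
        (D * (1 + e) ^ m) * (C * (1 + e) ^ m * norm x ^ m * norm y ^ m)"
      using D e by (intro mult_mono[OF w B]) auto
    also have "\<dots> = D * C * (1 + \<epsilon>) ^ m * norm x ^ m * norm y ^ m"
      unfolding e(2)[symmetric] power_mult_distrib by (simp only: mult_ac)
    finally show "real (CARD('n) + 2 * m) * norm (mseries (zonal_coeffs p m (rotate_vec \<psi> y)) (rotate_vec \<phi> x)) \<le>
      D * C * (1 + \<epsilon>) ^ m * norm x ^ m * norm y ^ m" .
  qed
qed

lemma hat_ballE:
  assumes "x \<in> hat_ball p"
  obtains k v where "k < p" "norm v < 1" "x = rotate_vec (real k * pi / real p) v"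
  using assms unfolding hat_ball_def by auto

lemma rotate_in_hat_ball: "k < p \<Longrightarrow> norm v < 1 \<Longrightarrow> rotate_vec (real k * pi / real p) v \<in> hat_ball p"
  unfolding hat_ball_def by (rule UN_I[of k]) auto

lemma norm_rotate_vec [simp]: "norm (rotate_vec \<psi> v) = norm v"
  by (simp add: norm_vec_def rotate_vec_def norm_mult)

lemma cvec_eq_rotate: "cvec x = rotate_vec 0 x"
  by (simp add: rotate_vec_def)

lemma hat_ball_norm_less: "x \<in> hat_ball p \<Longrightarrow> norm x < 1"
  by (metis hat_ballE norm_rotate_vec)

lemma mseries_cmult:
  assumes "c \<in> hom_coeffs k"
  shows "mseries (\<lambda>\<alpha>. a * c \<alpha>) z = a * mseries c z"
proof -
  have "(\<lambda>\<alpha>. a * c \<alpha>) \<in> hom_coeffs k" using assms by (simp add: hom_coeffs_def)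
  from hom_coeffs_eq_sum[OF this] show ?thesis
    unfolding hom_coeffs_eq_sum[OF assms] by (simp add: sum_distrib_left mult.assoc)
qed

lemma polyharm_coeffs_cmult: "c \<in> polyharm_coeffs p k \<Longrightarrow> (\<lambda>\<alpha>. a * c \<alpha>) \<in> polyharm_coeffs p k"
  using polyharm_coeffs_lincomb[OF zero_polyharm_coeffs, of c p k a] by simp

lemma set_nn_integral_ball_bounded:
  fixes f :: "real ^ 'n \<Rightarrow> real"
  assumes "\<And>x. x \<in> ball 0 1 \<Longrightarrow> f x \<le> B"
  shows "(\<integral>\<^sup>+x\<in>ball 0 1. ennreal (f x) \<partial>lborel) < \<infinity>"
proof -
  have "(\<integral>\<^sup>+x\<in>ball 0 1. ennreal (f x) \<partial>lborel) \<le> (\<integral>\<^sup>+x\<in>(ball 0 1 :: (real ^ 'n) set). ennreal B \<partial>lborel)"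
    by (rule nn_integral_mono) (use assms in \<open>auto simp: indicator_def intro: ennreal_leI\<close>)
  also have "\<dots> = ennreal B * emeasure lborel (ball 0 1 :: (real ^ 'n) set)"
    by (rule nn_integral_cmult_indicator) simp
  also have "\<dots> < \<infinity>" using emeasure_lborel_ball_finite[of "0 :: real ^ 'n" 1]
    by (simp add: ennreal_mult_less_top)
  finally show ?thesis .
qed

text \<open>The surface area of the unit sphere.\<close>

definition kernel_const :: "'n itself \<Rightarrow> real" where
  "kernel_const _ = real CARD('n) * unit_ball_vol (real CARD('n))"

lemma kernel_const_pos: "kernel_const TYPE('n::finite) > 0"
  unfolding kernel_const_def by (intro mult_pos_pos unit_ball_vol_pos) auto

definition zonal_kernel :: "nat \<Rightarrow> complex ^ 'n \<Rightarrow> complex ^ 'n \<Rightarrow> complex" where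
  "zonal_kernel p x y = (if x \<in> hat_ball p \<and> y \<in> hat_ball p then
     1 / complex_of_real (kernel_const TYPE('n)) * (\<Sum>m. of_nat (CARD('n) + 2 * m) * zonal p m x y) else 0)"

definition kernel_coeffs :: "nat \<Rightarrow> complex ^ 'n \<Rightarrow> nat \<Rightarrow> ('n \<Rightarrow> nat) \<Rightarrow> complex" where
  "kernel_coeffs p y m = (\<lambda>\<alpha>. complex_of_real (real (CARD('n) + 2 * m) / kernel_const TYPE('n)) * zonal_coeffs p m y \<alpha>)"

lemma kernel_coeffs: "kernel_coeffs p y m \<in> polyharm_coeffs p (int m)"
  unfolding kernel_coeffs_def by (intro polyharm_coeffs_cmult zonal_coeffs)

lemma kernel_coeffs_hom: "kernel_coeffs p y m \<in> hom_coeffs (int m)"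
  by (rule polyharm_coeffs_hom[OF kernel_coeffs])

lemma mseries_kernel_coeffs:
  "mseries (kernel_coeffs p (y :: complex ^ 'n) m) z =
    1 / complex_of_real (kernel_const TYPE('n)) * (of_nat (CARD('n) + 2 * m) * mseries (zonal_coeffs p m y) z)"
  unfolding kernel_coeffs_def mseries_cmult[OF polyharm_coeffs_hom[OF zonal_coeffs]] by simp

lemma geometric_room:
  fixes t :: real
  assumes t: "0 \<le> t" "t < 1"
  obtains \<epsilon> where "\<epsilon> > 0" "(1 + \<epsilon>) * t < 1"
proof
  show "(1 - t) / 2 > 0" using t by simp
  have "(1 - t) / 2 * t \<le> (1 - t) / 2 * 1" using t by (intro mult_left_mono) auto
  then have "(1 + (1 - t) / 2) * t \<le> (1 - t) / 2 + t" by (simp add: algebra_simps)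
  also have "\<dots> < 1" using t by (simp add: field_simps)
  finally show "(1 + (1 - t) / 2) * t < 1" .
qed

lemma kernel_coeffs_bound:
  fixes y :: "complex ^ 'n"
  assumes y: "y \<in> hat_ball p"
  obtains C \<kappa> where "C > 0" "0 < \<kappa>" "\<kappa> < 1"
    "\<And>m x \<phi>. norm x \<le> 1 \<Longrightarrow> norm (mseries (kernel_coeffs p y m) (rotate_vec \<phi> x)) \<le> C * \<kappa> ^ m"
proof -
  obtain k v where v: "norm v < 1" and yv: "y = rotate_vec (real k * pi / real p) v" using hat_ballE[OF y] by metis
  define t where "t = norm v"
  have t: "0 \<le> t" "t < 1" using v by (auto simp: t_def)
  obtain \<epsilon> where \<epsilon>: "\<epsilon> > 0" and et: "(1 + \<epsilon>) * t < 1" using geometric_room[OF t] by blast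
  define X where "X = (1 + \<epsilon>) * t"
  have X: "0 \<le> X" "X < 1" using t \<epsilon> et by (simp_all add: X_def)
  define \<kappa> where "\<kappa> = (X + 1) / 2"
  have \<kappa>: "0 < \<kappa>" "\<kappa> < 1" "X \<le> \<kappa>" using X by (simp_all add: \<kappa>_def)
  obtain C where C: "C > 0" and B: "\<And>m (x :: real ^ 'n) (y :: real ^ 'n) \<phi> \<psi>.
      real (CARD('n) + 2 * m) * norm (mseries (zonal_coeffs p m (rotate_vec \<psi> y)) (rotate_vec \<phi> x)) \<le>
      C * (1 + \<epsilon>) ^ m * norm x ^ m * norm y ^ m"
    using weighted_zonal_bound[OF \<epsilon>, where 'n='n and p=p] by blast
  show thesis
  proof (rule that[OF _ \<kappa>(1,2)])
    show "C / kernel_const TYPE('n) > 0" using C kernel_const_pos[where 'n='n] by simp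
    fix m and x :: "real ^ 'n" and \<phi> assume x: "norm x \<le> 1"
    have "real (CARD('n) + 2 * m) * norm (mseries (zonal_coeffs p m y) (rotate_vec \<phi> x)) \<le> C * (1 + \<epsilon>) ^ m * norm x ^ m * t ^ m"
      unfolding yv t_def by (rule B)
    also have "\<dots> \<le> C * (1 + \<epsilon>) ^ m * 1 * t ^ m"
      using C \<epsilon> t x by (intro mult_right_mono mult_left_mono power_le_one) auto
    also have "\<dots> = C * X ^ m" by (simp add: X_def power_mult_distrib)
    also have "\<dots> \<le> C * \<kappa> ^ m" using C \<kappa> X by (intro mult_left_mono power_mono) auto
    finally have "real (CARD('n) + 2 * m) * norm (mseries (zonal_coeffs p m y) (rotate_vec \<phi> x)) / kernel_const TYPE('n) \<le>
        C * \<kappa> ^ m / kernel_const TYPE('n)"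
      using kernel_const_pos[where 'n='n] by (intro divide_right_mono) auto
    moreover have "norm (mseries (kernel_coeffs p y m) (rotate_vec \<phi> x)) =
        real (CARD('n) + 2 * m) * norm (mseries (zonal_coeffs p m y) (rotate_vec \<phi> x)) / kernel_const TYPE('n)"
    proof -
      have "norm (1 / complex_of_real (kernel_const TYPE('n))) = 1 / kernel_const TYPE('n)"
        using kernel_const_pos[where 'n='n] by (simp add: norm_divide)
      then show ?thesis unfolding mseries_kernel_coeffs norm_mult norm_of_nat by simp
    qed
    ultimately show "norm (mseries (kernel_coeffs p y m) (rotate_vec \<phi> x)) \<le> C / kernel_const TYPE('n) * \<kappa> ^ m" by simp
  qed
qed

lemma kernel_coeffs_sums:
  fixes x y :: "complex ^ 'n"
  assumes p: "p \<ge> 1" and x: "x \<in> hat_ball p" and y: "y \<in> hat_ball p"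
  shows "summable (\<lambda>m. norm (mseries (kernel_coeffs p y m) x))"
    and "(\<lambda>m. mseries (kernel_coeffs p y m) x) sums zonal_kernel p x y"
proof -
  obtain C \<kappa> where \<kappa>: "0 < \<kappa>" "\<kappa> < 1" and B:
    "\<And>m x \<phi>. norm x \<le> 1 \<Longrightarrow> norm (mseries (kernel_coeffs p y m) (rotate_vec \<phi> x)) \<le> C * \<kappa> ^ m"
    using kernel_coeffs_bound[OF y] by metis
  obtain k v where v: "norm v < 1" and xv: "x = rotate_vec (real k * pi / real p) v" using hat_ballE[OF x] by metis
  have le: "norm (mseries (kernel_coeffs p y m) x) \<le> C * \<kappa> ^ m" for m unfolding xv by (rule B) (use v in simp)
  have "summable (\<lambda>m. C * \<kappa> ^ m)" using \<kappa> by (intro summable_mult summable_geometric) simp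
  then show s: "summable (\<lambda>m. norm (mseries (kernel_coeffs p y m) x))"
    by (rule summable_comparison_test'[where N=0]) (use le in simp)
  let ?k = "complex_of_real (kernel_const TYPE('n))"
  have k0: "?k \<noteq> 0" using kernel_const_pos[where 'n='n] by simp
  have sc: "summable (\<lambda>m. mseries (kernel_coeffs p y m) x)" by (rule summable_norm_cancel[OF s])
  have eq: "of_nat (CARD('n) + 2 * m) * zonal p m x y = ?k * mseries (kernel_coeffs p y m) x" for m
    unfolding mseries_kernel_coeffs zonal_eq[OF p x y] using k0 by simp
  have "zonal_kernel p x y = 1 / ?k * (\<Sum>m. ?k * mseries (kernel_coeffs p y m) x)"
    using x y unfolding zonal_kernel_def eq by simp
  also have "\<dots> = (\<Sum>m. mseries (kernel_coeffs p y m) x)" using suminf_mult[OF sc, of ?k] k0 by simp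
  finally show "(\<lambda>m. mseries (kernel_coeffs p y m) x) sums zonal_kernel p x y"
    using summable_sums[OF sc] by simp
qed

text \<open>With one argument fixed inside the domain the series converges geometrically up to the boundary in
  the other one; so the sum is polyharmonic and bounded.\<close>

lemma zonal_kernel_in_bergman_space:
  fixes y :: "complex ^ 'n"
  assumes p: "p \<ge> 1" and y: "y \<in> hat_ball p"
  shows "(\<lambda>x. zonal_kernel p x y) \<in> bergman_space p"
proof -
  obtain C \<kappa> where C: "C > 0" and \<kappa>: "0 < \<kappa>" "\<kappa> < 1" and B:
    "\<And>m x \<phi>. norm x \<le> 1 \<Longrightarrow> norm (mseries (kernel_coeffs p y m) (rotate_vec \<phi> x)) \<le> C * \<kappa> ^ m"
    using kernel_coeffs_bound[OF y] by metis
  define u where "u x = (\<Sum>m. mseries (kernel_coeffs p y m) (cvec x))" for x :: "real ^ 'n"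
  have B0: "norm (mseries (kernel_coeffs p y m) (cvec x)) \<le> C * \<kappa> ^ m" if "norm x = 1" for m and x :: "real ^ 'n"
    unfolding cvec_eq_rotate using that by (intro B) simp
  have "u \<in> polyharmonic_ball p"
    unfolding u_def[abs_def] by (rule polyharmonic_series[OF kernel_coeffs B0 \<kappa> C])
  moreover have "extends_to_hat_ball p u (\<lambda>x. zonal_kernel p x y)"
    unfolding extends_to_hat_ball_def
  proof (intro conjI allI impI exI[of _ "\<lambda>m x. mseries (kernel_coeffs p y m) (cvec x)"] ballI)
    show "zonal_kernel p z y = 0" if "z \<notin> hat_ball p" for z using that by (simp add: zonal_kernel_def)
    show "(\<lambda>x. mseries (kernel_coeffs p y m) (cvec x)) \<in> real_homogeneous_poly m" for m
      unfolding real_homogeneous_poly_iff using kernel_coeffs_hom by blast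
    show "(\<lambda>m. mseries (kernel_coeffs p y m) (cvec x)) sums u x" if "x \<in> ball 0 1" for x :: "real ^ 'n"
    proof -
      have "rotate_vec (real 0 * pi / real p) x \<in> hat_ball p" using p that by (intro rotate_in_hat_ball) auto
      then have "cvec x \<in> hat_ball p" by (simp add: cvec_eq_rotate)
      from kernel_coeffs_sums(2)[OF p this y] show ?thesis unfolding u_def by (metis sums_summable summable_sums)
    qed
    show "(\<lambda>m. cis (real m * \<psi>) * mseries (kernel_coeffs p y m) (cvec x)) sums zonal_kernel p (rotate_vec \<psi> x) y"
      if "rotate_vec \<psi> x \<in> hat_ball p" for \<psi> and x :: "real ^ 'n"
      using kernel_coeffs_sums(2)[OF p that y] unfolding mseries_rotate[OF kernel_coeffs_hom] .
  qed
  moreover have "ennreal (1 / real p) * (\<Sum>k<p. \<integral>\<^sup>+v\<in>ball 0 1.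
      ennreal ((cmod (zonal_kernel p (rotate_vec (real k * pi / real p) v) y))\<^sup>2) \<partial>lborel) < \<infinity>"
  proof -
    have K: "norm (zonal_kernel p x y) \<le> (\<Sum>m. C * \<kappa> ^ m)" if x: "x \<in> hat_ball p" for x
    proof -
      obtain k v where v: "norm v < 1" and xv: "x = rotate_vec (real k * pi / real p) v" using hat_ballE[OF x] by metis
      have "norm (\<Sum>m. mseries (kernel_coeffs p y m) x) \<le> (\<Sum>m. norm (mseries (kernel_coeffs p y m) x))"
        by (rule summable_norm[OF kernel_coeffs_sums(1)[OF p x y]])
      also have "\<dots> \<le> (\<Sum>m. C * \<kappa> ^ m)"
        using \<kappa> v by (intro suminf_le kernel_coeffs_sums(1)[OF p x y] summable_mult summable_geometric)
          (auto simp: xv intro!: B)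
      finally show ?thesis using kernel_coeffs_sums(2)[OF p x y] by (simp add: sums_iff)
    qed
    have "(\<integral>\<^sup>+v\<in>ball 0 1. ennreal ((cmod (zonal_kernel p (rotate_vec (real k * pi / real p) v) y))\<^sup>2) \<partial>lborel) < \<infinity>"
      if "k < p" for k
      by (rule set_nn_integral_ball_bounded[where B="(\<Sum>m. C * \<kappa> ^ m)\<^sup>2"])
         (use K rotate_in_hat_ball[OF that] in \<open>auto intro!: power_mono\<close>)
    then show ?thesis by (auto simp: ennreal_mult_less_top)
  qed
  ultimately show ?thesis unfolding bergman_space_def by blast
qed

section \<open>Homogeneous expansions\<close>

lemma power_series_real_unique:
  fixes a b :: "nat \<Rightarrow> complex"
  assumes "\<And>t::real. \<bar>t\<bar> \<le> 1 \<Longrightarrow> (\<lambda>m. complex_of_real t ^ m * a m) sums f t"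
    and "\<And>t::real. \<bar>t\<bar> \<le> 1 \<Longrightarrow> (\<lambda>m. complex_of_real t ^ m * b m) sums f t"
  shows "a m = b m"
proof (rule ccontr)
  assume ne: "a m \<noteq> b m"
  define c where "c m = a m - b m" for m
  have s: "(\<lambda>m. c m * complex_of_real t ^ m) sums 0" if "\<bar>t\<bar> \<le> 1" for t
    using sums_diff[OF assms[OF that]] by (simp add: c_def algebra_simps)
  have c0: "c 0 = 0"
  proof (rule sums_unique2)
    show "(\<lambda>m. c m * complex_of_real 0 ^ m) sums c 0" unfolding of_real_0 by (rule powser_sums_zero)
    show "(\<lambda>m. c m * complex_of_real 0 ^ m) sums 0" by (rule s) simp
  qed
  have sm: "summable (\<lambda>m. c m * z ^ m)" if "norm z < 1" for z
    by (rule powser_inside[where x=1]) (use s[of 1] that in \<open>auto simp: sums_iff\<close>)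
  define F where "F z = (\<Sum>m. c m * z ^ m)" for z
  have m0: "m > 0" using ne c0 by (cases m) (auto simp: c_def)
  have cm: "c m \<noteq> 0" using ne by (simp add: c_def)
  have F0: "F 0 = 0" using s[of 0] by (simp add: F_def sums_iff)
  obtain r where r: "r > 0" "\<And>z. z \<in> cball 0 r - {0} \<Longrightarrow> F z \<noteq> 0"
  proof (rule powser_0_nonzero[where r=1 and a=c and \<xi>=0 and f=F and m=m])
    show "(\<lambda>n. c n * (x - 0) ^ n) sums F x" if "norm (x - 0) < 1" for x
      using sm[of x] that by (simp add: F_def sums_iff)
  qed (use F0 cm m0 in auto)
  define t where "t = min r 1"
  have t: "0 < t" "t \<le> r" "t \<le> 1" using r by (auto simp: t_def)
  have "F (complex_of_real t) = 0" using s[of t] t by (simp add: F_def sums_iff)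
  then show False using r(2)[of "complex_of_real t"] t by auto
qed

definition degree_part :: "nat \<Rightarrow> (('n::finite \<Rightarrow> nat) \<Rightarrow> complex) \<Rightarrow> ('n \<Rightarrow> nat) \<Rightarrow> complex" where
  "degree_part m c = (\<lambda>\<alpha>. if mdegree \<alpha> = m then c \<alpha> else 0)"

lemma degree_part_hom: "degree_part m c \<in> hom_coeffs (int m)"
  by (simp add: hom_coeffs_def degree_part_def)

lemma mlap_pow_degree_part:
  "(mlap ^^ k) (degree_part m c) \<beta> = (if mdegree \<beta> + 2 * k = m then (mlap ^^ k) c \<beta> else 0)"
proof (induction k arbitrary: \<beta>)
  case (Suc k)
  let ?h = "\<lambda>\<beta>. if mdegree \<beta> + 2 * k = m then (mlap ^^ k) c \<beta> else 0"
  have md: "mdegree (\<beta>(i := Suc (Suc (\<beta> i)))) = Suc (Suc (mdegree \<beta>))" for i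
    using mdegree_upd[of "\<beta>(i := Suc (\<beta> i))" i] mdegree_upd[of \<beta> i] by simp
  have "mderiv i (mderiv i ?h) \<beta> = (if mdegree \<beta> + 2 * Suc k = m then mderiv i (mderiv i ((mlap ^^ k) c)) \<beta> else 0)" for i
    unfolding mderiv_def fun_upd_same fun_upd_upd md by simp
  then have "mlap ?h \<beta> = (if mdegree \<beta> + 2 * Suc k = m then mlap ((mlap ^^ k) c) \<beta> else 0)"
    by (simp add: mlap_def)
  moreover have "(mlap ^^ k) (degree_part m c) = ?h" using Suc.IH by (rule ext)
  ultimately show ?case by (simp only: funpow.simps(2) comp_apply)
qed (simp add: degree_part_def)

lemma sums_degree_part:
  assumes "((\<lambda>\<alpha>. c \<alpha> * monomial \<alpha> z) has_sum S) UNIV"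
  shows "(\<lambda>m. mseries (degree_part m c) z) sums S"
proof -
  have inj: "inj_on snd (SIGMA m:UNIV. {\<alpha> :: 'a \<Rightarrow> nat. mdegree \<alpha> = m})" by (auto simp: inj_on_def)
  have img: "snd ` (SIGMA m:UNIV. {\<alpha> :: 'a \<Rightarrow> nat. mdegree \<alpha> = m}) = UNIV" by force
  have "(((\<lambda>\<alpha>. c \<alpha> * monomial \<alpha> z) \<circ> snd) has_sum S) (SIGMA m:UNIV. {\<alpha>. mdegree \<alpha> = m})"
    using assms unfolding has_sum_reindex[OF inj, symmetric] img .
  then have "((\<lambda>m. mseries (degree_part m c) z) has_sum S) UNIV"
  proof (rule has_sum_SigmaD)
    fix m
    show "((\<lambda>\<alpha>. ((\<lambda>\<alpha>. c \<alpha> * monomial \<alpha> z) \<circ> snd) (m, \<alpha>)) has_sum mseries (degree_part m c) z) {\<alpha>. mdegree \<alpha> = m}"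
      using hom_coeffs_eq_sum[OF degree_part_hom[of m c], of z] finite_mdegree[of m]
      by (intro has_sum_finiteI) (auto simp: degree_part_def)
  qed
  then show ?thesis by (rule has_sum_imp_sums)
qed

text \<open>The terms of the homogeneous expansion are the homogeneous parts of the Taylor series at the
  origin, and the Laplacian maps homogeneous parts to homogeneous parts.\<close>

lemma expansion_polyharm_coeffs:
  fixes u :: "real ^ 'n \<Rightarrow> complex"
  assumes u: "u \<in> polyharmonic_ball p" and q: "\<And>m. q m \<in> hom_coeffs (int m)"
    and s: "\<And>x. x \<in> ball 0 1 \<Longrightarrow> (\<lambda>m. mseries (q m) (cvec x)) sums u x"
  shows "q m \<in> polyharm_coeffs p (int m)"
proof -
  obtain r0 c where r0: "r0 > 0" and c0: "\<And>x. x \<in> ball 0 r0 \<Longrightarrow> ((\<lambda>\<alpha>. c \<alpha> * complex_of_real (monomial \<alpha> (x - 0))) has_sum u x) UNIV"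
  proof -
    have "(0 :: real ^ 'n) \<in> ball 0 1" by simp
    moreover have "real_analytic_on u (ball 0 1)" using u by (simp add: polyharmonic_ball_def)
    ultimately show ?thesis using that unfolding real_analytic_on_def by blast
  qed
  define r where "r = min r0 1 / real CARD('n)"
  have "min r0 1 / real CARD('n) \<le> min r0 1 / 1" using r0 by (intro divide_left_mono) auto
  with r0 have r: "r > 0" "r \<le> min r0 1" by (simp_all add: r_def)
  have c1: "((\<lambda>\<alpha>. c \<alpha> * complex_of_real (monomial \<alpha> (x - 0))) has_sum u x) UNIV" if "x \<in> ball 0 (min r0 1)" for x
    using c0[of x] that by auto
  have conv: "mconv r c" unfolding r_def by (rule mconv_of_real_ball[OF c1])
  have box: "x \<in> ball 0 r" if "\<And>i. \<bar>x $ i\<bar> < r / real CARD('n)" for x :: "real ^ 'n"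
  proof -
    have "norm x \<le> (\<Sum>i\<in>UNIV. \<bar>x $ i\<bar>)" by (rule norm_le_l1_cart)
    also have "\<dots> < (\<Sum>i\<in>(UNIV::'n set). r / real CARD('n))" using that by (intro sum_strict_mono) auto
    finally show ?thesis by simp
  qed
  have lap: "mseries ((mlap ^^ p) c) (cvec x) = 0" if x: "x \<in> ball 0 r" for x
  proof -
    have "(laplacian ^^ p) u x = mseries ((mlap ^^ p) c) (cvec (x - 0))"
    proof (rule laplacian_pow_mseries[of "ball 0 r", OF _ conv _ x])
      show "(\<forall>j. \<bar>y $ j - 0 $ j\<bar> < r) \<and> u y = mseries c (cvec (y - 0))" if y: "y \<in> ball 0 r" for y
      proof
        show "\<forall>j. \<bar>y $ j - 0 $ j\<bar> < r"
          using component_le_norm_cart[of y] y by (auto intro: order_le_less_trans)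
        have "y \<in> ball 0 (min r0 1)" using y r by auto
        from infsumI[OF c1[OF this]] show "u y = mseries c (cvec (y - 0))"
          by (simp add: mseries_def monomial_cvec)
      qed
    qed simp
    moreover have "(laplacian ^^ p) u x = 0" using u x r unfolding polyharmonic_ball_def by auto
    ultimately show ?thesis by simp
  qed
  have z: "(mlap ^^ p) c \<alpha> = 0" for \<alpha>
  proof (rule mseries_unique)
    show "r / real CARD('n) > 0" using r by simp
    show "mconv (r / real CARD('n)) ((mlap ^^ p) c)"
      by (rule mconv_mono[OF mconv_mlap_pow[OF conv]]) (use r in \<open>simp add: field_simps\<close>)
  qed (rule lap[OF box])
  have e: "q m = degree_part m c"
  proof (rule mseries_real_unique)
    show "r / real CARD('n) > 0" using r by simp
    show "mconv (r / real CARD('n)) (q m)" "mconv (r / real CARD('n)) (degree_part m c)"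
      by (rule hom_coeffs_mconv[OF q], rule hom_coeffs_mconv[OF degree_part_hom])
    fix x :: "real ^ 'n" assume "\<And>i. \<bar>x $ i\<bar> < r / real CARD('n)"
    then have x: "x \<in> ball 0 r" by (rule box)
    show "mseries (q m) (cvec x) = mseries (degree_part m c) (cvec x)"
    proof (rule power_series_real_unique)
      fix t :: real assume t: "\<bar>t\<bar> \<le> 1"
      have "\<bar>t\<bar> * norm x \<le> norm x" using t by (intro mult_left_le_one_le) auto
      then have tx: "t *\<^sub>R x \<in> ball 0 1" "t *\<^sub>R x \<in> ball 0 (min r0 1)" using x r by auto
      show "(\<lambda>m. complex_of_real t ^ m * mseries (q m) (cvec x)) sums u (t *\<^sub>R x)"
        using s[OF tx(1)] unfolding cvec_scaleR mseries_scale[OF q] .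
      have "(\<lambda>m. mseries (degree_part m c) (cvec (t *\<^sub>R x))) sums u (t *\<^sub>R x)"
        by (rule sums_degree_part) (use c1[OF tx(2)] in \<open>simp add: monomial_cvec\<close>)
      then show "(\<lambda>m. complex_of_real t ^ m * mseries (degree_part m c) (cvec x)) sums u (t *\<^sub>R x)"
        unfolding cvec_scaleR mseries_scale[OF degree_part_hom] .
    qed
  qed
  show ?thesis
    unfolding e using degree_part_hom[of m c] z by (simp add: polyharm_coeffs_def mlap_pow_degree_part fun_eq_iff)
qed

text \<open>Pointwise convergence on the open ball already forces geometric decay on smaller balls: this
  is where Leja's lemma is used with a family that is bounded only pointwise.\<close>

lemma pointwise_bounded_imp_geometric:
  fixes q :: "nat \<Rightarrow> ('n::finite \<Rightarrow> nat) \<Rightarrow> complex"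
  assumes q: "\<And>m. q m \<in> hom_coeffs (int m)"
    and pb: "\<And>x :: real ^ 'n. norm x < 1 \<Longrightarrow> \<exists>N. \<forall>m. norm (mseries (q m) (cvec x)) \<le> N"
    and r: "0 < r" "r < 1"
  obtains N \<theta> where "0 < N" "0 < \<theta>" "\<theta> < 1" "\<And>m x. norm x \<le> r \<Longrightarrow> norm (mseries (q m) (cvec (x :: real ^ 'n))) \<le> N * \<theta> ^ m"
proof -
  let ?n = "real CARD('n)"
  define R where "R = (1 + r) / 2"
  have R: "r < R" "R < 1" "0 < R" using r by (auto simp: R_def)
  define \<epsilon> where "\<epsilon> = (R / r - 1) / 2"
  have \<epsilon>: "\<epsilon> > 0" using R r by (simp add: \<epsilon>_def)
  define \<theta> where "\<theta> = (1 + \<epsilon>) * (r / R)"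
  have \<theta>: "0 < \<theta>" "\<theta> < 1"
  proof -
    show "0 < \<theta>" using \<epsilon> r R by (simp add: \<theta>_def)
    have "\<theta> = (1 + r / R) / 2" using r R by (simp add: \<theta>_def \<epsilon>_def field_simps)
    also have "\<dots> < 1" using r R by simp
    finally show "\<theta> < 1" .
  qed
  obtain \<rho> where \<rho>: "\<rho> > 0" and L: "\<And>F :: (nat \<times> (complex ^ 'n \<Rightarrow> complex)) set. (\<And>m Q. (m, Q) \<in> F \<Longrightarrow> separately_poly m Q) \<Longrightarrow>
       (\<And>x. (\<And>i. \<bar>x $ i\<bar> \<le> 1) \<Longrightarrow> \<exists>N. \<forall>(m, Q)\<in>F. norm (Q (cvec x)) \<le> N) \<Longrightarrow>
       \<exists>N. \<forall>(m, Q)\<in>F. \<forall>z. (\<forall>i. norm (z $ i) \<le> \<rho>) \<longrightarrow> norm (Q z) \<le> N * (1 + \<epsilon>) ^ m"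
    using leja_separately[OF \<epsilon>, where 'n='n] by blast
  define s where "s = (1 - R) / (2 * ?n)"
  have s: "s > 0" "s * ?n < 1 - R" using R by (auto simp: s_def)
  \<comment> \<open>The polynomials are bounded pointwise on a cube around each point of norm at most \<open>R\<close>.\<close>
  have loc: "\<exists>N. \<forall>m. \<forall>x\<in>ball a (s * \<rho>). norm (mseries (q m) (cvec x)) \<le> N * (1 + \<epsilon>) ^ m" if a: "norm a \<le> R" for a :: "real ^ 'n"
  proof -
    define F where "F = range (\<lambda>m. (m, \<lambda>z. mseries (q m) (cvec a + complex_of_real s *s z)))"
    have "\<exists>N. \<forall>(m, Q)\<in>F. \<forall>z. (\<forall>i. norm (z $ i) \<le> \<rho>) \<longrightarrow> norm (Q z) \<le> N * (1 + \<epsilon>) ^ m"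
    proof (rule L)
      show "separately_poly m Q" if "(m, Q) \<in> F" for m Q
        using that unfolding F_def by (auto intro!: separately_poly_mseries q)
      fix x :: "real ^ 'n" assume x: "\<And>i. \<bar>x $ i\<bar> \<le> 1"
      have nx: "norm x \<le> ?n" using norm_le_l1_cart[of x] sum_mono[of UNIV "\<lambda>i. \<bar>x $ i\<bar>" "\<lambda>_. 1"] x by simp
      have e: "cvec a + complex_of_real s *s cvec x = cvec (a + s *\<^sub>R x)" by (simp add: vec_eq_iff)
      have "norm (a + s *\<^sub>R x) \<le> norm a + s * norm x" using norm_triangle_ineq[of a "s *\<^sub>R x"] s by simp
      also have "\<dots> \<le> R + s * ?n" using a nx s by (intro add_mono mult_left_mono) auto
      also have "\<dots> < 1" using s by simp
      finally obtain N where "\<forall>m. norm (mseries (q m) (cvec (a + s *\<^sub>R x))) \<le> N" using pb by blast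
      then show "\<exists>N. \<forall>(m, Q)\<in>F. norm (Q (cvec x)) \<le> N"
        unfolding F_def by (intro exI[of _ N]) (auto simp: e)
    qed
    then obtain N where N: "\<And>m z. (\<And>i. norm (z $ i) \<le> \<rho>) \<Longrightarrow> norm (mseries (q m) (cvec a + complex_of_real s *s z)) \<le> N * (1 + \<epsilon>) ^ m"
      unfolding F_def by auto
    have "norm (mseries (q m) (cvec x)) \<le> N * (1 + \<epsilon>) ^ m" if x: "x \<in> ball a (s * \<rho>)" for m x
    proof -
      define z where "z = cvec ((1 / s) *\<^sub>R (x - a))"
      have "norm (z $ i) \<le> \<rho>" for i
      proof -
        have "\<bar>(x - a) $ i\<bar> \<le> s * \<rho>" using component_le_norm_cart[of "x - a" i] x by (simp add: dist_norm norm_minus_commute)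
        then have "\<bar>((1 / s) *\<^sub>R (x - a)) $ i\<bar> \<le> \<rho>" using s by (simp add: abs_mult field_simps)
        then show ?thesis unfolding z_def cvec_nth norm_of_real .
      qed
      moreover have "cvec a + complex_of_real s *s z = cvec x" using s by (simp add: z_def vec_eq_iff)
      ultimately show ?thesis using N[of z m] by simp
    qed
    then show ?thesis by blast
  qed
  then obtain N where N: "\<And>a m x. norm a \<le> R \<Longrightarrow> x \<in> ball a (s * \<rho>) \<Longrightarrow> norm (mseries (q m) (cvec (x :: real ^ 'n))) \<le> N a * (1 + \<epsilon>) ^ m"
    by metis
  have cov: "cball (0 :: real ^ 'n) R \<subseteq> (\<Union>a\<in>cball 0 R. ball a (s * \<rho>))" using s \<rho> by force
  obtain T where T: "T \<subseteq> cball (0 :: real ^ 'n) R" "finite T" "cball 0 R \<subseteq> (\<Union>a\<in>T. ball a (s * \<rho>))"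
    using compactE_image[OF compact_cball _ cov] by auto
  define M where "M = 1 + (\<Sum>a\<in>T. \<bar>N a\<bar>)"
  have M: "M > 0" by (simp add: M_def add_pos_nonneg sum_nonneg)
  have MR: "norm (mseries (q m) (cvec x)) \<le> M * (1 + \<epsilon>) ^ m" if xR: "norm x \<le> R" for m and x :: "real ^ 'n"
  proof -
    have "x \<in> (\<Union>a\<in>T. ball a (s * \<rho>))" using T(3) xR by (auto simp del: mem_ball)
    then obtain a where a: "a \<in> T" "x \<in> ball a (s * \<rho>)" by blast
    have "N a \<le> \<bar>N a\<bar>" by simp
    also have "\<dots> \<le> (\<Sum>a\<in>T. \<bar>N a\<bar>)" using a T(2) by (intro member_le_sum) auto
    finally have "N a \<le> M" by (simp add: M_def)
    then have "N a * (1 + \<epsilon>) ^ m \<le> M * (1 + \<epsilon>) ^ m" using \<epsilon> by (intro mult_right_mono) auto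
    moreover have "norm a \<le> R" using a T(1) by auto
    ultimately show ?thesis using N[OF _ a(2), of m] by linarith
  qed
  show thesis
  proof (rule that[OF M \<theta>])
    fix m and x :: "real ^ 'n" assume x: "norm x \<le> r"
    have "norm ((R / r) *\<^sub>R x) \<le> R" using x r R by (simp add: field_simps)
    then have 1: "norm (mseries (q m) (cvec ((R / r) *\<^sub>R x))) \<le> M * (1 + \<epsilon>) ^ m" by (rule MR)
    have "x = (r / R) *\<^sub>R ((R / r) *\<^sub>R x)" using r R by simp
    then have "mseries (q m) (cvec x) = complex_of_real (r / R) ^ m * mseries (q m) (cvec ((R / r) *\<^sub>R x))"
      by (metis cvec_scaleR mseries_scale[OF q])
    then have "norm (mseries (q m) (cvec x)) = norm (complex_of_real (r / R)) ^ m * norm (mseries (q m) (cvec ((R / r) *\<^sub>R x)))"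
      by (simp only: norm_mult norm_power)
    also have "norm (complex_of_real (r / R)) = r / R" unfolding norm_of_real using r R by simp
    also have "(r / R) ^ m * norm (mseries (q m) (cvec ((R / r) *\<^sub>R x))) \<le> (r / R) ^ m * (M * (1 + \<epsilon>) ^ m)"
      using r R by (intro mult_left_mono[OF 1]) auto
    also have "\<dots> = M * \<theta> ^ m" unfolding \<theta>_def power_mult_distrib by (simp only: mult_ac)
    finally show "norm (mseries (q m) (cvec x)) \<le> M * \<theta> ^ m" .
  qed
qed

section \<open>The reproducing property\<close>

lemma integrable_indicator_ball: "integrable lborel (indicator (ball (a :: real ^ 'n) r) :: real ^ 'n \<Rightarrow> real)"
  by (rule integrable_real_indicator) (simp, rule emeasure_bounded_finite, rule bounded_ball)

lemma set_integral_sums: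
  fixes f :: "nat \<Rightarrow> 'b \<Rightarrow> complex" and w :: "'b \<Rightarrow> real"
  assumes f: "\<And>m. set_borel_measurable M A (f m)" and w: "set_integrable M A w" and K: "summable K"
    and b: "\<And>m x. x \<in> A \<Longrightarrow> norm (f m x) \<le> K m * w x"
    and g: "\<And>x. x \<in> A \<Longrightarrow> (\<lambda>m. f m x) sums g x"
  shows "(\<lambda>m. LINT x:A|M. f m x) sums (LINT x:A|M. g x)"
proof -
  let ?f = "\<lambda>m x. indicator A x *\<^sub>R f m x" and ?w = "\<lambda>x. indicator A x *\<^sub>R w x"
  have iw: "integrable M ?w" using w by (simp add: set_integrable_def)
  have fm: "?f m \<in> borel_measurable M" for m using f[of m] by (simp add: set_borel_measurable_def)
  have b': "norm (?f m x) \<le> K m * ?w x" for m x using b[of x m] by (auto simp: indicator_def)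
  have iK: "integrable M (\<lambda>x. K m * ?w x)" for m using iw by (rule integrable_mult_right)
  have i: "integrable M (?f m)" for m
  proof (rule Bochner_Integration.integrable_bound[OF iK[of m] fm], rule AE_I2)
    show "norm (?f m x) \<le> norm (K m * ?w x)" for x using b'[of x m] by (smt (verit) real_norm_def)
  qed
  have "(\<lambda>m. integral\<^sup>L M (?f m)) sums (\<integral>x. (\<Sum>m. ?f m x) \<partial>M)"
  proof (rule sums_integral[OF i])
    show "AE x in M. summable (\<lambda>m. norm (?f m x))"
    proof (rule AE_I2)
      show "summable (\<lambda>m. norm (?f m x))" for x
      proof (rule summable_comparison_test')
        show "summable (\<lambda>m. K m * ?w x)" by (intro summable_mult2 K)
      next
        fix m :: nat assume "0 \<le> m"
        show "norm (norm (?f m x)) \<le> K m * ?w x" using b'[of x m] by simp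
      qed
    qed
    show "summable (\<lambda>m. \<integral>x. norm (?f m x) \<partial>M)"
    proof (rule summable_comparison_test')
      show "summable (\<lambda>m. K m * (\<integral>x. ?w x \<partial>M))" by (intro summable_mult2 K)
    next
      fix m :: nat assume "0 \<le> m"
      have "(\<integral>x. norm (?f m x) \<partial>M) \<le> (\<integral>x. K m * ?w x \<partial>M)"
        using b'[of _ m] by (intro integral_mono integrable_norm i iK) blast
      then show "norm (\<integral>x. norm (?f m x) \<partial>M) \<le> K m * (\<integral>x. ?w x \<partial>M)"
        unfolding integral_mult_right_zero by simp
    qed
  qed
  also have "(\<integral>x. (\<Sum>m. ?f m x) \<partial>M) = (\<integral>x. indicator A x *\<^sub>R g x \<partial>M)"
  proof (rule Bochner_Integration.integral_cong[OF refl])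
    show "(\<Sum>m. ?f m x) = indicator A x *\<^sub>R g x" for x
      using g[of x] by (cases "x \<in> A") (auto simp: sums_iff)
  qed
  finally show ?thesis unfolding set_lebesgue_integral_def .
qed

text \<open>The rotations separate the degrees that orthogonality of harmonic functions does not: if two
  distinct degrees differ by an even number that is not a multiple of \<open>2p\<close>, the sum over the rotations
  vanishes, and otherwise no harmonic component of one term has the degree of a component of the
  other.\<close>

lemma rotation_orthogonality:
  assumes p: "p \<ge> 1" and c: "c \<in> polyharm_coeffs p (int m)" and d: "d \<in> polyharm_coeffs p (int l)"
  shows "(\<Sum>k<p. cis (- (real l * (real k * pi / real p))) * cis (real m * (real k * pi / real p))) * ball_inner c d =
    (if m = l then of_nat p * ball_inner c d else 0)"
proof -
  have e: "(\<Sum>k<p. cis (- (real l * (real k * pi / real p))) * cis (real m * (real k * pi / real p))) =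
      (\<Sum>k<p. cis (real_of_int (int m - int l) * (real k * pi / real p)))"
    by (intro sum.cong refl) (simp add: cis_mult algebra_simps diff_divide_distrib)
  consider "m = l" | "m \<noteq> l" "ball_inner c d = 0" | h where "int m - int l = 2 * h" "\<not> int p dvd h"
  proof (cases "\<exists>h. int m - int l = 2 * h \<and> \<not> int p dvd h")
    case True then show thesis using that(3) by blast
  next
    case False
    show thesis
    proof (cases "m = l")
      case True then show thesis using that(1) by blast
    next
      case ml: False
      have "ball_inner c d = 0"
      proof (rule ball_inner_orthogonal[OF c d], rule notI)
        fix i j assume ij: "i < p" "j < p" and eq: "int m - 2 * int i = int l - 2 * int j"
        then have h: "int m - int l = 2 * (int i - int j)" by simp
        with False have dv: "int p dvd int i - int j" by blast
        have "int i - int j \<noteq> 0" using h ml by auto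
        with dv have "int p \<le> \<bar>int i - int j\<bar>" by (metis dvd_imp_le_int abs_of_nat)
        with ij show False by linarith
      qed
      with ml show thesis using that(2) by blast
    qed
  qed
  then show ?thesis
  proof cases
    case 1 then show ?thesis by (simp add: cis_mult)
  next
    case 2 then show ?thesis by simp
  next
    case 3
    have "(\<Sum>k<p. cis (real_of_int h * (2 * pi * real k / real p))) = 0"
      using p 3 by (intro sum_cis_multiples) auto
    moreover have "real_of_int (int m - int l) * (real k * pi / real p) = real_of_int h * (2 * pi * real k / real p)" for k
      unfolding 3(1) by simp
    ultimately have "(\<Sum>k<p. cis (real_of_int (int m - int l) * (real k * pi / real p))) = 0"
      by (simp only:)
    moreover have "m \<noteq> l" using 3 by auto
    ultimately show ?thesis unfolding e by simp
  qed
qed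

lemma ball_inner_scale:
  fixes c d :: "('n::finite \<Rightarrow> nat) \<Rightarrow> complex"
  assumes c: "c \<in> hom_coeffs (int m)" and d: "d \<in> hom_coeffs (int l)" and s: "s > 0"
  shows "(LINT x:ball 0 s|lborel. mseries c (cvec (x :: real ^ 'n)) * cnj (mseries d (cvec x))) =
    complex_of_real (s ^ (CARD('n) + m + l)) * ball_inner c d"
proof -
  have "(LINT x:ball 0 s|lborel. mseries c (cvec (x :: real ^ 'n)) * cnj (mseries d (cvec x))) =
      complex_of_real (s ^ CARD('n) * s ^ (m + l)) * (LINT x:ball 0 1|lborel. mseries c (cvec (x :: real ^ 'n)) * cnj (mseries d (cvec x)))"
  proof (rule integral_ball_scale[OF _ s])
    show "(\<lambda>x :: real ^ 'n. mseries c (cvec x) * cnj (mseries d (cvec x))) \<in> borel_measurable borel"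
      by (intro borel_measurable_continuous_onI continuous_intros hom_coeffs_continuous[OF c] hom_coeffs_continuous[OF d])
    show "mseries c (cvec (s *\<^sub>R x)) * cnj (mseries d (cvec (s *\<^sub>R x))) =
        complex_of_real (s ^ (m + l)) * (mseries c (cvec x) * cnj (mseries d (cvec x)))" for x :: "real ^ 'n"
      unfolding cvec_scaleR mseries_scale[OF c] mseries_scale[OF d] by (simp add: power_add)
  qed
  then show ?thesis by (simp add: ball_inner_def power_add mult.assoc)
qed

text \<open>Averaged over the rotations, the pairing of a polyharmonic series with a homogeneous
  polyharmonic polynomial of degree \<open>l\<close> sees only the term of degree \<open>l\<close>. On smaller balls the
  series converges geometrically and may be integrated termwise; the unit ball is exhausted by
  these.\<close>

lemma bergman_projection:
  fixes U :: "nat \<Rightarrow> real ^ 'n \<Rightarrow> complex" and q :: "nat \<Rightarrow> ('n \<Rightarrow> nat) \<Rightarrow> complex"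
  assumes p: "p \<ge> 1" and q: "\<And>m. q m \<in> polyharm_coeffs p (int m)" and d: "d \<in> polyharm_coeffs p (int l)"
    and U: "\<And>k x. k < p \<Longrightarrow> x \<in> ball 0 1 \<Longrightarrow> (\<lambda>m. cis (real m * (real k * pi / real p)) * mseries (q m) (cvec x)) sums U k x"
    and int: "\<And>k. k < p \<Longrightarrow> set_integrable lborel (ball 0 1) (U k)"
  shows "(\<Sum>k<p. cis (- (real l * (real k * pi / real p))) * (LINT x:ball 0 1|lborel. U k x * cnj (mseries d (cvec x)))) =
    of_nat p * ball_inner (q l) d"
proof -
  let ?D = "\<lambda>x :: real ^ 'n. cnj (mseries d (cvec x))"
  have qh: "q m \<in> hom_coeffs (int m)" for m by (rule polyharm_coeffs_hom[OF q])
  have dh: "d \<in> hom_coeffs (int l)" by (rule polyharm_coeffs_hom[OF d])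
  have cD: "continuous_on A ?D" for A by (intro continuous_intros hom_coeffs_continuous[OF dh])
  have cQ: "continuous_on A (\<lambda>x :: real ^ 'n. mseries (q m) (cvec x))" for A m
    by (rule hom_coeffs_continuous[OF qh])
  have pb: "\<exists>N. \<forall>m. norm (mseries (q m) (cvec x)) \<le> N" if "norm x < 1" for x :: "real ^ 'n"
  proof -
    have "(\<lambda>m. mseries (q m) (cvec x)) sums U 0 x" using U[of 0 x] p that by simp
    then have "Bseq (\<lambda>m. mseries (q m) (cvec x))" by (intro summable_imp_Bseq) (rule sums_summable)
    then show ?thesis unfolding Bseq_def by blast
  qed
  obtain Bd where Bd: "\<And>x :: real ^ 'n. x \<in> cball 0 1 \<Longrightarrow> norm (?D x) \<le> Bd"
    using compact_imp_bounded[OF compact_continuous_image[OF cD compact_cball]] unfolding bounded_iff by blast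
  have J: "(\<Sum>k<p. cis (- (real l * (real k * pi / real p))) * (LINT x:ball 0 s|lborel. U k x * ?D x)) =
      of_nat p * (complex_of_real (s ^ (CARD('n) + l + l)) * ball_inner (q l) d)" if s: "0 < s" "s < 1" for s
  proof -
    obtain N \<theta> where N: "N > 0" "0 < \<theta>" "\<theta> < 1" "\<And>m x. norm x \<le> s \<Longrightarrow> norm (mseries (q m) (cvec (x :: real ^ 'n))) \<le> N * \<theta> ^ m"
      using pointwise_bounded_imp_geometric[OF qh pb s] by blast
    let ?f = "\<lambda>k m (x :: real ^ 'n). cis (real m * (real k * pi / real p)) * (mseries (q m) (cvec x) * ?D x)"
    have J1: "(\<lambda>m. LINT x:ball 0 s|lborel. ?f k m x) sums (LINT x:ball 0 s|lborel. U k x * ?D x)" if k: "k < p" for k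
    proof (rule set_integral_sums)
      show "set_borel_measurable lborel (ball 0 s) (?f k m)" for m
      proof -
        have "continuous_on UNIV (?f k m)" by (intro continuous_intros cQ cD)
        from set_integrable_ball_continuous[OF this, of 0 s] show ?thesis
          unfolding set_integrable_def set_borel_measurable_def by (rule borel_measurable_integrable)
      qed
      show "set_integrable lborel (ball (0 :: real ^ 'n) s) (\<lambda>_. Bd)"
        unfolding set_integrable_def
        by (intro integrable_scaleR_left integrable_indicator_ball)
      show "summable (\<lambda>m. N * \<theta> ^ m)" using N by (intro summable_mult summable_geometric) simp
      fix x :: "real ^ 'n" assume x: "x \<in> ball 0 s"
      show "norm (?f k m x) \<le> N * \<theta> ^ m * Bd" for m
        unfolding norm_mult norm_cis mult_1 using x s N Bd[of x] by (intro mult_mono N(4)) (auto simp: norm_mult)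
      have "x \<in> ball 0 1" using x s by simp
      from sums_mult2[OF U[OF k this], of "?D x"] show "(\<lambda>m. ?f k m x) sums (U k x * ?D x)"
        by (simp only: mult.assoc)
    qed
    have J2: "(LINT x:ball 0 s|lborel. ?f k m x) =
        cis (real m * (real k * pi / real p)) * (complex_of_real (s ^ (CARD('n) + m + l)) * ball_inner (q m) d)" for k m
      unfolding set_integral_mult_right ball_inner_scale[OF qh dh s(1)] ..
    have "(\<lambda>m. \<Sum>k<p. cis (- (real l * (real k * pi / real p))) * (LINT x:ball 0 s|lborel. ?f k m x)) sums
        (\<Sum>k<p. cis (- (real l * (real k * pi / real p))) * (LINT x:ball 0 s|lborel. U k x * ?D x))"
      by (intro sums_sum sums_mult J1) simp
    moreover have "(\<Sum>k<p. cis (- (real l * (real k * pi / real p))) * (LINT x:ball 0 s|lborel. ?f k m x)) =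
        (if m = l then of_nat p * (complex_of_real (s ^ (CARD('n) + l + l)) * ball_inner (q l) d) else 0)" for m
    proof -
      have "(\<Sum>k<p. cis (- (real l * (real k * pi / real p))) * (LINT x:ball 0 s|lborel. ?f k m x)) =
          complex_of_real (s ^ (CARD('n) + m + l)) *
          ((\<Sum>k<p. cis (- (real l * (real k * pi / real p))) * cis (real m * (real k * pi / real p))) * ball_inner (q m) d)"
        unfolding J2 sum_distrib_left sum_distrib_right by (intro sum.cong refl) (simp only: mult_ac)
      then show ?thesis unfolding rotation_orthogonality[OF p q d] by (simp add: mult_ac)
    qed
    ultimately have "(\<lambda>m. if m = l then of_nat p * (complex_of_real (s ^ (CARD('n) + l + l)) * ball_inner (q l) d) else 0) sums
        (\<Sum>k<p. cis (- (real l * (real k * pi / real p))) * (LINT x:ball 0 s|lborel. U k x * ?D x))"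
      by (simp only:)
    then show ?thesis using sums_single[of l "\<lambda>_. of_nat p * (complex_of_real (s ^ (CARD('n) + l + l)) * ball_inner (q l) d)"]
      by (rule sums_unique2)
  qed
  define s where "s j = 1 - 1 / real (j + 2)" for j
  have s: "0 < s j" "s j < 1" for j by (simp_all add: s_def)
  have sl: "s \<longlonglongrightarrow> 1" unfolding s_def[abs_def]
    using tendsto_diff[OF tendsto_const[of 1] LIMSEQ_ignore_initial_segment[OF lim_1_over_n, of 2]] by simp
  have mono: "incseq (\<lambda>j. ball (0 :: real ^ 'n) (s j))"
    by (intro incseq_SucI subset_ball) (simp add: s_def field_simps)
  have un: "(\<Union>j. ball (0 :: real ^ 'n) (s j)) = ball 0 1"
  proof
    show "(\<Union>j. ball (0 :: real ^ 'n) (s j)) \<subseteq> ball 0 1"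
      by (intro UN_least subset_ball less_imp_le s(2))
    show "ball 0 1 \<subseteq> (\<Union>j. ball (0 :: real ^ 'n) (s j))"
    proof
      fix x :: "real ^ 'n" assume "x \<in> ball 0 1"
      then have "eventually (\<lambda>j. norm x < s j) sequentially" using order_tendstoD(1)[OF sl] by simp
      then obtain j where "norm x < s j" by (auto simp: eventually_sequentially)
      then show "x \<in> (\<Union>j. ball (0 :: real ^ 'n) (s j))" by auto
    qed
  qed
  have intD: "set_integrable lborel (ball 0 1) (\<lambda>x. U k x * ?D x)" if k: "k < p" for k
  proof (rule set_integrable_bound)
    show "set_integrable lborel (ball 0 1) (\<lambda>x. Bd * norm (U k x))"
      using set_integrable_norm[OF int[OF k]] by (rule set_integrable_mult_right)
    have "?D \<in> borel_measurable lborel" using cD[of UNIV] by (simp add: borel_measurable_continuous_onI)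
    from borel_measurable_times[OF borel_measurable_integrable[OF int[OF k, unfolded set_integrable_def]] this]
    have "(\<lambda>x. (indicator (ball 0 1) x *\<^sub>R U k x) * ?D x) \<in> borel_measurable lborel" .
    then show "set_borel_measurable lborel (ball 0 1) (\<lambda>x. U k x * ?D x)"
      unfolding set_borel_measurable_def by simp
    show "AE x in lborel. x \<in> ball 0 1 \<longrightarrow> norm (U k x * ?D x) \<le> norm (Bd * norm (U k x))"
    proof (intro AE_I2 impI)
      fix x :: "real ^ 'n" assume "x \<in> ball 0 1"
      then have "norm (?D x) \<le> Bd" by (intro Bd) simp
      then have "norm (U k x) * norm (?D x) \<le> norm (U k x) * \<bar>Bd\<bar>" by (intro mult_left_mono) auto
      then show "norm (U k x * ?D x) \<le> norm (Bd * norm (U k x))" by (simp add: norm_mult mult_ac)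
    qed
  qed
  have "(\<lambda>j. LINT x:ball 0 (s j)|lborel. U k x * ?D x) \<longlonglongrightarrow> (LINT x:ball 0 1|lborel. U k x * ?D x)" if k: "k < p" for k
    using set_integral_cont_up[OF _ mono, of lborel "\<lambda>x. U k x * ?D x"] intD[OF k] unfolding un by simp
  then have "(\<lambda>j. \<Sum>k<p. cis (- (real l * (real k * pi / real p))) * (LINT x:ball 0 (s j)|lborel. U k x * ?D x)) \<longlonglongrightarrow>
      (\<Sum>k<p. cis (- (real l * (real k * pi / real p))) * (LINT x:ball 0 1|lborel. U k x * ?D x))"
    by (intro tendsto_sum tendsto_mult tendsto_const) auto
  then have L1: "(\<lambda>j. of_nat p * (complex_of_real (s j ^ (CARD('n) + l + l)) * ball_inner (q l) d)) \<longlonglongrightarrow>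
      (\<Sum>k<p. cis (- (real l * (real k * pi / real p))) * (LINT x:ball 0 1|lborel. U k x * ?D x))"
    unfolding J[OF s] .
  have L2: "(\<lambda>j. of_nat p * (complex_of_real (s j ^ (CARD('n) + l + l)) * ball_inner (q l) d)) \<longlonglongrightarrow>
      of_nat p * (complex_of_real (1 ^ (CARD('n) + l + l)) * ball_inner (q l) d)"
    by (intro tendsto_mult tendsto_const tendsto_of_real tendsto_power sl)
  show ?thesis using LIMSEQ_unique[OF L1 L2] by simp
qed


text \<open>The elements of the Bergman space are measurable on each rotated ball as limits of polynomials, and
  integrable because they are square integrable and the ball has finite measure.\<close>

lemma bergman_spaceE:
  fixes U :: "complex ^ 'n \<Rightarrow> complex"
  assumes U: "U \<in> bergman_space p" and p: "p \<ge> 1"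
  obtains q where "\<And>m. q m \<in> polyharm_coeffs p (int m)"
    "\<And>k x. k < p \<Longrightarrow> x \<in> ball 0 1 \<Longrightarrow>
      (\<lambda>m. cis (real m * (real k * pi / real p)) * mseries (q m) (cvec x)) sums U (rotate_vec (real k * pi / real p) x)"
    "\<And>k. k < p \<Longrightarrow> set_integrable lborel (ball 0 1) (\<lambda>x. U (rotate_vec (real k * pi / real p) x))"
proof -
  obtain u where u: "u \<in> polyharmonic_ball p" and ext: "extends_to_hat_ball p u U"
    using U unfolding bergman_space_def by blast
  obtain q0 where q0: "\<And>m. q0 m \<in> real_homogeneous_poly m"
    and s0: "\<And>x. x \<in> ball 0 1 \<Longrightarrow> (\<lambda>m. q0 m x) sums u x"
    and sU: "\<And>\<psi> x. x \<in> ball 0 1 \<Longrightarrow> rotate_vec \<psi> x \<in> hat_ball p \<Longrightarrow> (\<lambda>m. cis (real m * \<psi>) * q0 m x) sums U (rotate_vec \<psi> x)"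
    using ext unfolding extends_to_hat_ball_def by blast
  have fin: "ennreal (1 / real p) * (\<Sum>k<p. \<integral>\<^sup>+y\<in>ball 0 1. ennreal ((cmod (U (rotate_vec (real k * pi / real p) y)))\<^sup>2) \<partial>lborel) < \<infinity>"
    using U unfolding bergman_space_def by blast
  obtain q where q: "\<And>m. q m \<in> hom_coeffs (int m)" and qq: "\<And>m. q0 m = (\<lambda>x. mseries (q m) (cvec x))"
    using q0 unfolding real_homogeneous_poly_iff by metis
  have sq: "(\<lambda>m. cis (real m * (real k * pi / real p)) * mseries (q m) (cvec x)) sums U (rotate_vec (real k * pi / real p) x)"
    if "k < p" "x \<in> ball 0 1" for k x
    using sU[OF that(2) rotate_in_hat_ball[OF that(1)]] that(2) unfolding qq by simp
  have meas: "(\<lambda>x. indicator (ball 0 1) x *\<^sub>R U (rotate_vec (real k * pi / real p) x)) \<in> borel_measurable lborel" if k: "k < p" for k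
  proof (rule borel_measurable_LIMSEQ_metric)
    let ?t = "\<lambda>m (x :: real ^ 'n). cis (real m * (real k * pi / real p)) * mseries (q m) (cvec x)"
    show "(\<lambda>x. indicator (ball 0 1) x *\<^sub>R (\<Sum>m<N. ?t m x)) \<in> borel_measurable lborel" for N
    proof (intro borel_measurable_scaleR borel_measurable_indicator)
      have "continuous_on UNIV (\<lambda>x. \<Sum>m<N. ?t m x)" by (intro continuous_intros hom_coeffs_continuous[OF q])
      then show "(\<lambda>x. \<Sum>m<N. ?t m x) \<in> borel_measurable lborel" by (simp add: borel_measurable_continuous_onI)
    qed simp
    show "(\<lambda>N. indicator (ball 0 1) x *\<^sub>R (\<Sum>m<N. ?t m x)) \<longlonglongrightarrow> indicator (ball 0 1) x *\<^sub>R U (rotate_vec (real k * pi / real p) x)" for x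
      using sq[OF k, of x] by (cases "x \<in> ball 0 1") (simp_all add: sums_def)
  qed
  have int: "set_integrable lborel (ball 0 1) (\<lambda>x. U (rotate_vec (real k * pi / real p) x))" if k: "k < p" for k
  proof -
    let ?V = "\<lambda>x. U (rotate_vec (real k * pi / real p) x)"
    let ?g = "\<lambda>x :: real ^ 'n. indicator (ball 0 1) x *\<^sub>R (cmod (?V x))\<^sup>2"
    have "(\<Sum>k<p. \<integral>\<^sup>+y\<in>ball 0 1. ennreal ((cmod (U (rotate_vec (real k * pi / real p) y)))\<^sup>2) \<partial>lborel) < \<infinity>"
      using fin p by (auto simp: ennreal_mult_less_top ennreal_zero_less_divide)
    then have f: "(\<integral>\<^sup>+y\<in>ball 0 1. ennreal ((cmod (?V y))\<^sup>2) \<partial>lborel) < \<infinity>"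
      using k by auto
    have ge: "?g = (\<lambda>x. (norm (indicator (ball 0 1) x *\<^sub>R ?V x))\<^sup>2)"
      by (auto simp: fun_eq_iff indicator_def)
    have "integrable lborel ?g"
    proof (rule integrableI_nonneg)
      show "?g \<in> borel_measurable lborel" unfolding ge by (intro borel_measurable_power measurable_compose[OF meas[OF k] borel_measurable_norm])
      have "(\<integral>\<^sup>+x. ennreal (?g x) \<partial>lborel) = (\<integral>\<^sup>+y\<in>ball 0 1. ennreal ((cmod (?V y))\<^sup>2) \<partial>lborel)"
        by (intro nn_integral_cong) (simp add: indicator_def)
      then show "(\<integral>\<^sup>+x. ennreal (?g x) \<partial>lborel) < \<infinity>" using f by simp
    qed simp
    then have i: "integrable lborel (\<lambda>x. indicator (ball 0 1) x + ?g x)"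
      by (rule Bochner_Integration.integrable_add[OF integrable_indicator_ball])
    show ?thesis
      unfolding set_integrable_def
    proof (rule Bochner_Integration.integrable_bound[OF i meas[OF k]], rule AE_I2)
      fix x :: "real ^ 'n"
      have "norm (?V x) \<le> 1 + (norm (?V x))\<^sup>2"
      proof -
        have "2 * norm (?V x) \<le> 1 + (norm (?V x))\<^sup>2" using sum_squares_bound[of 1 "norm (?V x)"] by simp
        then show ?thesis using norm_ge_zero[of "?V x"] by linarith
      qed
      then show "norm (indicator (ball 0 1) x *\<^sub>R ?V x) \<le> norm (indicator (ball 0 1) x + ?g x)"
        by (simp add: indicator_def)
    qed
  qed
  have "q m \<in> polyharm_coeffs p (int m)" for m
    by (rule expansion_polyharm_coeffs[OF u q]) (use s0 in \<open>simp add: qq\<close>)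
  then show thesis using that sq int by blast
qed

text \<open>Both the kernel and the function are expanded in homogeneous polynomials; the projections of
  the function onto the individual degrees pair with the zonal polynomials to give its terms.\<close>

lemma zonal_kernel_reproducing:
  fixes U :: "complex ^ 'n \<Rightarrow> complex"
  assumes p: "p \<ge> 1" and U: "U \<in> bergman_space p" and y: "y \<in> hat_ball p"
  shows "U y = bergman_inner p U (\<lambda>x. zonal_kernel p x y)"
proof -
  define \<psi> where "\<psi> k = real k * pi / real p" for k
  obtain q where q: "\<And>m. q m \<in> polyharm_coeffs p (int m)"
    and sq: "\<And>k x. k < p \<Longrightarrow> x \<in> ball 0 1 \<Longrightarrow> (\<lambda>m. cis (real m * \<psi> k) * mseries (q m) (cvec x)) sums U (rotate_vec (\<psi> k) x)"
    and int: "\<And>k. k < p \<Longrightarrow> set_integrable lborel (ball 0 1) (\<lambda>x. U (rotate_vec (\<psi> k) x))"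
    using bergman_spaceE[OF U p] unfolding \<psi>_def by blast
  obtain C \<kappa> where \<kappa>: "0 < \<kappa>" "\<kappa> < 1" and B:
    "\<And>m x \<phi>. norm x \<le> 1 \<Longrightarrow> norm (mseries (kernel_coeffs p y m) (rotate_vec \<phi> x)) \<le> C * \<kappa> ^ m"
    using kernel_coeffs_bound[OF y] by metis
  have Uy: "(\<lambda>m. mseries (q m) y) sums U y"
  proof -
    obtain k v where v: "k < p" "norm v < 1" "y = rotate_vec (\<psi> k) v" using hat_ballE[OF y] unfolding \<psi>_def by metis
    then have "v \<in> ball 0 1" by simp
    from sq[OF v(1) this] show ?thesis unfolding v(3) mseries_rotate[OF polyharm_coeffs_hom[OF q]] .
  qed
  let ?f = "\<lambda>k l (x :: real ^ 'n). U (rotate_vec (\<psi> k) x) * cnj (mseries (kernel_coeffs p y l) (rotate_vec (\<psi> k) x))"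
  have J: "(\<lambda>l. LINT x:ball 0 1|lborel. ?f k l x) sums
      (LINT x:ball 0 1|lborel. U (rotate_vec (\<psi> k) x) * cnj (zonal_kernel p (rotate_vec (\<psi> k) x) y))" if k: "k < p" for k
  proof (rule set_integral_sums)
    show "set_borel_measurable lborel (ball 0 1) (?f k l)" for l
    proof -
      have "continuous_on UNIV (\<lambda>x :: real ^ 'n. cnj (mseries (kernel_coeffs p y l) (rotate_vec (\<psi> k) x)))"
        unfolding mseries_rotate[OF kernel_coeffs_hom]
        by (intro continuous_intros hom_coeffs_continuous[OF kernel_coeffs_hom])
      then have "(\<lambda>x :: real ^ 'n. cnj (mseries (kernel_coeffs p y l) (rotate_vec (\<psi> k) x))) \<in> borel_measurable lborel"
        by (simp add: borel_measurable_continuous_onI)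
      from borel_measurable_times[OF borel_measurable_integrable[OF int[OF k, unfolded set_integrable_def]] this]
      have "(\<lambda>x. (indicator (ball 0 1) x *\<^sub>R U (rotate_vec (\<psi> k) x)) * cnj (mseries (kernel_coeffs p y l) (rotate_vec (\<psi> k) x)))
          \<in> borel_measurable lborel" .
      then show ?thesis unfolding set_borel_measurable_def by simp
    qed
    show "set_integrable lborel (ball 0 1) (\<lambda>x. norm (U (rotate_vec (\<psi> k) x)))"
      by (rule set_integrable_norm[OF int[OF k]])
    show "summable (\<lambda>l. C * \<kappa> ^ l)" using \<kappa> by (intro summable_mult summable_geometric) simp
    fix x :: "real ^ 'n" assume x: "x \<in> ball 0 1"
    have "norm (U (rotate_vec (\<psi> k) x)) * norm (mseries (kernel_coeffs p y l) (rotate_vec (\<psi> k) x)) \<le>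
        norm (U (rotate_vec (\<psi> k) x)) * (C * \<kappa> ^ l)" for l
      using x by (intro mult_left_mono B) auto
    then show "norm (?f k l x) \<le> C * \<kappa> ^ l * norm (U (rotate_vec (\<psi> k) x))" for l
      unfolding norm_mult complex_mod_cnj by (simp only: mult.commute)
    have "rotate_vec (\<psi> k) x \<in> hat_ball p" using rotate_in_hat_ball[OF k] x unfolding \<psi>_def by simp
    from kernel_coeffs_sums(2)[OF p this y]
    show "(\<lambda>l. ?f k l x) sums (U (rotate_vec (\<psi> k) x) * cnj (zonal_kernel p (rotate_vec (\<psi> k) x) y))"
      by (intro sums_mult) (simp add: sums_cnj)
  qed
  have T: "(\<Sum>k<p. LINT x:ball 0 1|lborel. ?f k l x) = of_nat p * mseries (q l) y" for l
  proof -
    have "(LINT x:ball 0 1|lborel. ?f k l x) =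
        cis (- (real l * \<psi> k)) * (LINT x:ball 0 1|lborel. U (rotate_vec (\<psi> k) x) * cnj (mseries (kernel_coeffs p y l) (cvec x)))" for k
      unfolding mseries_rotate[OF kernel_coeffs_hom] set_integral_mult_right[symmetric]
      by (simp add: cis_cnj mult_ac)
    then have "(\<Sum>k<p. LINT x:ball 0 1|lborel. ?f k l x) = of_nat p * ball_inner (q l) (kernel_coeffs p y l)"
      using bergman_projection[OF p q kernel_coeffs, of "\<lambda>k x. U (rotate_vec (\<psi> k) x)" l y, folded \<psi>_def, OF sq int] by simp
    also have "ball_inner (q l) (kernel_coeffs p y l) = sphere_form l (q l) (zonal_coeffs p l y)"
    proof -
      let ?c = "complex_of_real (real (CARD('n) + 2 * l) / kernel_const TYPE('n))"
      have "mseries (kernel_coeffs p y l) z = ?c * mseries (zonal_coeffs p l y) z" for z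
        unfolding kernel_coeffs_def by (rule mseries_cmult[OF polyharm_coeffs_hom[OF zonal_coeffs]])
      then have "ball_inner (q l) (kernel_coeffs p y l) = ?c * ball_inner (q l) (zonal_coeffs p l y)"
        unfolding ball_inner_def set_integral_mult_right[symmetric] by (simp add: mult_ac)
      then show ?thesis by (simp add: sphere_form_def kernel_const_def)
    qed
    also have "\<dots> = mseries (q l) y" by (rule zonal_coeffs_reproducing[OF q, symmetric])
    finally show ?thesis .
  qed
  have "(\<lambda>l. \<Sum>k<p. LINT x:ball 0 1|lborel. ?f k l x) sums
      (\<Sum>k<p. LINT x:ball 0 1|lborel. U (rotate_vec (\<psi> k) x) * cnj (zonal_kernel p (rotate_vec (\<psi> k) x) y))"
    by (intro sums_sum J) simp
  then have "(\<Sum>k<p. LINT x:ball 0 1|lborel. U (rotate_vec (\<psi> k) x) * cnj (zonal_kernel p (rotate_vec (\<psi> k) x) y)) = of_nat p * U y"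
    unfolding T using sums_mult[OF Uy, of "of_nat p"] by (rule sums_unique2)
  then show ?thesis using p unfolding bergman_inner_def \<psi>_def[symmetric] by simp
qed

lemma zonal_kernel_is_bergman_kernel: "p \<ge> 1 \<Longrightarrow> is_bergman_kernel p (zonal_kernel p)"
  unfolding is_bergman_kernel_def using zonal_kernel_in_bergman_space zonal_kernel_reproducing by blast

lemma bergman_inner_commute: "bergman_inner p v u = cnj (bergman_inner p u v)"
  unfolding bergman_inner_def complex_cnj_mult cnj_sum
  by (simp add: set_lebesgue_integral_def mult.commute flip: Bochner_Integration.integral_cnj)

text \<open>Two kernels agree on the domain because each reproduces the other; outside of it both are zero, by
  the conventions on kernels and on elements of the space.\<close>

lemma bergman_kernel_eq_zonal_kernel:
  assumes p: "p \<ge> 1"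
  shows "bergman_kernel p = (zonal_kernel p :: complex ^ 'n \<Rightarrow> complex ^ 'n \<Rightarrow> complex)"
  unfolding bergman_kernel_def
proof (rule the_equality)
  show "is_bergman_kernel p (zonal_kernel p) \<and> (\<forall>x y. y \<notin> hat_ball p \<longrightarrow> zonal_kernel p x y = 0)"
    using zonal_kernel_is_bergman_kernel[OF p] by (simp add: zonal_kernel_def)
  fix R :: "complex ^ 'n \<Rightarrow> complex ^ 'n \<Rightarrow> complex"
  assume R: "is_bergman_kernel p R \<and> (\<forall>x y. y \<notin> hat_ball p \<longrightarrow> R x y = 0)"
  have sym: "R' x y = cnj (zonal_kernel p y x)"
    if R': "is_bergman_kernel p R'" and x: "x \<in> hat_ball p" and y: "y \<in> hat_ball p" for R' x y
  proof -
    have "(\<lambda>z. R' z y) \<in> bergman_space p" and rep: "\<forall>u\<in>bergman_space p. u y = bergman_inner p u (\<lambda>z. R' z y)"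
      using R' y unfolding is_bergman_kernel_def by blast+
    then have "R' x y = bergman_inner p (\<lambda>z. R' z y) (\<lambda>z. zonal_kernel p z x)"
      using zonal_kernel_reproducing[OF p _ x] by blast
    also have "\<dots> = cnj (bergman_inner p (\<lambda>z. zonal_kernel p z x) (\<lambda>z. R' z y))" by (rule bergman_inner_commute)
    also have "bergman_inner p (\<lambda>z. zonal_kernel p z x) (\<lambda>z. R' z y) = zonal_kernel p y x"
      by (rule bspec[OF rep zonal_kernel_in_bergman_space[OF p x], symmetric])
    finally show ?thesis .
  qed
  show "R = zonal_kernel p"
  proof (intro ext)
    fix x y :: "complex ^ 'n"
    consider "y \<notin> hat_ball p" | "y \<in> hat_ball p" "x \<notin> hat_ball p" | "x \<in> hat_ball p" "y \<in> hat_ball p" by blast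
    then show "R x y = zonal_kernel p x y"
    proof cases
      case 1 then show ?thesis using R by (simp add: zonal_kernel_def)
    next
      case 2
      then have "(\<lambda>z. R z y) \<in> bergman_space p" using R unfolding is_bergman_kernel_def by blast
      then have "R x y = 0" using 2 unfolding bergman_space_def extends_to_hat_ball_def by blast
      then show ?thesis using 2 by (simp add: zonal_kernel_def)
    next
      case 3 then show ?thesis
        using sym[OF _ 3, of R] sym[OF zonal_kernel_is_bergman_kernel[OF p] 3] R by simp
    qed
  qed
qed

text \<open>The norm attains its maximum on the compact set, so the radii stay away from 1; this leaves room
  for the slowly growing exponential in the bound on the zonal polynomials.\<close>

lemma zonal_geometric_bound:
  fixes K :: "(complex ^ 'n) set"
  assumes p: "p \<ge> 1" and K: "compact K" "K \<subseteq> hat_ball p"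
  obtains M where "summable M"
    "\<And>m x (y :: complex ^ 'n). x \<in> K \<Longrightarrow> y \<in> hat_ball p \<Longrightarrow> norm (of_nat (CARD('n) + 2 * m) * zonal p m x y) \<le> M m"
proof (cases "K = {}")
  case True
  have "summable (\<lambda>_ :: nat. 0 :: real)" by simp
  then show thesis by (rule that) (use True in auto)
next
  case False
  have "continuous_on K (norm :: complex ^ 'n \<Rightarrow> real)" by (intro continuous_intros)
  from continuous_attains_sup[OF K(1) False this] obtain x0 where x0: "x0 \<in> K" "\<And>x. x \<in> K \<Longrightarrow> norm x \<le> norm x0"
    by blast
  define t where "t = norm x0"
  have t: "0 \<le> t" "t < 1" using x0(1) K(2) hat_ball_norm_less by (auto simp: t_def)
  obtain \<epsilon> where \<epsilon>: "\<epsilon> > 0" and et: "(1 + \<epsilon>) * t < 1" using geometric_room[OF t] by blast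
  obtain C where C: "C > 0" and B: "\<And>m (x :: real ^ 'n) (y :: real ^ 'n) \<phi> \<psi>.
      real (CARD('n) + 2 * m) * norm (mseries (zonal_coeffs p m (rotate_vec \<psi> y)) (rotate_vec \<phi> x)) \<le>
      C * (1 + \<epsilon>) ^ m * norm x ^ m * norm y ^ m"
    using weighted_zonal_bound[OF \<epsilon>, where 'n='n and p=p] by blast
  show thesis
  proof (rule that)
    show "summable (\<lambda>m. C * ((1 + \<epsilon>) * t) ^ m)" using t \<epsilon> et by (intro summable_mult summable_geometric) simp
    fix m x and y :: "complex ^ 'n" assume x: "x \<in> K" and y: "y \<in> hat_ball p"
    have xh: "x \<in> hat_ball p" using x K(2) by blast
    obtain k v where v: "norm v < 1" "x = rotate_vec (real k * pi / real p) v" using hat_ballE[OF xh] by metis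
    obtain j w where w: "norm w < 1" "y = rotate_vec (real j * pi / real p) w" using hat_ballE[OF y] by metis
    have vt: "norm v \<le> t" using x0(2)[OF x] unfolding v(2) t_def by simp
    have "norm (of_nat (CARD('n) + 2 * m) * zonal p m x y) =
        real (CARD('n) + 2 * m) * norm (mseries (zonal_coeffs p m y) x)"
      unfolding zonal_eq[OF p xh y] norm_mult norm_of_nat ..
    also have "\<dots> \<le> C * (1 + \<epsilon>) ^ m * norm v ^ m * norm w ^ m" unfolding v(2) w(2) by (rule B)
    also have "\<dots> \<le> C * (1 + \<epsilon>) ^ m * t ^ m * 1"
      using C \<epsilon> t vt w(1) by (intro mult_mono mult_left_mono power_mono power_le_one) auto
    also have "\<dots> = C * ((1 + \<epsilon>) * t) ^ m" by (simp add: power_mult_distrib)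
    finally show "norm (of_nat (CARD('n) + 2 * m) * zonal p m x y) \<le> C * ((1 + \<epsilon>) * t) ^ m" .
  qed
qed

theorem theorem1:
  fixes p :: nat
  assumes "p \<ge> 1"
  shows "(\<forall>x\<in>hat_ball p. \<forall>y\<in>hat_ball p.
            bergman_kernel p x (y :: complex ^ 'n) =
              1 / complex_of_real (real CARD('n) * unit_ball_vol (real CARD('n))) *
              (\<Sum>m. of_nat (CARD('n) + 2 * m) * zonal p m x y))
       \<and> (\<forall>K :: (complex ^ 'n) set. compact K \<and> K \<subseteq> hat_ball p \<longrightarrow>
            (\<forall>x\<in>K. \<forall>y\<in>hat_ball p.
               summable (\<lambda>m. norm (of_nat (CARD('n) + 2 * m) * zonal p m x y))) \<and>
            uniform_limit (K \<times> hat_ball p)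
              (\<lambda>N (x, y). \<Sum>m<N. of_nat (CARD('n) + 2 * m) * zonal p m x y)
              (\<lambda>(x, y). \<Sum>m. of_nat (CARD('n) + 2 * m) * zonal p m x y)
              sequentially)"
proof (intro conjI ballI allI impI)
  fix x y :: "complex ^ 'n" assume "x \<in> hat_ball p" "y \<in> hat_ball p"
  then show "bergman_kernel p x y = 1 / complex_of_real (real CARD('n) * unit_ball_vol (real CARD('n))) *
      (\<Sum>m. of_nat (CARD('n) + 2 * m) * zonal p m x y)"
    unfolding bergman_kernel_eq_zonal_kernel[OF assms] zonal_kernel_def kernel_const_def by simp
next
  fix K :: "(complex ^ 'n) set" and x y :: "complex ^ 'n"
  assume K: "compact K \<and> K \<subseteq> hat_ball p" and xy: "x \<in> K" "y \<in> hat_ball p"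
  obtain M where M: "summable M"
    "\<And>m x (y :: complex ^ 'n). x \<in> K \<Longrightarrow> y \<in> hat_ball p \<Longrightarrow> norm (of_nat (CARD('n) + 2 * m) * zonal p m x y) \<le> M m"
    using zonal_geometric_bound[OF assms] K by blast
  show "summable (\<lambda>m. norm (of_nat (CARD('n) + 2 * m) * zonal p m x y))"
    by (rule summable_comparison_test'[OF M(1)]) (use M(2)[OF xy] in simp)
next
  fix K :: "(complex ^ 'n) set"
  assume K: "compact K \<and> K \<subseteq> hat_ball p"
  obtain M where M: "summable M"
    "\<And>m x (y :: complex ^ 'n). x \<in> K \<Longrightarrow> y \<in> hat_ball p \<Longrightarrow> norm (of_nat (CARD('n) + 2 * m) * zonal p m x y) \<le> M m"
    using zonal_geometric_bound[OF assms] K by blast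
  have "uniform_limit (K \<times> hat_ball p)
      (\<lambda>N z. \<Sum>m<N. of_nat (CARD('n) + 2 * m) * zonal p m (fst z) (snd z))
      (\<lambda>z. \<Sum>m. of_nat (CARD('n) + 2 * m) * zonal p m (fst z) (snd z)) sequentially"
    by (rule Weierstrass_m_test[OF _ M(1)]) (rule M(2), auto)
  then show "uniform_limit (K \<times> hat_ball p)
      (\<lambda>N (x, y). \<Sum>m<N. of_nat (CARD('n) + 2 * m) * zonal p m x y)
      (\<lambda>(x, y). \<Sum>m. of_nat (CARD('n) + 2 * m) * zonal p m x y) sequentially"
    by (simp only: case_prod_beta')
qed

end
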